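(* Let $G=(V,E)$ be a 2-edge-connected graph with nonnegative edge weights $w$, and let $z_G=\min\{\sum_{e\in E}w(e)x_e : x\in\textsc{Subtour}(G)\}$. If $w(E)\le\beta\cdot z_G$ for a real $\beta$, then there is a polynomial-time $\frac{1+2\beta}{3}$-approximation algorithm for 2EC on $G$.
   Context: $\textsc{Subtour}(G)=\{x\in\mathbb{R}^E: x(\delta(S))\ge 2 \text{ for all } \emptyset\ne S\subsetneq V,\ x\ge 0\}$, where $\delta(S)$ is the set of edges with exactly one endpoint in $S$. $w(E)=\sum_{e\in E}w(e)$. A multigraph of $G$ is a multiset of edges of $G$; its weight counts edges with multiplicity. A 2-edge-connected spanning multigraph of $G$ is a multigraph of $G$ spanning $V$ that remains connected after removal of any single copy of any edge; 2EC asks for a minimum weight such multigraph. A $\rho$-approximation algorithm outputs a feasible solution of weight at most $\rho$ times the optimum. *)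

theory Defs
  imports Complex_Main "HOL-Library.Multiset" "HOL-Library.FuncSet"
    "HOL-Computational_Algebra.Polynomial"
begin

section \<open>Graphs, the subtour relaxation and 2EC\<close>

text \<open>
  A graph is a finite set of vertices together with a set of two-element subsets of it.
  Vertices are natural numbers so that graphs can be given to a program as input.
\<close>

definition graph :: "nat set \<Rightarrow> nat set set \<Rightarrow> bool" where
  "graph V E \<longleftrightarrow> finite V \<and> V \<noteq> {} \<and> (\<forall>e\<in>E. e \<subseteq> V \<and> card e = 2)"

definition connected_graph :: "nat set \<Rightarrow> nat set set \<Rightarrow> bool" where
  "connected_graph V E \<longleftrightarrow> (\<forall>u\<in>V. \<forall>v\<in>V. (u, v) \<in> {(a, b). {a, b} \<in> E}\<^sup>*)"

text \<open>Subtracting \<open>{#e#}\<close> removes a single copy of \<open>e\<close>.\<close>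

definition two_edge_connected :: "nat set \<Rightarrow> nat set multiset \<Rightarrow> bool" where
  "two_edge_connected V M \<longleftrightarrow>
     connected_graph V (set_mset M) \<and> (\<forall>e\<in>#M. connected_graph V (set_mset (M - {#e#})))"

definition two_edge_connected_graph :: "nat set \<Rightarrow> nat set set \<Rightarrow> bool" where
  "two_edge_connected_graph V E \<longleftrightarrow> graph V E \<and> two_edge_connected V (mset_set E)"

definition cut :: "nat set set \<Rightarrow> nat set \<Rightarrow> nat set set" where
  "cut E S = {e \<in> E. card (e \<inter> S) = 1}"

definition Subtour :: "nat set \<Rightarrow> nat set set \<Rightarrow> (nat set \<Rightarrow> real) set" where
  "Subtour V E =
     {x \<in> E \<rightarrow>\<^sub>E {0..}. \<forall>S. S \<noteq> {} \<and> S \<subset> V \<longrightarrow> (\<Sum>e\<in>cut E S. x e) \<ge> 2}"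

text \<open>
  For a two-edge-connected graph and nonnegative weights, the infima in the following
  definition and in that of \<open>opt_2EC\<close> below are minima.
\<close>

definition subtour_value :: "nat set \<Rightarrow> nat set set \<Rightarrow> (nat set \<Rightarrow> real) \<Rightarrow> real" where
  "subtour_value V E w = (INF x\<in>Subtour V E. \<Sum>e\<in>E. w e * x e)"

definition feasible_2EC :: "nat set \<Rightarrow> nat set set \<Rightarrow> nat set multiset set" where
  "feasible_2EC V E = {M. set_mset M \<subseteq> E \<and> two_edge_connected V M}"

definition weight :: "(nat set \<Rightarrow> real) \<Rightarrow> nat set multiset \<Rightarrow> real" where
  "weight w M = (\<Sum>e\<in>#M. w e)"

definition opt_2EC :: "nat set \<Rightarrow> nat set set \<Rightarrow> (nat set \<Rightarrow> real) \<Rightarrow> real" where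
  "opt_2EC V E w = (INF M\<in>feasible_2EC V E. weight w M)"


section \<open>Polynomial time\<close>

text \<open>
  The machine model is the WHILE language over binary trees (N. D. Jones, Computability
  and Complexity from a Programming Perspective, MIT Press 1997). An assignment is charged
  for the size of the assigned tree, because with unit cost repeated \<open>X := (X . X)\<close> would
  build a tree of exponential size in linear time. With this charge the total size of the store
  is bounded by the size of the input plus the elapsed time, so running times agree with those
  of Turing machines up to a polynomial.
\<close>

datatype tree = Leaf | Node tree tree

fun left :: "tree \<Rightarrow> tree" where
  "left Leaf = Leaf"
| "left (Node l r) = l"

fun right :: "tree \<Rightarrow> tree" where
  "right Leaf = Leaf"
| "right (Node l r) = r"

datatype exp = Var nat | Const_Leaf | Mk_Node exp exp | Left exp | Right exp | Equal exp exp

type_synonym store = "nat \<Rightarrow> tree"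

text \<open>As a truth value, \<open>Leaf\<close> is false and every other tree is true.\<close>

fun eval_exp :: "exp \<Rightarrow> store \<Rightarrow> tree" where
  "eval_exp (Var x) s = s x"
| "eval_exp Const_Leaf s = Leaf"
| "eval_exp (Mk_Node a b) s = Node (eval_exp a s) (eval_exp b s)"
| "eval_exp (Left a) s = left (eval_exp a s)"
| "eval_exp (Right a) s = right (eval_exp a s)"
| "eval_exp (Equal a b) s = (if eval_exp a s = eval_exp b s then Node Leaf Leaf else Leaf)"

datatype com = Skip | Assign nat exp | Seq com com | Cond exp com com | While exp com

text \<open>\<open>exec c s t s'\<close>: started in \<open>s\<close>, the program \<open>c\<close> halts in \<open>s'\<close> after time \<open>t\<close>.\<close>

inductive exec :: "com \<Rightarrow> store \<Rightarrow> nat \<Rightarrow> store \<Rightarrow> bool" where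
  Skip: "exec Skip s 1 s"
| Assign: "exec (Assign x a) s (1 + size (eval_exp a s)) (s(x := eval_exp a s))"
| Seq: "exec c1 s t1 s' \<Longrightarrow> exec c2 s' t2 s'' \<Longrightarrow> exec (Seq c1 c2) s (t1 + t2) s''"
| CondTrue: "eval_exp b s \<noteq> Leaf \<Longrightarrow> exec c1 s t s' \<Longrightarrow> exec (Cond b c1 c2) s (1 + t) s'"
| CondFalse: "eval_exp b s = Leaf \<Longrightarrow> exec c2 s t s' \<Longrightarrow> exec (Cond b c1 c2) s (1 + t) s'"
| WhileFalse: "eval_exp b s = Leaf \<Longrightarrow> exec (While b c) s 1 s"
| WhileTrue: "eval_exp b s \<noteq> Leaf \<Longrightarrow> exec c s t1 s' \<Longrightarrow> exec (While b c) s' t2 s'' \<Longrightarrow>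
    exec (While b c) s (1 + t1 + t2) s''"

text \<open>Variable 0 holds the input at the start and the output at the end.\<close>

definition runs :: "com \<Rightarrow> tree \<Rightarrow> nat \<Rightarrow> tree \<Rightarrow> bool" where
  "runs c input t output \<longleftrightarrow> (\<exists>s. exec c ((\<lambda>_. Leaf)(0 := input)) t s \<and> s 0 = output)"

text \<open>
  \<open>R input\<close> is the set of correct outputs on \<open>input\<close>; inputs outside the set \<open>D\<close> of admissible
  inputs are unconstrained.
\<close>

definition solves_in_poly_time :: "com \<Rightarrow> tree set \<Rightarrow> (tree \<Rightarrow> tree set) \<Rightarrow> bool" where
  "solves_in_poly_time c D R \<longleftrightarrow>
     (\<exists>p :: nat poly. \<forall>input\<in>D. \<exists>t output.
        runs c input t output \<and> t \<le> poly p (size input) \<and> output \<in> R input)"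


section \<open>Encoding of instances and solutions\<close>

text \<open>Binary notation, least significant bit first.\<close>

fun enc_nat :: "nat \<Rightarrow> tree" where
  "enc_nat n = (if n = 0 then Leaf
     else Node (if odd n then Node Leaf Leaf else Leaf) (enc_nat (n div 2)))"

declare enc_nat.simps [simp del]

fun enc_list :: "('a \<Rightarrow> tree) \<Rightarrow> 'a list \<Rightarrow> tree" where
  "enc_list f [] = Leaf"
| "enc_list f (x # xs) = Node (f x) (enc_list f xs)"

text \<open>Numerator and denominator in lowest terms; used for nonnegative numbers only.\<close>

definition enc_rat :: "rat \<Rightarrow> tree" where
  "enc_rat r = (let (a, b) = quotient_of r in Node (enc_nat (nat a)) (enc_nat (nat b)))"

definition enc_pair :: "nat \<times> nat \<Rightarrow> tree" where
  "enc_pair p = Node (enc_nat (fst p)) (enc_nat (snd p))"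

definition edge_of :: "nat \<times> nat \<Rightarrow> nat set" where
  "edge_of p = {fst p, snd p}"

definition enc_instance :: "nat list \<Rightarrow> (nat \<times> nat) list \<Rightarrow> (nat set \<Rightarrow> rat) \<Rightarrow> tree" where
  "enc_instance vs es w =
     Node (enc_list enc_nat vs)
          (enc_list (\<lambda>p. Node (enc_pair p) (enc_rat (w (edge_of p)))) es)"

text \<open>
  An instance has several encodings: vertices and edges may be listed in any order, and
  the endpoints of an edge may be given in either order.
\<close>

definition encodes_instance ::
    "tree \<Rightarrow> nat set \<Rightarrow> nat set set \<Rightarrow> (nat set \<Rightarrow> rat) \<Rightarrow> bool" where
  "encodes_instance d V E w \<longleftrightarrow>
     (\<exists>vs es. distinct vs \<and> set vs = V \<and>
        distinct (map edge_of es) \<and> set (map edge_of es) = E \<and> d = enc_instance vs es w)"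

text \<open>A multigraph is output as the list of its edges, each repeated according to multiplicity.\<close>

definition encodes_multigraph :: "tree \<Rightarrow> nat set multiset \<Rightarrow> bool" where
  "encodes_multigraph d M \<longleftrightarrow> (\<exists>ps. mset (map edge_of ps) = M \<and> d = enc_list enc_pair ps)"


section \<open>Approximation algorithms for 2EC\<close>

text \<open>
  \<open>\<I>\<close> is the class of instances on which the algorithm is required to work. Weights
  are rational since they are part of the input of the program.
\<close>

definition poly_time_approx_2EC ::
    "real \<Rightarrow> (nat set \<times> nat set set \<times> (nat set \<Rightarrow> rat)) set \<Rightarrow> com \<Rightarrow> bool" where
  "poly_time_approx_2EC \<rho> \<I> c \<longleftrightarrow>
     solves_in_poly_time c
       {d. \<exists>(V, E, w)\<in>\<I>. encodes_instance d V E w}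
       (\<lambda>d. {d'. \<forall>(V, E, w)\<in>\<I>. encodes_instance d V E w \<longrightarrow>
          (\<exists>M. encodes_multigraph d' M \<and> M \<in> feasible_2EC V E \<and>
             weight (real_of_rat \<circ> w) M \<le> \<rho> * opt_2EC V E (real_of_rat \<circ> w))})"

end

(*
Call two edges partners if they form a cut of size two. The penalty p(e) of an edge is the total
weight of its partners, and its excess is w(e) - min(w(e), p(e)). Let T be a spanning tree of
minimum excess, and let L be the set of remaining edges, the links. Every tree edge is crossed
(its fundamental cut is met) by a link; if it is crossed by only one, the two are partners.

The links can be coloured with three colours so that every tree edge crossed by at least two links
is crossed by two colours (Cheriyan, Jordan and Ravi). Hence for each colour i the tree, together
with the links of other colours, becomes 2-edge-connected once each link l of colour i is either
kept or paid for by doubling its partners in T. Taking the cheaper option, the three solutions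
together weigh at most
  3 w(T) + sum over L of (2 w + min(w, p)) = 2 w(E) + (sum over E of min(w, p)) + excess(T).
The last two terms are at most the weight of every point x of the subtour polytope: being partners
is an equivalence relation, on each class x may be replaced by its minimum at the cost of the term
min(w, p), and the resulting vector still dominates a spanning tree of the edges of positive excess.
So the lightest of the three solutions has weight at most (2 w(E) + z) / 3.
*)
theory Submission
  imports Defs
begin

section \<open>Connectivity and cuts\<close>

text \<open>No linear program is solved. The algorithm uses only weights and partner tests, and the
  lower bound is proved for every point x separately, so it passes to the infimum.

  The excess comes from the accounting: over the three solutions a tree edge costs 3 w and a link is
  charged 2 w + min(w, p). The difference is w - min(w, p), which makes a tree of minimum excess the
  right choice.

  The difficulty is to find both min(w, p) and the tree inside one x. Two partners carry at least 2
  between them, so when the smallest value in a class is below 1, all other members carry a surplus,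
  and this pays for min(w, p). The classwise minimum that remains may be too small on a cut with two
  partners. On other cuts it is still at least 2, because an edge can be exchanged for the partner
  attaining the minimum. Edges of positive excess are never partners, so the cuts between components
  of the cheaper edges are of the good kind. Comparing tree and x at one threshold of the excess at
  a time then leaves only a count of components.\<close>

definition con :: "nat set set \<Rightarrow> nat \<Rightarrow> nat \<Rightarrow> bool" where
  "con F u v \<longleftrightarrow> (u, v) \<in> {(a, b). {a, b} \<in> F}\<^sup>*"

lemma con_refl [simp]: "con F u u"
  by (simp add: con_def)

lemma con_edge: "{a, b} \<in> F \<Longrightarrow> con F a b"
  by (auto simp: con_def)

lemma con_trans: "con F u v \<Longrightarrow> con F v w \<Longrightarrow> con F u w"
  unfolding con_def by (rule rtrancl_trans)

lemma con_sym: "con F u v \<Longrightarrow> con F v u"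
proof -
  have "sym {(a, b). {a, b} \<in> F}" by (auto intro!: symI simp: insert_commute)
  then show "con F u v \<Longrightarrow> con F v u" unfolding con_def using sym_rtrancl symD by metis
qed

text \<open>The working form of connectivity: separations are proved by exhibiting a set closed
  under the edges of \<open>F\<close>.\<close>

lemma con_closed:
  assumes "con F u v" "u \<in> S" "\<And>a b. {a, b} \<in> F \<Longrightarrow> a \<in> S \<Longrightarrow> b \<in> S"
  shows "v \<in> S"
  using assms(1) unfolding con_def
  by (induction rule: rtrancl_induct) (use assms(2,3) in auto)

lemma con_subset:
  assumes "\<And>a b. {a, b} \<in> F \<Longrightarrow> con G a b" "con F u v"
  shows "con G u v"
  using con_closed[OF assms(2), of "{v. con G u v}"] assms(1) con_trans by auto

lemma con_mono: "F \<subseteq> G \<Longrightarrow> con F u v \<Longrightarrow> con G u v"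
  using con_subset[of F G] con_edge by blast

text \<open>A walk can be shortened to use the new edge at most once. Formally, the right-hand side
  describes a set closed under all edges.\<close>

lemma con_insert:
  assumes "con (insert {a, b} F) x y"
  shows "con F x y \<or> con F x a \<and> con F b y \<or> con F x b \<and> con F a y"
proof -
  let ?S = "{y. con F x y \<or> con F x a \<and> con F b y \<or> con F x b \<and> con F a y}"
  have "y \<in> ?S"
  proof (rule con_closed[OF assms])
    fix c d assume cd: "{c, d} \<in> insert {a, b} F" "c \<in> ?S"
    show "d \<in> ?S"
    proof (cases "{c, d} \<in> F")
      case True
      then show ?thesis using cd(2) con_edge[OF True] con_trans by blast
    next
      case False
      then have "c = a \<and> d = b \<or> c = b \<and> d = a" using cd(1) by (auto simp: doubleton_eq_iff)
      then show ?thesis using cd(2) by auto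
    qed
  qed simp
  then show ?thesis by simp
qed

section \<open>Connected components and their number\<close>

definition component :: "nat set \<Rightarrow> nat set set \<Rightarrow> nat \<Rightarrow> nat set" where
  "component V F v = {u \<in> V. con F v u}"

definition components :: "nat set \<Rightarrow> nat set set \<Rightarrow> nat set set" where
  "components V F = component V F ` V"

lemma finite_components [simp]: "finite V \<Longrightarrow> finite (components V F)"
  by (simp add: components_def)

lemma component_self: "v \<in> V \<Longrightarrow> v \<in> component V F v"
  by (simp add: component_def)

lemma component_eq_iff: "u \<in> V \<Longrightarrow> v \<in> V \<Longrightarrow> component V F u = component V F v \<longleftrightarrow> con F u v"
proof
  assume "v \<in> V" "component V F u = component V F v"
  then have "v \<in> component V F u" using component_self[of v V F] by simp
  then show "con F u v" by (simp add: component_def)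
next
  assume *: "con F u v"
  have "con F u x \<longleftrightarrow> con F v x" for x
    using con_trans[OF *, of x] con_trans[OF con_sym[OF *], of x] by blast
  then show "component V F u = component V F v" by (simp add: component_def)
qed

text \<open>Closing the components of \<open>F\<close> under reachability in \<open>G\<close>
  produces every component of \<open>G\<close>. The hypothesis compares reachability and not edge
  sets, since the lemma is applied with a forest \<open>G\<close> inside the graph
  \<open>F\<close>.\<close>

lemma components_antimono:
  assumes "finite V" "\<And>u v. con F u v \<Longrightarrow> con G u v"
  shows "card (components V G) \<le> card (components V F)"
proof -
  have "card (components V G) \<le> card ((\<lambda>C. {u \<in> V. \<exists>v\<in>C. con G v u}) ` components V F)"
  proof (rule card_mono)
    show "components V G \<subseteq> (\<lambda>C. {u \<in> V. \<exists>v\<in>C. con G v u}) ` components V F"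
    proof
      fix C assume "C \<in> components V G"
      then obtain v where v: "v \<in> V" "C = component V G v" by (auto simp: components_def)
      have "con G v u \<longleftrightarrow> (\<exists>v'. v' \<in> V \<and> con F v v' \<and> con G v' u)" for u
      proof
        assume "con G v u"
        then show "\<exists>v'. v' \<in> V \<and> con F v v' \<and> con G v' u" using v(1) con_refl[of F v] by metis
      qed (metis assms(2) con_trans)
      then have "C = {u \<in> V. \<exists>v\<in>component V F v. con G v u}"
        unfolding v(2) component_def by blast
      then show "C \<in> (\<lambda>C. {u \<in> V. \<exists>v\<in>C. con G v u}) ` components V F"
        using v(1) by (auto simp: components_def)
    qed
  qed (use assms in simp)
  also have "\<dots> \<le> card (components V F)"
    by (rule card_image_le) (use assms in simp)
  finally show ?thesis .
qed

lemma components_insert: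
  assumes "finite V" "a \<in> V" "b \<in> V"
  shows "components V (insert {a, b} F) =
    insert (component V F a \<union> component V F b) (components V F - {component V F a, component V F b})"
    (is "?L = ?R")
proof -
  let ?G = "insert {a, b} F"
  have ab: "con ?G a b" by (rule con_edge) simp
  have FG: "con F u v \<Longrightarrow> con ?G u v" for u v by (rule con_mono[of F]) auto
  have 1: "component V ?G v = component V F a \<union> component V F b"
    if "con F a v \<or> con F b v" "v \<in> V" for v
  proof -
    have av: "con ?G a v" using that(1) FG[of a v] con_trans[OF ab FG[of b v]] by blast
    show ?thesis
    proof (intro set_eqI iffI)
      fix u assume "u \<in> component V ?G v"
      then have "con ?G a u" "u \<in> V" using con_trans[OF av] by (auto simp: component_def)
      with con_insert[of a b F a u] show "u \<in> component V F a \<union> component V F b"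
        by (auto simp: component_def)
    next
      fix u assume "u \<in> component V F a \<union> component V F b"
      then have "con ?G a u" "u \<in> V"
        using FG[of a u] con_trans[OF ab FG[of b u]] by (auto simp: component_def)
      then show "u \<in> component V ?G v" using con_trans[OF con_sym[OF av]] by (simp add: component_def)
    qed
  qed
  have 2: "component V ?G v = component V F v" if "\<not> con F a v" "\<not> con F b v" for v
  proof -
    have "con ?G v u \<longleftrightarrow> con F v u" for u
      using con_insert[of a b F v u] that con_sym[of F v] FG[of v u] by blast
    then show ?thesis by (simp add: component_def)
  qed
  have 3: "component V F v = component V F a \<longleftrightarrow> con F a v" "component V F v = component V F b \<longleftrightarrow> con F b v"
    if "v \<in> V" for v
    using component_eq_iff[OF assms(2) that, of F] component_eq_iff[OF assms(3) that, of F] by metis+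
  show ?thesis
  proof (intro set_eqI iffI)
    fix C assume "C \<in> ?L"
    then obtain v where v: "v \<in> V" "C = component V ?G v" by (auto simp: components_def)
    show "C \<in> ?R"
    proof (cases "con F a v \<or> con F b v")
      case True
      then show ?thesis using 1[OF True v(1)] v(2) by simp
    next
      case False
      then show ?thesis using 2[of v] 3[OF v(1)] v by (simp add: components_def)
    qed
  next
    fix C assume C: "C \<in> ?R"
    show "C \<in> ?L"
    proof (cases "C = component V F a \<union> component V F b")
      case True
      then have "C = component V ?G a" using 1[of a] assms(2) by simp
      then show ?thesis using assms(2) by (simp add: components_def)
    next
      case False
      then obtain v where v: "v \<in> V" "C = component V F v" "C \<noteq> component V F a" "C \<noteq> component V F b"
        using C by (auto simp: components_def)
      then have "C = component V ?G v" using 2[of v] 3[OF v(1)] by simp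
      then show ?thesis using v(1) by (simp add: components_def)
    qed
  qed
qed

lemma card_components_insert_ge:
  assumes "finite V" "a \<in> V" "b \<in> V"
  shows "card (components V F) \<le> card (components V (insert {a, b} F)) + 1"
proof -
  let ?A = "component V F a" and ?B = "component V F b"
  let ?C = "components V F - {?A, ?B}"
  have "?A \<union> ?B \<notin> ?C"
  proof
    assume "?A \<union> ?B \<in> ?C"
    then obtain v where v: "v \<in> V" "?A \<union> ?B = component V F v" "component V F v \<noteq> ?A"
      by (auto simp: components_def)
    then have "a \<in> component V F v" using component_self[OF assms(2), of F] by blast
    then have "con F v a" by (simp add: component_def)
    then show False using v component_eq_iff[OF v(1) assms(2)] by simp
  qed
  then have "card (components V (insert {a, b} F)) = Suc (card ?C)"
    unfolding components_insert[OF assms] using assms(1) by simp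
  moreover have "card (components V F) \<le> card ?C + 2"
  proof -
    have "card (components V F) \<le> card (insert ?A (insert ?B ?C))"
      using assms(1) by (intro card_mono) auto
    also have "\<dots> \<le> card ?C + 2"
    proof -
      have "card (insert X S) \<le> Suc (card S)" for X and S :: "nat set set"
        by (cases "finite S") (simp_all add: card_insert_if)
      from this[of ?A "insert ?B ?C"] this[of ?B ?C] show ?thesis by linarith
    qed
    finally show ?thesis .
  qed
  ultimately show ?thesis by simp
qed

lemma card_components_insert_less:
  assumes "finite V" "a \<in> V" "b \<in> V" "\<not> con F a b"
  shows "card (components V (insert {a, b} F)) < card (components V F)"
proof -
  let ?A = "component V F a" and ?B = "component V F b"
  have AB: "?A \<noteq> ?B" using component_eq_iff assms by blast
  have sub: "{?A, ?B} \<subseteq> components V F" using assms by (auto simp: components_def)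
  then have "card (components V F - {?A, ?B}) = card (components V F) - 2"
    using AB assms(1) by (subst card_Diff_subset) auto
  moreover have "2 \<le> card (components V F)"
    using card_mono[OF _ sub] AB assms(1) by simp
  ultimately show ?thesis
    unfolding components_insert[OF assms(1-3)] using assms(1) 
    by (intro le_less_trans[OF card_insert_le_m1[of "card (components V F) - 1"]]) auto
qed

section \<open>Cuts, partner classes, penalty and excess\<close>

lemma in_cut_iff: "a \<noteq> b \<Longrightarrow> {a, b} \<in> cut E S \<longleftrightarrow> {a, b} \<in> E \<and> (a \<in> S) \<noteq> (b \<in> S)"
proof -
  assume "a \<noteq> b"
  moreover have "{a, b} \<inter> S = (if a \<in> S then if b \<in> S then {a, b} else {a} else if b \<in> S then {b} else {})"
    by auto
  ultimately show ?thesis by (auto simp: cut_def)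
qed

locale tec_graph =
  fixes V :: "nat set" and E :: "nat set set"
  assumes tec: "two_edge_connected_graph V E"
begin

lemma finite_V: "finite V" and V_ne: "V \<noteq> {}" and edge_card: "e \<in> E \<Longrightarrow> e \<subseteq> V \<and> card e = 2"
  using tec by (auto simp: two_edge_connected_graph_def graph_def)

lemma finite_E: "finite E"
  using finite_subset[of E "Pow V"] finite_V edge_card by auto

lemma edgeE:
  assumes "e \<in> E"
  obtains a b where "e = {a, b}" "a \<noteq> b" "a \<in> V" "b \<in> V"
  using edge_card[OF assms] by (auto simp: card_2_iff)

lemma edgeD: "{a, b} \<in> E \<Longrightarrow> a \<noteq> b \<and> a \<in> V \<and> b \<in> V"
  using edge_card[of "{a, b}"] by auto

lemma con_E: "u \<in> V \<Longrightarrow> v \<in> V \<Longrightarrow> con E u v"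
  using tec finite_E
  by (simp add: two_edge_connected_graph_def two_edge_connected_def connected_graph_def con_def)

lemma con_remove: "u \<in> V \<Longrightarrow> v \<in> V \<Longrightarrow> con (E - {e}) u v"
proof (cases "e \<in> E")
  case True
  have "mset_set E - {#e#} = mset_set (E - {e})"
    using True finite_E by (simp add: mset_set_Diff)
  then show "u \<in> V \<Longrightarrow> v \<in> V \<Longrightarrow> con (E - {e}) u v"
    using tec finite_E True
    by (auto simp: two_edge_connected_graph_def two_edge_connected_def connected_graph_def con_def)
qed (simp add: con_E)

lemma cut_edge: "{a, b} \<in> cut E S \<Longrightarrow> {a, b} \<in> E \<and> (a \<in> S) \<noteq> (b \<in> S)"
  using in_cut_iff[of a b E S] edgeD[of a b] by (auto simp: cut_def)

lemma cut_nonempty: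
  assumes "u \<in> V" "v \<in> V" "u \<in> S" "v \<notin> S"
  shows "cut E S \<noteq> {}"
  using con_closed[OF con_E[OF assms(1,2)] assms(3)] assms(4) in_cut_iff edgeD by blast

text \<open>The edge of a singleton cut would be a bridge.\<close>

lemma cut_not_singleton: "cut E S \<noteq> {e}"
proof
  assume *: "cut E S = {e}"
  then have "e \<in> E" by (auto simp: cut_def)
  then obtain a b where ab: "e = {a, b}" "a \<noteq> b" "a \<in> V" "b \<in> V" by (rule edgeE)
  have "(a \<in> S) \<noteq> (b \<in> S)" using * ab in_cut_iff[of a b E S] by auto
  moreover have closed: "c \<in> S \<longleftrightarrow> d \<in> S" if "{c, d} \<in> E - {e}" for c d
    using that * in_cut_iff[of c d E S] edgeD[of c d] by auto
  have "b \<in> S" if "a \<in> S"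
    by (rule con_closed[OF con_remove[OF ab(3,4), of e] that]) (simp add: closed)
  moreover have "a \<in> S" if "b \<in> S"
    by (rule con_closed[OF con_remove[OF ab(4,3), of e] that]) (simp add: closed)
  ultimately show False by blast
qed

text \<open>Transitivity of partnership and the exchange argument for \<open>low\<close> both rest
  on this closure property of cuts.\<close>

lemma cut_symdiff: "cut E ((S - S') \<union> (S' - S)) = (cut E S - cut E S') \<union> (cut E S' - cut E S)"
proof (intro set_eqI)
  fix e show "e \<in> cut E ((S - S') \<union> (S' - S)) \<longleftrightarrow> e \<in> (cut E S - cut E S') \<union> (cut E S' - cut E S)"
  proof (cases "e \<in> E")
    case True
    then obtain a b where "e = {a, b}" "a \<noteq> b" by (rule edgeE)
    then show ?thesis using True by (auto simp: in_cut_iff)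
  qed (auto simp: cut_def)
qed

text \<open>The partner relation. The set \<open>S\<close> is not confined to \<open>V\<close>,
  which gives no further cuts.\<close>

definition two_cut :: "nat set \<Rightarrow> nat set \<Rightarrow> bool" where
  "two_cut e f \<longleftrightarrow> e \<noteq> f \<and> (\<exists>S. cut E S = {e, f})"

lemma two_cut_edges: "two_cut e f \<Longrightarrow> e \<in> E \<and> f \<in> E"
  by (auto simp: two_cut_def cut_def)

lemma two_cut_sym: "two_cut e f \<Longrightarrow> two_cut f e"
  by (auto simp: two_cut_def insert_commute)

text \<open>In the sum of the cuts \<open>{e, f}\<close> and \<open>{f, g}\<close> the edge
  \<open>f\<close> cancels.\<close>

lemma two_cut_trans: "two_cut e f \<Longrightarrow> two_cut f g \<Longrightarrow> e \<noteq> g \<Longrightarrow> two_cut e g"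
proof -
  assume "two_cut e f" "two_cut f g" "e \<noteq> g"
  then obtain S S' where "cut E S = {e, f}" "cut E S' = {f, g}" "e \<noteq> f" "f \<noteq> g" 
    by (auto simp: two_cut_def)
  then have "cut E ((S - S') \<union> (S' - S)) = {e, g}"
    unfolding cut_symdiff using \<open>e \<noteq> g\<close> by auto
  then show ?thesis using \<open>e \<noteq> g\<close> by (auto simp: two_cut_def)
qed

text \<open>This turns partnership into a reachability test that the program can run.\<close>

lemma two_cut_iff:
  assumes "{a, b} \<in> E" "f \<in> E"
  shows "two_cut {a, b} f \<longleftrightarrow> f \<noteq> {a, b} \<and> \<not> con (E - {{a, b}, f}) a b"
proof
  assume "two_cut {a, b} f"
  then obtain S where S: "cut E S = {{a, b}, f}" "f \<noteq> {a, b}" by (auto simp: two_cut_def)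
  have ab: "(a \<in> S) \<noteq> (b \<in> S)" using S cut_edge[of a b S] by auto
  have closed: "c \<in> S \<longleftrightarrow> d \<in> S" if "{c, d} \<in> E - {{a, b}, f}" for c d
    using that S in_cut_iff[of c d E S] edgeD[of c d] by auto
  have "\<not> con (E - {{a, b}, f}) a b"
  proof
    assume c: "con (E - {{a, b}, f}) a b"
    show False
      using con_closed[OF c, of S] con_closed[OF con_sym[OF c], of S] ab closed by blast
  qed
  then show "f \<noteq> {a, b} \<and> \<not> con (E - {{a, b}, f}) a b" using S by blast
next
  assume *: "f \<noteq> {a, b} \<and> \<not> con (E - {{a, b}, f}) a b"
  \<comment> \<open>The side of \<open>a\<close> after deletion of both edges. Its cut lies within
    these two edges, contains the first, and is no singleton.\<close>
  define S where "S = {v. con (E - {{a, b}, f}) a v}"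
  have "e \<in> {{a, b}, f}" if e: "e \<in> cut E S" for e
  proof (rule ccontr)
    assume n: "e \<notin> {{a, b}, f}"
    obtain c d where cd: "e = {c, d}" "c \<noteq> d" using e edgeE[of e] unfolding cut_def by blast
    have "{c, d} \<in> E - {{a, b}, f}" using n cd e by (auto simp: cut_def)
    then have "con (E - {{a, b}, f}) c d" by (rule con_edge)
    then have "c \<in> S \<longleftrightarrow> d \<in> S" unfolding S_def using con_trans con_sym by blast
    then show False using cut_edge[of c d S] e cd by simp
  qed
  moreover have "{a, b} \<in> cut E S"
    using * edgeD[OF assms(1)] assms(1) by (subst in_cut_iff) (auto simp: S_def)
  ultimately have "cut E S = {{a, b}} \<or> cut E S = {{a, b}, f}" by auto
  then show "two_cut {a, b} f" using cut_not_singleton[of S] * by (auto simp: two_cut_def)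
qed

definition cls :: "nat set \<Rightarrow> nat set set" where
  "cls e = insert e {f. two_cut e f}"

lemma cls_subset: "e \<in> E \<Longrightarrow> cls e \<subseteq> E"
  using two_cut_edges by (auto simp: cls_def)

lemma finite_cls: "e \<in> E \<Longrightarrow> finite (cls e)"
  using cls_subset finite_E finite_subset by blast

lemma cls_eq: "f \<in> cls e \<Longrightarrow> cls f = cls e"
proof (intro set_eqI)
  fix g assume "f \<in> cls e"
  then consider "f = e" | "two_cut e f" "two_cut f e" using two_cut_sym by (auto simp: cls_def)
  then show "g \<in> cls f \<longleftrightarrow> g \<in> cls e"
    using two_cut_trans[of e f g] two_cut_trans[of f e g] by cases (auto simp: cls_def)
qed

lemma sum_cls: "(\<Sum>e\<in>E. g e) = (\<Sum>C\<in>cls ` E. \<Sum>e\<in>C. g e)" for g :: "nat set \<Rightarrow> real"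
proof -
  have "{x \<in> E. cls x = C} = C" if C: "C \<in> cls ` E" for C
  proof -
    obtain e where e: "e \<in> E" "C = cls e" using C by blast
    have "x \<in> cls x" for x by (simp add: cls_def)
    then show ?thesis using cls_eq[of _ e] cls_subset[OF e(1)] unfolding e(2) by blast
  qed
  then show ?thesis using sum.group[of E "cls ` E" cls g] finite_E by simp
qed

definition penalty :: "(nat set \<Rightarrow> real) \<Rightarrow> nat set \<Rightarrow> real" where
  "penalty w e = sum w {f. two_cut e f}"

text \<open>The additional charge for placing \<open>e\<close> in the tree: three times its weight,
  against \<open>2 * w e + min (w e) (penalty w e)\<close> as a link.\<close>

definition excess :: "(nat set \<Rightarrow> real) \<Rightarrow> nat set \<Rightarrow> real" where
  "excess w e = w e - min (w e) (penalty w e)"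

lemma excess_nonneg: "0 \<le> excess w e"
  by (simp add: excess_def)

lemma finite_two_cut: "finite {f. two_cut e f}"
  by (rule finite_subset[OF _ finite_E]) (use two_cut_edges in auto)

lemma penalty_cls: "penalty w e = sum w (cls e) - w e"
  using finite_two_cut[of e] by (auto simp: penalty_def cls_def two_cut_def)

end

section \<open>Lower bounds on the weight of a point of the subtour polytope\<close>

locale subtour_point = tec_graph +
  fixes w x :: "nat set \<Rightarrow> real"
  assumes w_nonneg: "\<And>e. e \<in> E \<Longrightarrow> 0 \<le> w e"
    and x_nonneg: "\<And>e. e \<in> E \<Longrightarrow> 0 \<le> x e"
    and x_cut: "\<And>S. cut E S \<noteq> {} \<Longrightarrow> 2 \<le> (\<Sum>e\<in>cut E S. x e)"
begin

definition low :: "nat set \<Rightarrow> real" where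
  "low e = Min (x ` cls e)"

lemma low_attained:
  assumes "e \<in> E"
  obtains g where "g \<in> cls e" "low e = x g"
proof -
  have "low e \<in> x ` cls e"
    unfolding low_def using finite_cls[OF assms] by (intro Min_in) (auto simp: cls_def)
  then show ?thesis using that by blast
qed

lemma low_le: "e \<in> E \<Longrightarrow> f \<in> cls e \<Longrightarrow> low e \<le> x f"
  unfolding low_def using finite_cls by simp

lemma low_cls: "f \<in> cls e \<Longrightarrow> low f = low e"
  unfolding low_def using cls_eq by simp

lemma low_nonneg: "e \<in> E \<Longrightarrow> 0 \<le> low e"
  using low_attained[of e] x_nonneg cls_subset[of e] by (metis subsetD)

lemma two_cut_sum: 
  assumes "two_cut e f"
  shows "2 \<le> x e + x f"
proof -
  obtain S where "cut E S = {e, f}" "e \<noteq> f" using assms by (auto simp: two_cut_def)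
  with x_cut[of S] show ?thesis by simp
qed

text \<open>Within one class the sum of the minima of weight and penalty is at most twice the penalty of
  the member \<open>g\<close> with the smallest \<open>x\<close>, while every other member has \<open>x\<close> at least \<open>2 - x g\<close>.\<close>

lemma class_bound:
  assumes e: "e \<in> E"
  shows "(\<Sum>f\<in>cls e. min (w f) (penalty w f) + excess w f * min 1 (low f)) \<le> (\<Sum>f\<in>cls e. w f * x f)"
proof -
  \<comment> \<open>Since \<open>low\<close> is constant on the class, each summand on the left is
    the convex combination of \<open>min (w f) (penalty w f)\<close> and \<open>w f\<close> with
    parameter \<open>t\<close>.\<close>
  define t where "t = min 1 (low e)"
  note fin = finite_cls[OF e] and sub = cls_subset[OF e]
  have "(\<Sum>f\<in>cls e. min (w f) (penalty w f) + excess w f * min 1 (low f)) =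
      (\<Sum>f\<in>cls e. (1 - t) * min (w f) (penalty w f) + t * w f)"
  proof (rule sum.cong[OF refl])
    fix f assume "f \<in> cls e"
    then have "min 1 (low f) = t" by (simp add: low_cls t_def)
    then show "min (w f) (penalty w f) + excess w f * min 1 (low f) = (1 - t) * min (w f) (penalty w f) + t * w f"
      unfolding excess_def by (simp only: left_diff_distrib right_diff_distrib) (simp add: mult.commute)
  qed
  also have "\<dots> = (1 - t) * (\<Sum>f\<in>cls e. min (w f) (penalty w f)) + t * sum w (cls e)"
    by (simp add: sum.distrib sum_distrib_left)
  also have "\<dots> \<le> (\<Sum>f\<in>cls e. w f * x f)"
  proof (cases "low e \<ge> 1")
    case True
    then have "t = 1" by (simp add: t_def)
    moreover have "w f \<le> w f * x f" if "f \<in> cls e" for f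
      using low_le[OF e that] True w_nonneg[of f] sub that mult_left_mono[of 1 "x f" "w f"] by auto
    ultimately show ?thesis by (simp add: sum_mono)
  next
    case False
    obtain g where g: "g \<in> cls e" "low e = x g" using low_attained[OF e] .
    have t: "t = x g" "t < 1" using False g by (auto simp: t_def)
    have gE: "g \<in> E" using g sub by blast
    let ?R = "cls e - {g}"
    have pg: "penalty w g = sum w ?R"
      using penalty_cls[of w g] cls_eq[OF g(1)] fin g(1) by (simp add: sum.remove[of "cls e" g])
    have "(\<Sum>f\<in>cls e. min (w f) (penalty w f)) = min (w g) (penalty w g) + (\<Sum>f\<in>?R. min (w f) (penalty w f))"
      using fin g by (simp add: sum.remove[of "cls e" g])
    \<comment> \<open>Both terms equal the weight of \<open>?R\<close>, hence the factor 2 below. In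
      the end \<open>2 * (1 - t) + t = 2 - t\<close> is the coefficient matched by the lower bound
      on \<open>x f\<close>.\<close>
    also have "\<dots> \<le> penalty w g + sum w ?R" by (intro add_mono sum_mono) auto
    finally have 1: "(1 - t) * (\<Sum>f\<in>cls e. min (w f) (penalty w f)) \<le> (1 - t) * (2 * sum w ?R)"
      using t pg by (intro mult_left_mono) auto
    have "w f * (2 - t) \<le> w f * x f" if f: "f \<in> ?R" for f
    proof -
      have "two_cut g f" using f cls_eq[OF g(1)] by (auto simp: cls_def)
      then have "2 - t \<le> x f" using two_cut_sum t by fastforce
      then show ?thesis using w_nonneg[of f] sub f by (intro mult_left_mono) auto
    qed
    then have "(2 - t) * sum w ?R \<le> (\<Sum>f\<in>?R. w f * x f)"
      unfolding sum_distrib_left by (intro sum_mono) (simp add: mult.commute)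
    moreover have "(\<Sum>f\<in>cls e. w f * x f) = w g * t + (\<Sum>f\<in>?R. w f * x f)"
      "sum w (cls e) = w g + sum w ?R"
      using fin g t by (simp_all add: sum.remove[of "cls e" g])
    ultimately show ?thesis using 1 by (simp add: algebra_simps)
  qed
  finally show ?thesis .
qed

lemma excess_bound:
  "(\<Sum>e\<in>E. min (w e) (penalty w e)) + (\<Sum>e\<in>E. excess w e * min 1 (low e)) \<le> (\<Sum>e\<in>E. w e * x e)"
proof -
  have "(\<Sum>e\<in>E. min (w e) (penalty w e)) + (\<Sum>e\<in>E. excess w e * min 1 (low e)) =
      (\<Sum>C\<in>cls ` E. \<Sum>e\<in>C. min (w e) (penalty w e) + excess w e * min 1 (low e))"
    unfolding sum.distrib[symmetric] by (rule sum_cls)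
  also have "\<dots> \<le> (\<Sum>C\<in>cls ` E. \<Sum>e\<in>C. w e * x e)"
    by (rule sum_mono) (use class_bound in blast)
  also have "\<dots> = (\<Sum>e\<in>E. w e * x e)"
    by (rule sum_cls[symmetric])
  finally show ?thesis .
qed

text \<open>Exchanging an edge of a cut for an equivalent edge gives another cut.\<close>

lemma low_cut:
  assumes "cut E S \<noteq> {}" "\<And>e f. e \<in> cut E S \<Longrightarrow> f \<in> cut E S \<Longrightarrow> \<not> two_cut e f"
  shows "2 \<le> (\<Sum>e\<in>cut E S. low e)"
  using assms
\<comment> \<open>Induction on the number of edges of the cut at which the class minimum is not
  attained. At zero, \<open>low\<close> agrees with \<open>x\<close> on the cut.\<close>
proof (induction "card {e \<in> cut E S. low e \<noteq> x e}" arbitrary: S rule: less_induct)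
  case less
  have fin: "finite (cut E S)" for S using finite_E by (simp add: cut_def)
  show ?case
  proof (cases "\<exists>e\<in>cut E S. low e \<noteq> x e")
    case False
    then show ?thesis using x_cut[OF less.prems(1)] by simp
  next
    case True
    then obtain e where e: "e \<in> cut E S" "low e \<noteq> x e" by blast
    have eE: "e \<in> E" using e by (simp add: cut_def)
    obtain g where g: "g \<in> cls e" "low e = x g" using low_attained[OF eE] .
    then have eg: "two_cut e g" using e by (auto simp: cls_def)
    have gS: "g \<notin> cut E S" using less.prems(2)[OF e(1)] eg by blast
    obtain S0 where S0: "cut E S0 = {e, g}" using eg by (auto simp: two_cut_def)
    define S' where "S' = (S - S0) \<union> (S0 - S)"
    have S': "cut E S' = insert g (cut E S - {e})"
      unfolding S'_def cut_symdiff S0 using e gS by auto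
    have lg: "low g = low e" using low_cls[OF g(1)] .
    have "2 \<le> (\<Sum>e\<in>cut E S'. low e)"
    proof (rule less.hyps)
      have "{f \<in> cut E S'. low f \<noteq> x f} = {f \<in> cut E S. low f \<noteq> x f} - {e}"
        unfolding S' using lg g(2) gS by auto
      also have "card \<dots> < card {f \<in> cut E S. low f \<noteq> x f}"
        using e fin[of S] by (intro card_Diff1_less) auto
      finally show "card {f \<in> cut E S'. low f \<noteq> x f} < card {f \<in> cut E S. low f \<noteq> x f}" .
      show "cut E S' \<noteq> {}" unfolding S' by simp
      \<comment> \<open>By transitivity, a partner of \<open>g\<close> in the rest of the cut would
        be a partner of \<open>e\<close>.\<close>
      have "\<not> two_cut g f" if "f \<in> cut E S - {e}" for f
        using that two_cut_trans[OF eg, of f] less.prems(2)[OF e(1), of f] by blast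
      then show "\<not> two_cut f h" if "f \<in> cut E S'" "h \<in> cut E S'" for f h
        using that less.prems(2) two_cut_sym unfolding S' by (metis DiffD1 insertE two_cut_def)
    qed
    also have "(\<Sum>e\<in>cut E S'. low e) = (\<Sum>e\<in>cut E S. low e)"
      unfolding S' using fin[of S] gS e lg by (simp add: sum.remove[of "cut E S" e])
    finally show ?thesis .
  qed
qed

text \<open>An edge of positive excess outweighs all its partners together, and two edges cannot
  outweigh each other.\<close>

lemma excess_not_two_cut:
  assumes "excess w e > 0" "excess w f > 0" "e \<in> E" "f \<in> E"
  shows "\<not> two_cut e f"
proof
  assume ef: "two_cut e f"
  have "w f \<le> penalty w e"
    unfolding penalty_def using ef finite_two_cut two_cut_edges w_nonneg by (intro member_le_sum) auto
  moreover have "w e \<le> penalty w f"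
    unfolding penalty_def using two_cut_sym[OF ef] finite_two_cut two_cut_edges w_nonneg
    by (intro member_le_sum) auto
  ultimately show False using assms by (auto simp: excess_def min_def split: if_splits)
qed

text \<open>Every component has a cut of \<open>low\<close>-value at least 2, and an edge meets at
  most two of these cuts. Truncation at 1 would spoil the cut values, so the induction first adds to
  \<open>F\<close> the edges with \<open>low e \<ge> 1\<close>: each pays 1 and lowers the number of
  components by at most one.\<close>

lemma components_bound:
  assumes "F \<subseteq> E" "\<And>e. e \<in> E - F \<Longrightarrow> excess w e > 0"
  shows "real (card (components V F)) \<le> 1 + (\<Sum>e\<in>E - F. min 1 (low e))"
  using assms
proof (induction "card (E - F)" arbitrary: F rule: less_induct)
  case less
  have fin: "finite (E - F)" using finite_E by simp
  show ?case
  proof (cases "\<exists>e\<in>E - F. low e \<ge> 1")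
    case True
    then obtain e where e: "e \<in> E - F" "low e \<ge> 1" by blast
    then obtain a b where ab: "e = {a, b}" "a \<in> V" "b \<in> V" using edgeE[of e] by blast
    have eq: "E - insert e F = (E - F) - {e}" by blast
    have "real (card (components V (insert e F))) \<le> 1 + (\<Sum>e\<in>E - insert e F. min 1 (low e))"
    proof (rule less.hyps)
      show "card (E - insert e F) < card (E - F)"
        unfolding eq using e fin by (intro card_Diff1_less) auto
    qed (use less.prems e in auto)
    moreover have "(\<Sum>e\<in>E - F. min 1 (low e)) = 1 + (\<Sum>e\<in>E - insert e F. min 1 (low e))"
      unfolding eq using e fin by (simp add: sum.remove[of "E - F" e])
    ultimately show ?thesis
      using card_components_insert_ge[OF finite_V ab(2,3), of F] unfolding ab(1) by linarith
  next
    case False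
    have low1: "min 1 (low e) = low e" if "e \<in> E - F" for e
      using False that by (auto simp: min_def)
    have nn: "0 \<le> (\<Sum>e\<in>E - F. min 1 (low e))"
      using low_nonneg by (intro sum_nonneg) auto
    show ?thesis
    \<comment> \<open>The counting needs two components, since the cut of a single one is
      empty.\<close>
    proof (cases "card (components V F) \<le> 1")
      case True
      then show ?thesis using nn by simp
    next
      case many: False
      have 1: "2 \<le> (\<Sum>e\<in>cut E C. low e) \<and> cut E C \<subseteq> E - F" if C: "C \<in> components V F" for C
      proof
        obtain v where v: "v \<in> V" "C = component V F v" using C by (auto simp: components_def)
        have "components V F \<noteq> {C}" using many by auto
        then obtain u where u: "u \<in> V" "component V F u \<noteq> C" using v by (auto simp: components_def)
        then have "u \<notin> C" using component_eq_iff[OF v(1) u(1), of F] v(2) by (auto simp: component_def)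
        moreover have "v \<in> C" using component_self v by simp
        ultimately have ne: "cut E C \<noteq> {}" using cut_nonempty v(1) u(1) by blast
        show sub: "cut E C \<subseteq> E - F"
        proof
          fix e assume e: "e \<in> cut E C"
          then have eE: "e \<in> E" by (simp add: cut_def)
          obtain a b where ab: "e = {a, b}" "a \<in> V" "b \<in> V" using edgeE[OF eE] by blast
          have "e \<notin> F"
          proof
            assume "e \<in> F"
            then have con: "con F a b" using con_edge ab by simp
            then have "con F v a \<longleftrightarrow> con F v b" using con_trans con_sym by metis
            then have "a \<in> C \<longleftrightarrow> b \<in> C" using v(2) ab by (simp add: component_def)
            then show False using cut_edge e ab by blast
          qed
          then show "e \<in> E - F" using eE by simp
        qed
        show "2 \<le> (\<Sum>e\<in>cut E C. low e)"
        proof (rule low_cut[OF ne])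
          fix e f assume "e \<in> cut E C" "f \<in> cut E C"
          then have "e \<in> E - F" "f \<in> E - F" using sub by auto
          then show "\<not> two_cut e f"
            using less.prems(2)[of e] less.prems(2)[of f] excess_not_two_cut[of e f] by simp
        qed
      qed
      have "2 * real (card (components V F)) \<le> (\<Sum>C\<in>components V F. \<Sum>e\<in>cut E C. low e)"
        using sum_mono[of "components V F" "\<lambda>_. 2" "\<lambda>C. \<Sum>e\<in>cut E C. low e"] 1 by (simp add: mult.commute)
      also have "\<dots> = (\<Sum>C\<in>components V F. \<Sum>e\<in>E - F. if e \<in> cut E C then low e else 0)"
      proof (rule sum.cong[OF refl])
        fix C assume "C \<in> components V F"
        then have "(E - F) \<inter> cut E C = cut E C" using 1 by blast
        then show "(\<Sum>e\<in>cut E C. low e) = (\<Sum>e\<in>E - F. if e \<in> cut E C then low e else 0)"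
          using sum.inter_restrict[OF fin, of low "cut E C"] by simp
      qed
      also have "\<dots> = (\<Sum>e\<in>E - F. \<Sum>C\<in>components V F. if e \<in> cut E C then low e else 0)"
        by (rule sum.swap)
      also have "\<dots> \<le> (\<Sum>e\<in>E - F. 2 * low e)"
      proof (rule sum_mono)
        fix e assume e: "e \<in> E - F"
        obtain a b where ab: "e = {a, b}" "a \<in> V" "b \<in> V" using edgeE[of e] e by blast
        let ?K = "{C \<in> components V F. e \<in> cut E C}"
        \<comment> \<open>An edge enters only the cuts of the components of its ends. The resulting
          factor 2 cancels the 2 demanded of each cut.\<close>
        have "?K \<subseteq> {component V F a, component V F b}"
        proof
          fix C assume C: "C \<in> ?K"
          then obtain v where v: "v \<in> V" "C = component V F v" by (auto simp: components_def)
          have "a \<in> C \<or> b \<in> C" using C cut_edge[of a b C] ab by auto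
          then have "con F v a \<or> con F v b" unfolding v(2) component_def by blast
          then show "C \<in> {component V F a, component V F b}"
            using component_eq_iff[OF v(1) ab(2), of F] component_eq_iff[OF v(1) ab(3), of F] v(2) by blast
        qed
        then have "card ?K \<le> card {component V F a, component V F b}"
          by (intro card_mono) auto
        also have "\<dots> \<le> 2" by (simp add: card_insert_if)
        finally have "card ?K \<le> 2" .
        then have "(real (card ?K)) * low e \<le> 2 * low e"
          using low_nonneg[of e] e by (intro mult_right_mono) auto
        then show "(\<Sum>C\<in>components V F. if e \<in> cut E C then low e else 0) \<le> 2 * low e"
          using finite_V by (simp add: sum.If_cases Int_def)
      qed
      also have "\<dots> = 2 * (\<Sum>e\<in>E - F. min 1 (low e))"
        using low1 by (simp add: sum_distrib_left)
      finally show ?thesis using nn by simp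
    qed
  qed
qed

end

text \<open>Summation by parts: it suffices to compare the superlevel sets of \<open>k\<close>.\<close>

lemma sum_levels_nonneg:
  fixes k d :: "'a \<Rightarrow> real"
  assumes "finite E" "\<And>e. e \<in> E \<Longrightarrow> 0 \<le> k e"
    "\<And>l. 0 < l \<Longrightarrow> 0 \<le> (\<Sum>e\<in>{e \<in> E. l \<le> k e}. d e)"
  shows "0 \<le> (\<Sum>e\<in>E. k e * d e)"
  using assms(2,3)
proof (induction "card {e \<in> E. 0 < k e}" arbitrary: k rule: less_induct)
  case less
  let ?P = "{e \<in> E. 0 < k e}"
  show ?case
  proof (cases "?P = {}")
    case True
    then have "k e = 0" if "e \<in> E" for e using less.prems(1)[OF that] that by force
    then show ?thesis by simp
  next
    case False
    define l where "l = Min (k ` ?P)"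
    have finP: "finite ?P" using assms(1) by simp
    have "l \<in> k ` ?P" unfolding l_def using False finP by (intro Min_in) auto
    then obtain g where g: "g \<in> ?P" "l = k g" by blast
    have l: "l \<le> k e" if "e \<in> ?P" for e unfolding l_def using finP that by simp
    have l0: "0 < l" using g by auto
    have P: "?P = {e \<in> E. l \<le> k e}" using l l0 by force
    \<comment> \<open>Subtracting the least positive value removes \<open>g\<close> from the
      support, and the superlevel set of \<open>k'\<close> at \<open>m\<close> is that of
      \<open>k\<close> at \<open>l + m\<close>.\<close>
    define k' where "k' e = (if e \<in> ?P then k e - l else 0)" for e
    have "0 \<le> (\<Sum>e\<in>E. k' e * d e)"
    proof (rule less.hyps)
      have "{e \<in> E. 0 < k' e} \<subseteq> ?P - {g}" using g by (auto simp: k'_def split: if_splits)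
      then have "card {e \<in> E. 0 < k' e} \<le> card (?P - {g})" using finP by (intro card_mono) auto
      also have "\<dots> < card ?P" using g finP by (intro card_Diff1_less) auto
      finally show "card {e \<in> E. 0 < k' e} < card ?P" .
      show "0 \<le> k' e" if "e \<in> E" for e using l that by (auto simp: k'_def)
      fix m :: real assume m: "0 < m"
      have "{e \<in> E. m \<le> k' e} = {e \<in> E. l + m \<le> k e}"
        using m l0 by (auto simp: k'_def split: if_splits)
      then show "0 \<le> (\<Sum>e\<in>{e \<in> E. m \<le> k' e}. d e)" using less.prems(2)[of "l + m"] l0 m by simp
    qed
    moreover have "(\<Sum>e\<in>E. k e * d e) = (\<Sum>e\<in>E. k' e * d e) + l * (\<Sum>e\<in>?P. d e)"
    proof -
      have "k e * d e = k' e * d e + l * (if e \<in> ?P then d e else 0)" if "e \<in> E" for e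
        using less.prems(1)[OF that] that by (auto simp: k'_def algebra_simps)
      then have "(\<Sum>e\<in>E. k e * d e) = (\<Sum>e\<in>E. k' e * d e) + l * (\<Sum>e\<in>E. if e \<in> ?P then d e else 0)"
        by (simp add: sum.distrib sum_distrib_left)
      also have "(\<Sum>e\<in>E. if e \<in> ?P then d e else 0) = (\<Sum>e\<in>?P. d e)"
        using assms(1) by (subst sum.inter_restrict[symmetric]) (auto simp: Int_def intro: sum.cong)
      finally show ?thesis .
    qed
    moreover have "0 \<le> (\<Sum>e\<in>?P. d e)" using less.prems(2)[OF l0] P by simp
    ultimately show ?thesis using l0 by simp
  qed
qed

section \<open>Minimum spanning trees\<close>

text \<open>Minimality enters only as the bottleneck property, the form that can be compared across
  thresholds. It also makes \<open>T\<close> connected.\<close>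

locale spanning_tree = tec_graph +
  fixes T :: "nat set set" and k :: "nat set \<Rightarrow> real"
  assumes T_sub: "T \<subseteq> E"
    and forest: "\<And>a b. {a, b} \<in> T \<Longrightarrow> \<not> con (T - {{a, b}}) a b"
    and bottleneck: "\<And>a b. {a, b} \<in> E \<Longrightarrow> con {t \<in> T. k t \<le> k {a, b}} a b"
begin

lemma finite_T: "finite T"
  using T_sub finite_E finite_subset by blast

lemma con_T: "u \<in> V \<Longrightarrow> v \<in> V \<Longrightarrow> con T u v"
proof (rule con_subset[OF _ con_E])
  fix a b assume "{a, b} \<in> E"
  from bottleneck[OF this] show "con T a b" by (rule con_mono[rotated]) blast
qed

text \<open>Each deletion from a forest increases the number of components, and there is at least
  one at the start.\<close>

lemma card_components_forest:
  assumes "B \<subseteq> T"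
  shows "card B < card (components V (T - B))"
proof -
  have "finite B" using assms finite_T finite_subset by blast
  then show ?thesis using assms
  proof (induction B rule: finite_induct)
    case empty
    have "components V T \<noteq> {}" using V_ne by (simp add: components_def)
    then show ?case using finite_V by (simp add: card_gt_0_iff)
  next
    case (insert t B)
    obtain a b where ab: "t = {a, b}" "a \<in> V" "b \<in> V" using edgeE[of t] T_sub insert.prems by blast
    have "\<not> con (T - insert t B) a b"
      using forest[of a b] con_mono[of "T - insert t B" "T - {t}" a b] ab insert.prems by blast
    from card_components_insert_less[OF finite_V ab(2,3) this]
    have "card (components V (insert t (T - insert t B))) < card (components V (T - insert t B))"
      by (simp add: ab(1))
    moreover have "insert t (T - insert t B) = T - B" using insert by blast
    ultimately show ?case using insert by simp
  qed
qed

end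

locale minimum_tree = subtour_point V E w x + spanning_tree V E T "excess w"
  for V E w x T
begin

text \<open>Summation by parts with the excess as level function. By the bottleneck property the
  tree edges below level \<open>l\<close> reach as far as all edges below \<open>l\<close>. So the
  tree has fewer edges from level \<open>l\<close> upwards than the graph of cheaper edges has
  components, and \<open>components_bound\<close> pays for them.\<close>

lemma tree_bound:
  "(\<Sum>e\<in>E. min (w e) (penalty w e)) + (\<Sum>e\<in>T. excess w e) \<le> (\<Sum>e\<in>E. w e * x e)"
proof -
  have "0 \<le> (\<Sum>e\<in>E. excess w e * (min 1 (low e) - of_bool (e \<in> T)))"
  proof (rule sum_levels_nonneg[OF finite_E excess_nonneg])
    fix l :: real assume l: "0 < l"
    let ?F = "{e \<in> E. excess w e < l}" and ?B = "{t \<in> T. l \<le> excess w t}"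
    have EF: "E - ?F = {e \<in> E. l \<le> excess w e}" by auto
    have "con (T - ?B) a b" if "{a, b} \<in> ?F" for a b
      using bottleneck[of a b] by (rule con_mono[rotated]) (use that in auto)
    then have "card (components V (T - ?B)) \<le> card (components V ?F)"
      by (intro components_antimono finite_V) (rule con_subset)
    with card_components_forest[of ?B] have "real (card ?B) + 1 \<le> real (card (components V ?F))"
      by simp
    also have "\<dots> \<le> 1 + (\<Sum>e\<in>E - ?F. min 1 (low e))"
      by (rule components_bound) (use l in auto)
    finally have "real (card ?B) \<le> (\<Sum>e\<in>{e \<in> E. l \<le> excess w e}. min 1 (low e))"
      unfolding EF by simp
    moreover have "(\<Sum>e\<in>{e \<in> E. l \<le> excess w e}. of_bool (e \<in> T)) = real (card ?B)"
    proof -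
      have "{e \<in> E. l \<le> excess w e} \<inter> {e. e \<in> T} = ?B" using T_sub by blast
      then show ?thesis using finite_E by (simp add: sum_of_bool_eq)
    qed
    ultimately show "0 \<le> (\<Sum>e\<in>{e \<in> E. l \<le> excess w e}. min 1 (low e) - of_bool (e \<in> T))"
      by (simp add: sum_subtractf)
  qed
  moreover have "(\<Sum>e\<in>E. excess w e * of_bool (e \<in> T)) = (\<Sum>e\<in>T. excess w e)"
    using finite_E T_sub by (simp add: sum.If_cases of_bool_def if_distrib Int_absorb1 cong: if_cong)
  ultimately show ?thesis using excess_bound by (simp add: algebra_simps sum_subtractf)
qed

end

section \<open>The laminar family of a rooted tree\<close>

locale rooted_tree = spanning_tree +
  fixes r :: nat
  assumes root: "r \<in> V"
begin

definition under :: "nat set \<Rightarrow> nat set" where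
  "under e = {v \<in> V. \<not> con (T - {e}) r v}"

definition spans :: "nat set \<Rightarrow> nat set \<Rightarrow> bool" where
  "spans e l \<longleftrightarrow> l \<in> cut E (under e)"

lemma spans_iff: "{a, b} \<in> E \<Longrightarrow> spans e {a, b} \<longleftrightarrow> (a \<in> under e) \<noteq> (b \<in> under e)"
  using edgeD[of a b] by (simp add: spans_def in_cut_iff)

text \<open>The vertex \<open>c\<close> is the end of \<open>e\<close> away from the root.\<close>

lemma tree_edge_remove:
  assumes "e \<in> T"
  obtains c where "c \<in> V" "\<And>v. v \<in> under e \<Longrightarrow> con (T - {e}) c v" "spans e e"
proof -
  obtain a b where ab: "e = {a, b}" "a \<in> V" "b \<in> V" using edgeE[of e] T_sub assms by blast
  have eq: "insert {a, b} (T - {e}) = T" using assms ab by blast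
  have nab: "\<not> con (T - {e}) a b" using forest[of a b] assms ab by simp
  have split: "con (T - {e}) r v \<or> con (T - {e}) r a \<and> con (T - {e}) b v \<or> con (T - {e}) r b \<and> con (T - {e}) a v"
    if "v \<in> V" for v
    using con_insert[of a b "T - {e}" r v] con_T[OF root that] unfolding eq by blast
  consider "con (T - {e}) r a" "\<not> con (T - {e}) r b" | "con (T - {e}) r b" "\<not> con (T - {e}) r a"
    using split[OF ab(2)] nab con_trans[OF con_sym, of "T - {e}" r a b] by auto
  then show ?thesis
  proof cases
    case 1
    then show ?thesis using split ab assms T_sub
      by (intro that[of b]) (auto simp: under_def spans_iff)
  next
    case 2
    then show ?thesis using split ab assms T_sub
      by (intro that[of a]) (auto simp: under_def spans_iff)
  qed
qed

lemma con_under: "e \<in> T \<Longrightarrow> u \<in> under e \<Longrightarrow> v \<in> under e \<Longrightarrow> con (T - {e}) u v"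
  by (rule tree_edge_remove[of e]) (auto intro: con_trans[OF con_sym])

lemma con_not_under: "v \<in> V \<Longrightarrow> v \<notin> under e \<Longrightarrow> con (T - {e}) r v"
  by (simp add: under_def)

lemma under_edge:
  assumes "{a, b} \<in> T - {e}"
  shows "a \<in> under e \<longleftrightarrow> b \<in> under e"
proof -
  have "con (T - {e}) a b" using assms by (rule con_edge)
  then have "con (T - {e}) r a \<longleftrightarrow> con (T - {e}) r b"
    using con_trans[of "T - {e}" r] con_sym[of "T - {e}"] by blast
  moreover have "a \<in> V" "b \<in> V" using assms T_sub edgeD[of a b] by auto
  ultimately show ?thesis by (simp add: under_def)
qed

lemma spans_tree: "e \<in> T \<Longrightarrow> f \<in> T \<Longrightarrow> spans e f \<longleftrightarrow> e = f"
proof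
  assume *: "e \<in> T" "f \<in> T" "spans e f"
  obtain a b where ab: "f = {a, b}" using edgeE[of f] T_sub * by blast
  show "e = f"
    using under_edge[of a b e] spans_iff[of a b e] * T_sub ab by blast
next
  assume "e \<in> T" "e = f"
  then show "spans e f" using tree_edge_remove[of e] by blast
qed

text \<open>If no end of \<open>f\<close> lies under \<open>e\<close>, the part under
  \<open>e\<close> stays connected without \<open>f\<close> and is on the side of \<open>u\<close>
  as a whole. If both ends do, everything outside keeps its connection to the root without
  \<open>f\<close>, so the part under \<open>f\<close> lies inside.\<close>

lemma under_laminar:
  assumes e: "e \<in> T" and f: "f \<in> T" and u: "u \<in> under e" "u \<in> under f"
  shows "under e \<subseteq> under f \<or> under f \<subseteq> under e"
proof (cases "e = f")
  case False
  obtain a b where ab: "f = {a, b}" "a \<in> V" "b \<in> V" using edgeE[of f] T_sub f by blast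
  have same: "a \<in> under e \<longleftrightarrow> b \<in> under e" using under_edge[of a b e] f ab False by blast
  show ?thesis
  proof (cases "a \<in> under e")
    case out: False
    have "v \<in> under f" if v: "v \<in> under e" for v
    proof -
      have "v \<in> {v \<in> under e. con (T - {f}) u v}"
      proof (rule con_closed[OF con_under[OF e u(1) v]])
        fix c d assume cd: "{c, d} \<in> T - {e}" "c \<in> {v \<in> under e. con (T - {f}) u v}"
        then have "c \<in> under e" "d \<in> under e" using under_edge[OF cd(1)] by auto
        then have "{c, d} \<noteq> f" using out same ab by (auto simp: doubleton_eq_iff)
        then have "con (T - {f}) c d" using cd(1) by (intro con_edge) auto
        then show "d \<in> {v \<in> under e. con (T - {f}) u v}"
          using cd(2) \<open>d \<in> under e\<close> con_trans by simp metis
      qed (use u in simp)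
      then have "con (T - {f}) v u" using con_sym by simp
      then have "\<not> con (T - {f}) r v" using u(2) con_trans[of "T - {f}" r v u] by (auto simp: under_def)
      then show "v \<in> under f" using v by (simp add: under_def)
    qed
    then show ?thesis by blast
  next
    case inside: True
    have "v \<in> under e" if v: "v \<in> under f" for v
    proof (rule ccontr)
      assume n: "v \<notin> under e"
      have vV: "v \<in> V" using v by (simp add: under_def)
      have "v \<in> {v \<in> V - under e. con (T - {f}) r v}"
      proof (rule con_closed[OF con_not_under[OF vV n]])
        show "r \<in> {v \<in> V - under e. con (T - {f}) r v}" using root by (simp add: under_def)
        fix c d assume cd: "{c, d} \<in> T - {e}" "c \<in> {v \<in> V - under e. con (T - {f}) r v}"
        then have "c \<notin> under e" "d \<notin> under e" using under_edge[OF cd(1)] by auto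
        then have "{c, d} \<noteq> f" using inside same ab by (auto simp: doubleton_eq_iff)
        then have "con (T - {f}) c d" using cd(1) by (intro con_edge) auto
        moreover have "d \<in> V" using cd(1) T_sub edgeD[of c d] by blast
        ultimately show "d \<in> {v \<in> V - under e. con (T - {f}) r v}"
          using cd(2) \<open>d \<notin> under e\<close> con_trans by simp metis
      qed
      then show False using v by (simp add: under_def)
    qed
    then show ?thesis by blast
  qed
qed simp

lemma spanning_link:
  assumes "e \<in> T"
  obtains l where "l \<in> E - T" "spans e l"
proof -
  have "e \<in> cut E (under e)" using spans_tree[OF assms assms] by (simp add: spans_def)
  with cut_not_singleton[of "under e" e] obtain l where l: "l \<in> cut E (under e)" "l \<noteq> e" by blast
  then have "l \<in> E" "spans e l" by (auto simp: cut_def spans_def)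
  moreover have "l \<notin> T" using spans_tree[OF assms] l(2) \<open>spans e l\<close> by blast
  ultimately show ?thesis using that by blast
qed

lemma unique_spanning_link:
  assumes "e \<in> T" "l \<in> E - T" "spans e l" "\<And>l'. l' \<in> E - T \<Longrightarrow> spans e l' \<Longrightarrow> l' = l"
  shows "two_cut l e"
proof -
  have "cut E (under e) = {l, e}"
  proof (intro equalityI subsetI)
    fix f assume f: "f \<in> cut E (under e)"
    then have "f \<in> E" "spans e f" by (auto simp: cut_def spans_def)
    then show "f \<in> {l, e}" using assms(4)[of f] spans_tree[OF assms(1), of f] by auto
  qed (use assms(3) spans_tree[OF assms(1,1)] in \<open>auto simp: spans_def\<close>)
  moreover have "l \<noteq> e" using assms(1,2) by blast
  ultimately show ?thesis unfolding two_cut_def by blast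
qed

text \<open>Deleting anything but the only copy of a tree edge leaves the whole tree. In the
  remaining case a link spanning that edge rejoins the two sides.\<close>

lemma two_edge_connectedI:
  assumes M: "set_mset M \<subseteq> E" "T \<subseteq> set_mset M"
    and safe: "\<And>e. e \<in> T \<Longrightarrow> 2 \<le> count M e \<or> (\<exists>l\<in>#M. l \<notin> T \<and> spans e l)"
  shows "two_edge_connected V M"
proof -
  have T_con: "connected_graph V F" if "T \<subseteq> F" for F
    using con_mono[OF that con_T] by (simp add: connected_graph_def con_def)
  have "connected_graph V (set_mset (M - {#e#}))" if e: "e \<in># M" for e
  proof -
    have other: "f \<in># M - {#e#}" if "f \<in># M" "f \<noteq> e" for f
      using that e by (metis insert_DiffM insert_noteq_member)
    show ?thesis
    proof (cases "e \<in> T \<and> count M e < 2")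
      case False
      have "T \<subseteq> set_mset (M - {#e#})"
      proof
        fix t assume t: "t \<in> T"
        show "t \<in># M - {#e#}"
        proof (cases "t = e")
          case True
          then show ?thesis using False t by (simp flip: count_greater_zero_iff)
        next
          case False
          then show ?thesis using t M(2) other by blast
        qed
      qed
      then show ?thesis by (rule T_con)
    next
      case True
      then obtain l where l: "l \<in># M" "l \<notin> T" "spans e l" using safe[of e] by fastforce
      have sub: "T - {e} \<subseteq> set_mset (M - {#e#})"
        using M(2) other by blast
      have lM: "l \<in># M - {#e#}" using l True other by blast
      obtain a b where ab: "l = {a, b}" "a \<in> V" "b \<in> V" using edgeE[of l] l(1) M(1) by blast
      obtain c d where cd: "l = {c, d}" "c \<in> under e" "d \<notin> under e" "d \<in> V"
        using spans_iff[of a b e] l M(1) ab insert_commute[of a b "{}"] by blast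
      let ?G = "set_mset (M - {#e#})"
      have "con ?G r v" if v: "v \<in> V" for v
      proof (cases "v \<in> under e")
        case False
        then show ?thesis using con_mono[OF sub con_not_under[OF v]] by simp
      next
        case in_e: True
        have "con ?G r d" using con_mono[OF sub con_not_under[OF cd(4,3)]] .
        moreover have "con ?G d c" using con_sym[OF con_edge[of c d ?G]] lM cd(1) by simp
        moreover have "con ?G c v" using con_mono[OF sub con_under[OF _ cd(2) in_e]] True by simp
        ultimately show ?thesis using con_trans by blast
      qed
      then have "con ?G u v" if "u \<in> V" "v \<in> V" for u v
        using con_trans[OF con_sym, of ?G r u v] that by blast
      then show ?thesis by (simp add: connected_graph_def con_def)
    qed
  qed
  then show ?thesis using T_con[OF M(2)] by (simp add: two_edge_connected_def)
qed

end

section \<open>Colouring the links of a laminar family\<close>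

text \<open>The sets crossed by \<open>l\<close> fall into two groups, and within a group the earlier links crossing one
  set cross the other as well or vice versa. So each group rules out at most one colour.\<close>

locale greedy_colouring =
  fixes I :: "'e set" and cr :: "'e \<Rightarrow> 'l \<Rightarrow> bool" and ls :: "'l list"
  assumes distinct_ls: "distinct ls"
    and two_chains: "\<And>xs l ys. ls = xs @ l # ys \<Longrightarrow> \<exists>side :: 'e \<Rightarrow> bool. \<forall>e\<in>I. \<forall>f\<in>I.
      cr e l \<longrightarrow> cr f l \<longrightarrow> side e = side f \<longrightarrow>
      (\<forall>l'\<in>set xs. cr e l' \<longrightarrow> cr f l') \<or> (\<forall>l'\<in>set xs. cr f l' \<longrightarrow> cr e l')"
begin

text \<open>Such a colour would leave a set monochromatic although \<open>l\<close> is not the first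
  link to cross it. Sets crossed for the first time forbid nothing.\<close>

definition bad :: "('l \<times> nat) list \<Rightarrow> 'l \<Rightarrow> nat \<Rightarrow> bool" where
  "bad acc l c \<longleftrightarrow> (\<exists>e\<in>I. cr e l \<and> (\<exists>a\<in>set acc. cr e (fst a)) \<and>
     (\<forall>a\<in>set acc. \<not> cr e (fst a) \<or> snd a = c))"

text \<open>The fallback colour 2 is justified by \<open>some_colour_not_bad\<close>.\<close>

definition extend :: "'l \<Rightarrow> ('l \<times> nat) list \<Rightarrow> ('l \<times> nat) list" where
  "extend l acc = (l, if \<not> bad acc l 0 then 0 else if \<not> bad acc l 1 then 1 else 2) # acc"

text \<open>If all three colours were bad, two of the three witnesses would be in one group and
  hence share an earlier link, which would then have two colours.\<close>

lemma some_colour_not_bad: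
  assumes "ls = xs @ l # ys" "map fst acc = rev xs"
  shows "\<not> bad acc l 0 \<or> \<not> bad acc l 1 \<or> \<not> bad acc l 2"
proof (rule ccontr)
  assume "\<not> ?thesis"
  then have b: "bad acc l 0" "bad acc l 1" "bad acc l 2" by simp_all
  obtain e0 where e0: "e0 \<in> I" "cr e0 l" "\<exists>a\<in>set acc. cr e0 (fst a)" "\<forall>a\<in>set acc. cr e0 (fst a) \<longrightarrow> snd a = 0"
    using b(1) unfolding bad_def by auto
  obtain e1 where e1: "e1 \<in> I" "cr e1 l" "\<exists>a\<in>set acc. cr e1 (fst a)" "\<forall>a\<in>set acc. cr e1 (fst a) \<longrightarrow> snd a = 1"
    using b(2) unfolding bad_def by auto
  obtain e2 where e2: "e2 \<in> I" "cr e2 l" "\<exists>a\<in>set acc. cr e2 (fst a)" "\<forall>a\<in>set acc. cr e2 (fst a) \<longrightarrow> snd a = 2"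
    using b(3) unfolding bad_def by auto
  obtain side :: "'e \<Rightarrow> bool" where side: "\<forall>e\<in>I. \<forall>f\<in>I. cr e l \<longrightarrow> cr f l \<longrightarrow> side e = side f \<longrightarrow>
      (\<forall>l'\<in>set xs. cr e l' \<longrightarrow> cr f l') \<or> (\<forall>l'\<in>set xs. cr f l' \<longrightarrow> cr e l')"
    using two_chains[OF assms(1)] by (elim exE)
  have xs: "fst a \<in> set xs" if "a \<in> set acc" for a
    using that arg_cong[OF assms(2), of set] by auto
  have differ: "side e \<noteq> side f"
    if e: "e \<in> I" and f: "f \<in> I" and cr: "cr e l" "cr f l"
      and ne: "\<exists>a\<in>set acc. cr e (fst a)" "\<exists>a\<in>set acc. cr f (fst a)"
      and mono: "\<forall>a\<in>set acc. cr e (fst a) \<longrightarrow> snd a = c" "\<forall>a\<in>set acc. cr f (fst a) \<longrightarrow> snd a = d" 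
      and "c \<noteq> d"
    for e f c d
  proof
    assume "side e = side f"
    with side e f cr have "(\<forall>l'\<in>set xs. cr e l' \<longrightarrow> cr f l') \<or> (\<forall>l'\<in>set xs. cr f l' \<longrightarrow> cr e l')"
      by simp
    then obtain a where "a \<in> set acc" "cr e (fst a)" "cr f (fst a)"
      using ne xs by blast
    then have "snd a = c" "snd a = d" using mono by blast+
    then show False using \<open>c \<noteq> d\<close> by simp
  qed
  have "side e0 \<noteq> side e1" by (rule differ[OF e0(1) e1(1) e0(2) e1(2) e0(3) e1(3) e0(4) e1(4)]) simp
  moreover have "side e1 \<noteq> side e2" by (rule differ[OF e1(1) e2(1) e1(2) e2(2) e1(3) e2(3) e1(4) e2(4)]) simp
  moreover have "side e0 \<noteq> side e2" by (rule differ[OF e0(1) e2(1) e0(2) e2(2) e0(3) e2(3) e0(4) e2(4)]) simp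
  ultimately show False by blast
qed

text \<open>Contrapositive form: a set that meets only one colour is crossed at most once so far. A
  link whose colour is not bad leaves every previously crossed set that it crosses with two
  colours.\<close>

lemma colouring_invariant:
  "ls = xs @ ys \<Longrightarrow> map fst (fold extend xs []) = rev xs \<and> (\<forall>a\<in>set (fold extend xs []). snd a < 3) \<and>
     (\<forall>e\<in>I. \<forall>c. (\<forall>a\<in>set (fold extend xs []). cr e (fst a) \<longrightarrow> snd a = c) \<longrightarrow>
       (\<forall>l\<in>set xs. \<forall>l'\<in>set xs. cr e l \<longrightarrow> cr e l' \<longrightarrow> l = l'))"
proof (induction xs arbitrary: ys rule: rev_induct)
  case (snoc l xs)
  let ?acc = "fold extend xs []"
  from snoc.prems have ls: "ls = xs @ l # ys" by simp
  note IH = snoc.IH[OF ls]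
  have acc: "map fst ?acc = rev xs" using IH by blast
  have "fst ` set ?acc = set xs" using arg_cong[OF acc, of set] by simp
  then have fst_acc: "l' \<in> set xs \<longleftrightarrow> (\<exists>a\<in>set ?acc. fst a = l')" for l'
    by (metis imageE imageI)
  obtain c where c: "extend l ?acc = (l, c) # ?acc" "\<not> bad ?acc l c" "c < 3"
    using some_colour_not_bad[OF ls acc] by (auto simp: extend_def)
  have "l1 = l2"
    if e: "e \<in> I" and mono: "\<forall>a\<in>set ((l, c) # ?acc). cr e (fst a) \<longrightarrow> snd a = d"
      and l1: "l1 \<in> set (xs @ [l])" "cr e l1" and l2: "l2 \<in> set (xs @ [l])" "cr e l2" for e d l1 l2
  proof (cases "cr e l")
    case False
    then have "l1 \<in> set xs" "l2 \<in> set xs" using l1 l2 by auto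
    then show ?thesis using IH e mono l1(2) l2(2) by (metis list.set_intros(2))
  next
    case True
    then have "d = c" using mono by simp
    then have "\<not> (\<exists>a\<in>set ?acc. cr e (fst a))"
      using c(2) True mono e unfolding bad_def by auto
    then have "\<not> cr e l'" if "l' \<in> set xs" for l' using that fst_acc[of l'] by metis
    then show ?thesis using l1 l2 by auto
  qed
  then show ?case using acc IH c by auto
qed simp

text \<open>The colour \<open>c\<close> is arbitrary because each of the three candidates may give
  up the links of one colour.\<close>

lemma colouring:
  defines "cs \<equiv> fold extend ls []"
  shows "map fst cs = rev ls" "a \<in> set cs \<Longrightarrow> snd a < 3"
    "e \<in> I \<Longrightarrow> l \<in> set ls \<Longrightarrow> l' \<in> set ls \<Longrightarrow> cr e l \<Longrightarrow> cr e l' \<Longrightarrow> l \<noteq> l' \<Longrightarrow> \<exists>a\<in>set cs. cr e (fst a) \<and> snd a \<noteq> c"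
  using colouring_invariant[of ls "[]"] unfolding cs_def by simp_all blast+

end

text \<open>If the earlier link \<open>l'\<close> had both ends in \<open>B f\<close>, it would be deeper than \<open>l\<close>.\<close>

lemma laminar_two_chains:
  fixes B :: "'e \<Rightarrow> 'v set"
  assumes fin: "finite I"
    and laminar: "\<And>e f u. e \<in> I \<Longrightarrow> f \<in> I \<Longrightarrow> u \<in> B e \<Longrightarrow> u \<in> B f \<Longrightarrow> B e \<subseteq> B f \<or> B f \<subseteq> B e"
    and e: "e \<in> I" "u \<in> B e" "v \<notin> B e" and f: "f \<in> I" "u \<in> B f" "v \<notin> B f"
    and deep: "\<And>a b. (a, b) \<in> L \<Longrightarrow> card {g \<in> I. a \<in> B g \<and> b \<in> B g} \<le> card {g \<in> I. u \<in> B g \<and> v \<in> B g}"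
  shows "(\<forall>(a, b)\<in>L. (a \<in> B e) \<noteq> (b \<in> B e) \<longrightarrow> (a \<in> B f) \<noteq> (b \<in> B f)) \<or>
    (\<forall>(a, b)\<in>L. (a \<in> B f) \<noteq> (b \<in> B f) \<longrightarrow> (a \<in> B e) \<noteq> (b \<in> B e))"
proof -
  have *: "(a \<in> B f) \<noteq> (b \<in> B f)"
    if sub: "B e \<subseteq> B f" and f: "f \<in> I" "u \<in> B f" "v \<notin> B f" and L: "(a, b) \<in> L"
      and cr: "(a \<in> B e) \<noteq> (b \<in> B e)" for e f a b
  proof (rule ccontr)
    assume "\<not> ?thesis"
    then have ab: "a \<in> B f" "b \<in> B f" using cr sub by blast+
    \<comment> \<open>A member containing both \<open>u\<close> and \<open>v\<close> meets
      \<open>B f\<close> in \<open>u\<close> and reaches outside it at \<open>v\<close>, so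
      laminarity puts \<open>B f\<close> inside it. The set \<open>B f\<close> itself makes the
      inclusion strict, contrary to \<open>deep\<close>.\<close>
    have "{g \<in> I. u \<in> B g \<and> v \<in> B g} \<subset> {g \<in> I. a \<in> B g \<and> b \<in> B g}"
    proof
      show "{g \<in> I. u \<in> B g \<and> v \<in> B g} \<subseteq> {g \<in> I. a \<in> B g \<and> b \<in> B g}"
      proof
        fix g assume g: "g \<in> {g \<in> I. u \<in> B g \<and> v \<in> B g}"
        then have "B f \<subseteq> B g" using laminar[of f g u] f by blast
        then show "g \<in> {g \<in> I. a \<in> B g \<and> b \<in> B g}" using g ab by blast
      qed
    qed (use f ab in blast)
    from psubset_card_mono[OF _ this] fin deep[OF L] show False by simp
  qed
  from laminar[OF e(1) f(1) e(2) f(2)] show ?thesis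
  proof
    assume "B e \<subseteq> B f"
    from *[OF this f] show ?thesis by blast
  next
    assume "B f \<subseteq> B e"
    from *[OF this e] show ?thesis by blast
  qed
qed

section \<open>Polynomial-time functions on encoded data\<close>

text \<open>Injectivity lets \<open>Equal\<close> on trees decide equality of values and makes the
  input recoverable from its tree.\<close>

class encodable =
  fixes encode :: "'a \<Rightarrow> tree"
  assumes encode_inject: "encode x = encode y \<longleftrightarrow> x = y"

instantiation bool :: encodable
begin
definition encode_bool :: "bool \<Rightarrow> tree" where "encode_bool b = (if b then Node Leaf Leaf else Leaf)"
instance by standard (simp add: encode_bool_def)
end

lemma enc_nat_0 [simp]: "enc_nat 0 = Leaf"
  by (simp add: enc_nat.simps)

lemma enc_nat_pos: "n > 0 \<Longrightarrow> enc_nat n = Node (encode (odd n)) (enc_nat (n div 2))"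
  by (subst enc_nat.simps) (simp add: encode_bool_def)

lemma enc_nat_inject: "enc_nat m = enc_nat n \<longleftrightarrow> m = n"
proof (induction m arbitrary: n rule: less_induct)
  case (less m)
  show ?case
  proof (cases "m = 0 \<or> n = 0")
    case True
    then show ?thesis using enc_nat_pos[of m] enc_nat_pos[of n] by fastforce
  next
    case False
    then have "enc_nat m = enc_nat n \<longleftrightarrow> odd m = odd n \<and> m div 2 = n div 2"
      using less.IH[of "m div 2" "n div 2"] by (simp add: enc_nat_pos encode_inject)
    also have "\<dots> \<longleftrightarrow> m = n"
      by (metis div_mult_mod_eq odd_iff_mod_2_eq_one not_mod_2_eq_0_eq_1)
    finally show ?thesis .
  qed
qed

instantiation nat :: encodable
begin
definition encode_nat :: "nat \<Rightarrow> tree" where [simp]: "encode = enc_nat"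
instance by standard (simp add: enc_nat_inject)
end

instantiation prod :: (encodable, encodable) encodable
begin
definition encode_prod :: "'a \<times> 'b \<Rightarrow> tree" where "encode p = Node (encode (fst p)) (encode (snd p))"
instance by standard (auto simp: encode_prod_def encode_inject)
end

lemma encode_Pair [simp]: "encode (a, b) = Node (encode a) (encode b)"
  by (simp add: encode_prod_def)

instantiation list :: (encodable) encodable
begin
definition encode_list :: "'a list \<Rightarrow> tree" where "encode = enc_list encode"
instance
proof
  have "enc_list encode xs = enc_list encode ys \<longleftrightarrow> xs = ys" for xs ys :: "'a list"
    by (induction xs arbitrary: ys) (case_tac ys; auto simp: encode_inject)+
  then show "encode x = encode y \<longleftrightarrow> x = y" for x y :: "'a list"
    by (simp add: encode_list_def)
qed
end

lemma encode_Nil [simp]: "encode [] = Leaf" and encode_Cons [simp]: "encode (x # xs) = Node (encode x) (encode xs)"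
  by (simp_all add: encode_list_def)

lemma encode_map: "encode (map f xs) = enc_list (\<lambda>x. encode (f x)) xs"
  by (induction xs) auto

section \<open>Polynomial bounds and timed execution\<close>

definition poly_bounded :: "(nat \<Rightarrow> nat) \<Rightarrow> bool" where
  "poly_bounded f \<longleftrightarrow> (\<exists>p. \<forall>n. f n \<le> poly p n)"

lemma poly_nat_mono: "m \<le> n \<Longrightarrow> poly p m \<le> poly p n" for p :: "nat poly"
  by (induction p) (auto intro!: add_mono mult_mono)

lemma poly_bounded_id: "poly_bounded (\<lambda>n. n)"
  unfolding poly_bounded_def by (rule exI[of _ "[:0, 1:]"]) simp

lemma poly_bounded_const: "poly_bounded (\<lambda>_. c)"
  unfolding poly_bounded_def by (rule exI[of _ "[:c:]"]) simp

lemma poly_bounded_add: "poly_bounded f \<Longrightarrow> poly_bounded g \<Longrightarrow> poly_bounded (\<lambda>n. f n + g n)"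
  unfolding poly_bounded_def 
proof (elim exE)
  fix p q assume "\<forall>n. f n \<le> poly p n" "\<forall>n. g n \<le> poly q n"
  then show "\<exists>p. \<forall>n. f n + g n \<le> poly p n"
    by (intro exI[of _ "p + q"]) (auto intro!: add_mono)
qed

lemma poly_bounded_mult: "poly_bounded f \<Longrightarrow> poly_bounded g \<Longrightarrow> poly_bounded (\<lambda>n. f n * g n)"
  unfolding poly_bounded_def 
proof (elim exE)
  fix p q assume "\<forall>n. f n \<le> poly p n" "\<forall>n. g n \<le> poly q n"
  then show "\<exists>p. \<forall>n. f n * g n \<le> poly p n"
    by (intro exI[of _ "p * q"]) (auto intro!: mult_mono)
qed

lemma poly_bounded_poly: "poly_bounded f \<Longrightarrow> poly_bounded (\<lambda>n. poly p (f n))"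
  unfolding poly_bounded_def by (metis poly_nat_mono poly_pcompose)

lemma poly_bounded_Suc: "poly_bounded f \<Longrightarrow> poly_bounded (\<lambda>n. Suc (f n))"
  using poly_bounded_add[OF poly_bounded_const[of 1]] by simp

lemmas poly_bounded_intros = poly_bounded_id poly_bounded_const poly_bounded_add poly_bounded_mult
  poly_bounded_poly poly_bounded_Suc

text \<open>A total-correctness triple with a time budget. Nesting it in the postcondition chains
  the parts of a sequence.\<close>

definition reaches :: "com \<Rightarrow> store \<Rightarrow> nat \<Rightarrow> (store \<Rightarrow> bool) \<Rightarrow> bool" where
  "reaches c s T Q \<longleftrightarrow> (\<exists>t s'. exec c s t s' \<and> t \<le> T \<and> Q s')"

lemma reaches_mono: "reaches c s T Q \<Longrightarrow> T \<le> T' \<Longrightarrow> (\<And>s'. Q s' \<Longrightarrow> Q' s') \<Longrightarrow> reaches c s T' Q'"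
  unfolding reaches_def using le_trans by blast

lemma reaches_Assign:
  "1 + size (eval_exp a s) \<le> T \<Longrightarrow> Q (s(x := eval_exp a s)) \<Longrightarrow> reaches (Assign x a) s T Q"
  unfolding reaches_def using exec.Assign by blast

lemma reaches_Seq:
  assumes "reaches c1 s T1 (\<lambda>s'. reaches c2 s' T2 Q)" "T1 + T2 \<le> T"
  shows "reaches (Seq c1 c2) s T Q"
proof -
  obtain t1 s' t2 s'' where "exec c1 s t1 s'" "t1 \<le> T1" "exec c2 s' t2 s''" "t2 \<le> T2" "Q s''"
    using assms(1) unfolding reaches_def by blast
  then show ?thesis
    unfolding reaches_def
    by (intro exI[of _ "t1 + t2"] exI[of _ s''] conjI exec.Seq) (use assms(2) in auto)
qed

lemma reaches_Cond:
  assumes "eval_exp b s \<noteq> Leaf \<Longrightarrow> reaches c1 s T1 Q" "eval_exp b s = Leaf \<Longrightarrow> reaches c2 s T2 Q"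
    "1 + (T1 + T2) \<le> T"
  shows "reaches (Cond b c1 c2) s T Q"
proof (cases "eval_exp b s = Leaf")
  case True
  then obtain t s' where "exec c2 s t s'" "t \<le> T2" "Q s'"
    using assms(2) unfolding reaches_def by blast
  moreover have "1 + t \<le> T" using \<open>t \<le> T2\<close> assms(3) by simp
  ultimately show ?thesis
    unfolding reaches_def using exec.CondFalse[OF True] by blast
next
  case False
  then obtain t s' where "exec c1 s t s'" "t \<le> T1" "Q s'"
    using assms(1) unfolding reaches_def by blast
  moreover have "1 + t \<le> T" using \<open>t \<le> T1\<close> assms(3) by simp
  ultimately show ?thesis
    unfolding reaches_def using exec.CondTrue[OF False] by blast
qed

text \<open>Assignments are charged for what they store, so every result of a polynomial-time
  program has polynomial size.\<close>

lemma exec_size: "exec c s t s' \<Longrightarrow> size (s' x) \<le> size (s x) + t"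
proof (induction arbitrary: x rule: exec.induct)
  case (Seq c1 s t1 s' c2 t2 s'')
  then show ?case using Seq.IH(1)[of x] Seq.IH(2)[of x] by linarith
next
  case (WhileTrue b s c t1 s' t2 s'')
  then show ?case using WhileTrue.IH(1)[of x] WhileTrue.IH(2)[of x] by linarith
next
  case (CondTrue b s c1 t s' c2)
  then show ?case using CondTrue.IH[of x] by linarith
next
  case (CondFalse b s c2 t s' c1)
  then show ?case using CondFalse.IH[of x] by linarith
qed auto

definition computes ::
  "com \<Rightarrow> nat \<Rightarrow> nat poly \<Rightarrow> ('a::encodable \<Rightarrow> 'b::encodable) \<Rightarrow> bool" where
  "computes c N p f \<longleftrightarrow> (\<forall>x s. s 0 = encode x \<longrightarrow>
     reaches c s (poly p (size (encode x))) (\<lambda>s'. s' 0 = encode (f x) \<and> (\<forall>k>N. s' k = s k)))"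

definition ptime :: "('a::encodable \<Rightarrow> 'b::encodable) \<Rightarrow> bool" where
  "ptime f \<longleftrightarrow> (\<exists>c N p. computes c N p f)"

lemma ptimeI:
  fixes f :: "'a::encodable \<Rightarrow> 'b::encodable"
  assumes "\<And>x s. s 0 = encode x \<Longrightarrow>
      reaches c s (b (size (encode x))) (\<lambda>s'. s' 0 = encode (f x) \<and> (\<forall>k>N. s' k = s k))"
    and "poly_bounded b"
  shows "ptime f"
proof -
  obtain p where "\<And>n. b n \<le> poly p n"
    using assms(2) unfolding poly_bounded_def by blast
  then have "computes c N p f"
    unfolding computes_def using assms(1) reaches_mono by (metis (no_types, lifting))
  then show ?thesis unfolding ptime_def by blast
qed

lemma ptime_assignI:
  fixes f :: "'a::encodable \<Rightarrow> 'b::encodable"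
  assumes "\<And>x s. s 0 = encode x \<Longrightarrow> eval_exp a s = encode (f x)"
    and "\<And>x. size (encode (f x)) \<le> b (size (encode x))" "poly_bounded b"
  shows "ptime f"
proof (rule ptimeI[where N = 0 and b = "\<lambda>n. 1 + b n"])
  fix x :: 'a and s :: store
  assume "s 0 = encode x"
  then show "reaches (Assign 0 a) s (1 + b (size (encode x)))
      (\<lambda>s'. s' 0 = encode (f x) \<and> (\<forall>k>0. s' k = s k))"
    using assms(1)[of s x] assms(2)[of x] by (intro reaches_Assign) auto
qed (intro poly_bounded_intros assms)

lemma computesD:
  "computes c N p f \<Longrightarrow> s 0 = encode x \<Longrightarrow>
     reaches c s (poly p (size (encode x))) (\<lambda>s'. s' 0 = encode (f x) \<and> (\<forall>k>N. s' k = s k))"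
  unfolding computes_def by blast

lemma computes_size:
  assumes "computes c N p f"
  shows "size (encode (f x)) \<le> size (encode x) + poly p (size (encode x))"
proof -
  obtain t s' where "exec c (\<lambda>_. encode x) t s'" "t \<le> poly p (size (encode x))" "s' 0 = encode (f x)"
    using assms unfolding computes_def reaches_def by metis
  with exec_size[OF this(1), of 0] show ?thesis by simp
qed

lemma ptime_size:
  assumes "ptime f"
  obtains p where "\<And>x. size (encode (f x)) \<le> poly p (size (encode x))"
proof -
  obtain c N p where "computes c N p f" using assms unfolding ptime_def by blast
  from computes_size[OF this] show ?thesis
    by (intro that[of "[:0, 1:] + p"]) (auto simp: add.commute)
qed

section \<open>Closure properties of polynomial-time functions\<close>

named_theorems ptime_intros

lemma ptime_id [ptime_intros]: "ptime (\<lambda>x. x)"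
  by (rule ptime_assignI[of "Var 0" _ "\<lambda>n. n"]) (auto intro: poly_bounded_intros)

lemma ptime_const [ptime_intros]: "ptime (\<lambda>_. c)"
proof -
  have "\<exists>a. \<forall>s. eval_exp a s = t" for t
  proof (induction t)
    case Leaf
    then show ?case by (intro exI[of _ Const_Leaf]) simp
  next
    case (Node l r)
    then obtain a b where "\<forall>s. eval_exp a s = l" "\<forall>s. eval_exp b s = r" by blast
    then show ?case by (intro exI[of _ "Mk_Node a b"]) simp
  qed
  then obtain a where "\<forall>s. eval_exp a s = encode c" by blast
  then show ?thesis
    by (intro ptime_assignI[of a _ "\<lambda>_. size (encode c)"]) (auto intro: poly_bounded_intros)
qed

lemma ptime_comp:
  fixes f :: "'a::encodable \<Rightarrow> 'b::encodable" and g :: "'b \<Rightarrow> 'c::encodable"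
  assumes "ptime g" "ptime f"
  shows "ptime (\<lambda>x. g (f x))"
proof -
  obtain c1 N1 p1 c2 N2 p2 where f: "computes c1 N1 p1 f" and g: "computes c2 N2 p2 g"
    using assms unfolding ptime_def by blast
  show ?thesis
  proof (rule ptimeI[where N = "max N1 N2" and b = "\<lambda>n. poly p1 n + poly p2 (n + poly p1 n)"])
    fix x :: 'a and s :: store
    assume s: "s 0 = encode x"
    let ?n = "size (encode x)"
    show "reaches (Seq c1 c2) s (poly p1 ?n + poly p2 (?n + poly p1 ?n))
      (\<lambda>s'. s' 0 = encode (g (f x)) \<and> (\<forall>k>max N1 N2. s' k = s k))"
    proof (intro reaches_Seq[OF _ order_refl] reaches_mono[OF computesD[OF f, where s = s and x = x]] s
        order_refl)
      fix s' assume s': "s' 0 = encode (f x) \<and> (\<forall>k>N1. s' k = s k)"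
      show "reaches c2 s' (poly p2 (?n + poly p1 ?n))
         (\<lambda>s'. s' 0 = encode (g (f x)) \<and> (\<forall>k>max N1 N2. s' k = s k))"
        using s' by (intro reaches_mono[OF computesD[OF g, where x = "f x"]]
            poly_nat_mono computes_size[OF f]) auto
    qed
  qed (intro poly_bounded_intros)
qed

lemma ptime_Pair [ptime_intros]:
  fixes f :: "'a::encodable \<Rightarrow> 'b::encodable" and g :: "'a \<Rightarrow> 'c::encodable"
  assumes "ptime f" "ptime g"
  shows "ptime (\<lambda>x. (f x, g x))"
proof -
  obtain c1 N1 p1 c2 N2 p2 where f: "computes c1 N1 p1 f" and g: "computes c2 N2 p2 g"
    using assms unfolding ptime_def by blast
  define K where "K = Suc (max N1 N2)"
  have K: "N1 < K" "N2 < K" by (auto simp: K_def)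
  \<comment> \<open>The summands are the costs in program order, nested like the sequence
    itself.\<close>
  define b where "b n = (1 + n) + (poly p1 n + ((1 + (n + poly p1 n)) + ((1 + n) +
      (poly p2 n + (2 + ((n + poly p1 n) + (n + poly p2 n)))))))" for n
  show ?thesis
  proof (rule ptimeI[where N = "Suc K" and b = b])
    fix x :: 'a and s :: store
    assume s: "s 0 = encode x"
    let ?n = "size (encode x)"
    note fsz = computes_size[OF f, of x] and gsz = computes_size[OF g, of x]
    show "reaches (Seq (Assign K (Var 0)) (Seq c1 (Seq (Assign (Suc K) (Var 0))
        (Seq (Assign 0 (Var K)) (Seq c2 (Assign 0 (Mk_Node (Var (Suc K)) (Var 0)))))))) s (b ?n)
        (\<lambda>s'. s' 0 = encode (f x, g x) \<and> (\<forall>k>Suc K. s' k = s k))"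
      unfolding b_def using K s fsz gsz
      by (intro reaches_Seq[OF _ order_refl] reaches_Assign reaches_mono[OF computesD[OF f, where x = x]]
          reaches_mono[OF computesD[OF g, where x = x]] order_refl) auto
  qed (unfold b_def, intro poly_bounded_intros)
qed

lemma ptime_fst [ptime_intros]: "ptime f \<Longrightarrow> ptime (\<lambda>x. fst (f x))"
  by (rule ptime_comp[of fst], rule ptime_assignI[of "Left (Var 0)" _ "\<lambda>n. n"])
     (auto simp: encode_prod_def intro: poly_bounded_intros)

lemma ptime_snd [ptime_intros]: "ptime f \<Longrightarrow> ptime (\<lambda>x. snd (f x))"
  by (rule ptime_comp[of snd], rule ptime_assignI[of "Right (Var 0)" _ "\<lambda>n. n"])
     (auto simp: encode_prod_def intro: poly_bounded_intros)

lemma ptime_eq [ptime_intros]: "ptime f \<Longrightarrow> ptime g \<Longrightarrow> ptime (\<lambda>x. f x = g x)"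
  by (rule ptime_comp[of "\<lambda>p. fst p = snd p" "\<lambda>x. (f x, g x)", simplified],
      rule ptime_assignI[of "Equal (Left (Var 0)) (Right (Var 0))" _ "\<lambda>_. 1"])
     (auto simp: encode_prod_def encode_bool_def encode_inject intro: poly_bounded_intros ptime_intros)

lemma ptime_Cons [ptime_intros]: "ptime f \<Longrightarrow> ptime g \<Longrightarrow> ptime (\<lambda>x. f x # g x)"
  by (rule ptime_comp[of "\<lambda>p. fst p # snd p" "\<lambda>x. (f x, g x)", simplified],
      rule ptime_assignI[of "Var 0" _ "\<lambda>n. n"])
     (auto simp: encode_prod_def intro: poly_bounded_intros ptime_intros)

lemma ptime_tl [ptime_intros]: "ptime f \<Longrightarrow> ptime (\<lambda>x. tl (f x))"
proof (rule ptime_comp[of tl], rule ptime_assignI[of "Right (Var 0)" _ "\<lambda>n. n"])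
  show "s 0 = encode x \<Longrightarrow> eval_exp (Right (Var 0)) s = encode (tl x)" for s and x :: "'b list"
    by (cases x) auto
  show "size (encode (tl x)) \<le> size (encode x)" for x :: "'b list"
    by (cases x) auto
qed (auto intro: poly_bounded_intros)

lemma ptime_if [ptime_intros]:
  fixes f :: "'a::encodable \<Rightarrow> 'b::encodable"
  assumes "ptime b" "ptime f" "ptime g"
  shows "ptime (\<lambda>x. if b x then f x else g x)"
proof -
  obtain c0 N0 p0 c1 N1 p1 c2 N2 p2
    where b: "computes c0 N0 p0 b" and f: "computes c1 N1 p1 f" and g: "computes c2 N2 p2 g"
    using assms unfolding ptime_def by blast
  define K where "K = Suc (max N0 (max N1 N2))"
  have K: "N0 < K" "N1 < K" "N2 < K" by (auto simp: K_def)
  define T where "T n = (1 + n) + (poly p0 n +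
      (1 + (((1 + n) + poly p1 n) + ((1 + n) + poly p2 n))))" for n
  show ?thesis
  proof (rule ptimeI[where N = "K" and b = T])
    fix x :: 'a and s :: store
    assume s: "s 0 = encode x"
    let ?n = "size (encode x)"
    show "reaches (Seq (Assign K (Var 0)) (Seq c0 (Cond (Var 0)
        (Seq (Assign 0 (Var K)) c1) (Seq (Assign 0 (Var K)) c2)))) s (T ?n)
        (\<lambda>s'. s' 0 = encode (if b x then f x else g x) \<and> (\<forall>k>K. s' k = s k))"
      unfolding T_def using K s
      by (intro reaches_Seq[OF _ order_refl] reaches_Cond[OF _ _ order_refl] reaches_Assign reaches_mono[OF computesD[OF b, where x = x]]
          reaches_mono[OF computesD[OF f, where x = x]] reaches_mono[OF computesD[OF g, where x = x]] order_refl)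
         (auto simp: encode_bool_def split: if_splits)
  qed (unfold T_def, intro poly_bounded_intros)
qed

lemma ptime_not [ptime_intros]:
  assumes "ptime f"
  shows "ptime (\<lambda>x. \<not> f x)"
proof -
  have "(\<lambda>x. \<not> f x) = (\<lambda>x. if f x then False else True)" by auto
  with assms show ?thesis by (simp only: ptime_intros)
qed

lemma ptime_conj [ptime_intros]:
  assumes "ptime f" "ptime g"
  shows "ptime (\<lambda>x. f x \<and> g x)"
proof -
  have "(\<lambda>x. f x \<and> g x) = (\<lambda>x. if f x then g x else False)" by auto
  with assms show ?thesis by (simp only: ptime_intros)
qed

lemma ptime_disj [ptime_intros]:
  assumes "ptime f" "ptime g"
  shows "ptime (\<lambda>x. f x \<or> g x)"
proof -
  have "(\<lambda>x. f x \<or> g x) = (\<lambda>x. if f x then True else g x)" by auto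
  with assms show ?thesis by (simp only: ptime_intros)
qed

lemma reaches_WhileFalse: "eval_exp b s = Leaf \<Longrightarrow> 1 \<le> T \<Longrightarrow> Q s \<Longrightarrow> reaches (While b c) s T Q"
  unfolding reaches_def using exec.WhileFalse by blast

lemma reaches_WhileTrue:
  assumes "eval_exp b s \<noteq> Leaf" "reaches c s T1 (\<lambda>s'. reaches (While b c) s' T2 Q)" "1 + T1 + T2 \<le> T"
  shows "reaches (While b c) s T Q"
proof -
  obtain t1 s' t2 s'' where *: "exec c s t1 s'" "t1 \<le> T1" "exec (While b c) s' t2 s''" "t2 \<le> T2" "Q s''"
    using assms(2) unfolding reaches_def by blast
  moreover have "1 + t1 + t2 \<le> T" using * assms(3) by linarith
  ultimately show ?thesis
    unfolding reaches_def using exec.WhileTrue[OF assms(1)] by blast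
qed

lemma length_le_size_encode: "length xs \<le> size (encode xs)"
  by (induction xs) auto

lemma size_encode_member: "x \<in> set xs \<Longrightarrow> size (encode x) \<le> size (encode xs)"
  by (induction xs) auto

text \<open>The size bound on all intermediate results is what makes bounded iteration polynomial:
  repeated squaring, for instance, violates it.\<close>

lemma ptime_fold:
  fixes g :: "'a::encodable \<Rightarrow> 'b::encodable \<Rightarrow> 'c::encodable \<Rightarrow> 'c"
  assumes l: "ptime l" and i: "ptime i"
    and g: "ptime (\<lambda>q. g (fst q) (fst (snd q)) (snd (snd q)))"
    and bound: "\<And>x n. size (encode (fold (g x) (take n (l x)) (i x))) \<le> r (size (encode x))"
    and r: "poly_bounded r"
  shows "ptime (\<lambda>x. fold (g x) (l x) (i x))"
proof -
  obtain c1 N1 p1 c2 N2 p2 c3 N3 p3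
    where l: "computes c1 N1 p1 l" and i: "computes c2 N2 p2 i"
      and g: "computes c3 N3 p3 (\<lambda>q. g (fst q) (fst (snd q)) (snd (snd q)))"
    using assms(1-3) unfolding ptime_def by blast
  obtain r' where r': "\<And>n. r n \<le> poly r' n" using r unfolding poly_bounded_def by blast
  define K where "K = Suc (max N1 (max N2 N3))"
  have K: "N1 < K" "N2 < K" "N3 < K" by (auto simp: K_def)
  \<comment> \<open>Register \<open>K\<close> holds the parameter, \<open>Suc K\<close> the rest of
    the list, \<open>Suc (Suc K)\<close> the accumulator. An empty list is encoded as
    \<open>Leaf\<close>, so the list serves as loop condition.\<close>
  define body where "body = Seq (Assign 0 (Mk_Node (Var K) (Mk_Node (Left (Var (Suc K))) (Var (Suc (Suc K))))))
    (Seq c3 (Seq (Assign (Suc (Suc K)) (Var 0)) (Assign (Suc K) (Right (Var (Suc K))))))"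
  \<comment> \<open>The cost of one round when parameter, list and accumulator have sizes at most
    \<open>X\<close>, \<open>Y\<close> and \<open>Z\<close>. With bounds valid throughout the loop,
    all rounds cost at most the same.\<close>
  define B where "B X Y Z = (1 + (2 + X + Y + Z)) + (poly p3 (2 + X + Y + Z) + ((1 + Z) + (1 + Y)))" for X Y Z
  have loop: "reaches (While (Var (Suc K)) body) s (1 + length ys * (1 + B (size (encode x)) Y Z))
      (\<lambda>s'. s' (Suc (Suc K)) = encode (fold (g x) ys a) \<and> (\<forall>k>Suc (Suc K). s' k = s k))"
    if "s K = encode x" "s (Suc K) = encode ys" "s (Suc (Suc K)) = encode a" "size (encode ys) \<le> Y"
      "\<And>n. size (encode (fold (g x) (take n ys) a)) \<le> Z" for s ys a x Y Z
    using that
  proof (induction ys arbitrary: s a)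
    case Nil
    then show ?case by (intro reaches_WhileFalse) auto
  next
    case (Cons y ys)
    have a: "size (encode a) \<le> Z" using Cons.prems(5)[of 0] by simp
    have a': "size (encode (g x y a)) \<le> Z" using Cons.prems(5)[of 1] by simp
    have sz: "size (encode y) \<le> Y" "size (encode ys) \<le> Y" using Cons.prems(4) by auto
    have g'': "reaches c3 s (poly p3 (2 + size (encode x) + Y + Z)) (\<lambda>s'. s' 0 = encode (g x y a) \<and> (\<forall>k>N3. s' k = s k))"
      if "s 0 = encode (x, y, a)" for s
      by (rule reaches_mono[OF computesD[OF g, where x = "(x, y, a)" and s = s]]) (use a sz that in \<open>auto intro!: poly_nat_mono\<close>)
    show ?case
    proof (rule reaches_WhileTrue)
      show "eval_exp (Var (Suc K)) s \<noteq> Leaf" using Cons.prems by simp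
      show "reaches body s (B (size (encode x)) Y Z) (\<lambda>s'. reaches (While (Var (Suc K)) body) s'
          (1 + length ys * (1 + B (size (encode x)) Y Z))
          (\<lambda>s'. s' (Suc (Suc K)) = encode (fold (g x) (y # ys) a) \<and> (\<forall>k>Suc (Suc K). s' k = s k)))"
        unfolding body_def B_def
      proof (intro reaches_Seq[OF _ order_refl] reaches_Assign reaches_mono[OF g''] order_refl,
          goal_cases)
        case (5 s')
        show ?case unfolding body_def[symmetric] B_def[symmetric]
          using 5 Cons.prems K sz(2)
          by (intro reaches_mono[OF Cons.IH[of _ "g x y a"]] order_refl)
             (use Cons.prems(5)[of "Suc n" for n] in auto)
      qed (use Cons.prems K a a' sz in auto)
    qed simp
  qed
  define T where "T n = (1 + n) + (poly p1 n + ((1 + (n + poly p1 n)) + ((1 + n) + (poly p2 n +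
    ((1 + (n + poly p2 n)) + ((1 + (n + poly p1 n) * (1 + B n (n + poly p1 n) (poly r' n)))
     + (1 + poly r' n)))))))" for n
  show ?thesis
  proof (rule ptimeI[where N = "Suc (Suc K)" and b = T])
    fix x :: 'a and s :: store
    assume s: "s 0 = encode x"
    let ?n = "size (encode x)"
    note lsz = computes_size[OF l, of x] and isz = computes_size[OF i, of x]
    have bd: "size (encode (fold (g x) (take n (l x)) (i x))) \<le> poly r' ?n" for n
      using bound r' order_trans by blast
    have len: "length (l x) \<le> ?n + poly p1 ?n"
      using length_le_size_encode lsz order_trans by blast
    have loop': "reaches (While (Var (Suc K)) body) s
      (1 + (?n + poly p1 ?n) * (1 + B ?n (?n + poly p1 ?n) (poly r' ?n)))
      (\<lambda>s'. s' (Suc (Suc K)) = encode (fold (g x) (l x) (i x)) \<and> (\<forall>k>Suc (Suc K). s' k = s k))"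
      if "s K = encode x" "s (Suc K) = encode (l x)" "s (Suc (Suc K)) = encode (i x)" for s
      by (rule reaches_mono[OF loop[OF that lsz bd]]) (use len in \<open>auto intro!: mult_mono simp del: mult_Suc_right\<close>)
    show "reaches (Seq (Assign K (Var 0)) (Seq c1 (Seq (Assign (Suc K) (Var 0)) (Seq (Assign 0 (Var K))
      (Seq c2 (Seq (Assign (Suc (Suc K)) (Var 0)) (Seq (While (Var (Suc K)) body)
      (Assign 0 (Var (Suc (Suc K))))))))))) s (T ?n)
        (\<lambda>s'. s' 0 = encode (fold (g x) (l x) (i x)) \<and> (\<forall>k>Suc (Suc K). s' k = s k))"
      unfolding T_def using K s lsz isz bd[of "length (l x)"]
      by (intro reaches_Seq[OF _ order_refl] reaches_Assign reaches_mono[OF computesD[OF l, where x = x]]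
          reaches_mono[OF computesD[OF i, where x = x]] reaches_mono[OF loop'] order_refl) auto
  qed (unfold T_def B_def, intro poly_bounded_intros)
qed

text \<open>The growth in one round may depend on the parameter and the list element but not on the
  accumulator, so it only adds up.\<close>

lemma ptime_fold_additive:
  fixes g :: "'a::encodable \<Rightarrow> 'b::encodable \<Rightarrow> 'c::encodable \<Rightarrow> 'c"
  assumes l: "ptime l" and i: "ptime i"
    and g: "ptime (\<lambda>q. g (fst q) (fst (snd q)) (snd (snd q)))"
    and step: "\<And>x h a. size (encode (g x h a)) \<le> size (encode a) + poly r (size (encode x) + size (encode h))"
  shows "ptime (\<lambda>x. fold (g x) (l x) (i x))"
proof -
  obtain p where p: "\<And>x. size (encode (l x)) \<le> poly p (size (encode x))"
    using ptime_size[OF l] by blast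
  obtain q where q: "\<And>x. size (encode (i x)) \<le> poly q (size (encode x))"
    using ptime_size[OF i] by blast
  have *: "size (encode (fold (g x) ys a)) \<le> size (encode a) + length ys * poly r (size (encode x) + Y)"
    if "\<forall>y\<in>set ys. size (encode y) \<le> Y" for x ys a Y
    using that
  proof (induction ys arbitrary: a)
    case (Cons y ys)
    have "poly r (size (encode x) + size (encode y)) \<le> poly r (size (encode x) + Y)"
      using Cons.prems by (intro poly_nat_mono) auto
    then show ?case using Cons.IH[of "g x y a"] Cons.prems step[of x y a] by auto
  qed simp
  show ?thesis
  proof (rule ptime_fold[OF l i g])
    fix x :: 'a and n
    let ?n = "size (encode x)"
    have sz: "\<forall>y\<in>set (take n (l x)). size (encode y) \<le> poly p ?n"
      using size_encode_member p by (meson in_set_takeD order_trans)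
    have len: "length (take n (l x)) \<le> poly p ?n"
      using length_le_size_encode[of "l x"] p[of x] by auto
    show "size (encode (fold (g x) (take n (l x)) (i x)))
        \<le> poly q ?n + poly p ?n * poly r (?n + poly p ?n)"
      using *[OF sz, of x "i x"] q[of x] mult_le_mono1[OF len, of "poly r (?n + poly p ?n)"]
      by linarith
  qed (intro poly_bounded_intros)
qed

section \<open>Operations on lists\<close>

lemma ptime_rev [ptime_intros]:
  assumes "ptime f"
  shows "ptime (\<lambda>x. rev (f x))"
proof -
  have "ptime (\<lambda>x. fold (\<lambda>h a. h # a) (f x) [])"
    by (rule ptime_fold_additive[where r = "[:1, 1:]"]) (intro ptime_intros assms | simp)+
  then show ?thesis by (simp add: fold_Cons_rev)
qed

lemma ptime_append [ptime_intros]: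
  assumes "ptime f" "ptime g"
  shows "ptime (\<lambda>x. f x @ g x)"
proof -
  have "ptime (\<lambda>x. fold (\<lambda>h a. h # a) (rev (f x)) (g x))"
    by (rule ptime_fold_additive[where r = "[:1, 1:]"]) (intro ptime_intros assms | simp)+
  then show ?thesis by (simp add: fold_Cons_rev)
qed

lemma ptime_map [ptime_intros]:
  assumes l: "ptime l" and g: "ptime (\<lambda>q. g (fst q) (snd q))"
  shows "ptime (\<lambda>x. map (g x) (l x))"
proof -
  obtain p where p: "\<And>q. size (encode (g (fst q) (snd q))) \<le> poly p (size (encode q))"
    using ptime_size[OF g] by blast
  have "fold (\<lambda>h a. g x h # a) ys zs = rev (map (g x) ys) @ zs" for x ys zs
    by (induction ys arbitrary: zs) auto
  moreover have "ptime (\<lambda>x. rev (fold (\<lambda>h a. g x h # a) (l x) []))"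
  proof (rule ptime_rev, rule ptime_fold_additive[OF l, where r = "pcompose p [:1, 1:] + [:1:]"])
    show "ptime (\<lambda>q. g (fst q) (fst (snd q)) # snd (snd q))"
    proof (rule ptime_Cons)
      show "ptime (\<lambda>q. g (fst q) (fst (snd q)))"
        using ptime_comp[OF g, of "\<lambda>q. (fst q, fst (snd q))"] by (simp add: ptime_intros)
    qed (intro ptime_intros)
    show "size (encode (g x h # a))
        \<le> size (encode a) + poly (p \<circ>\<^sub>p [:1, 1:] + [:1:]) (size (encode x) + size (encode h))" for x h a
      using p[of "(x, h)"] by (simp add: poly_pcompose)
  qed (intro ptime_intros)
  ultimately show ?thesis by simp
qed

lemma ptime_filter [ptime_intros]:
  assumes l: "ptime l" and g: "ptime (\<lambda>q. P (fst q) (snd q))"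
  shows "ptime (\<lambda>x. filter (P x) (l x))"
proof -
  have "fold (\<lambda>h a. if P x h then h # a else a) ys zs = rev (filter (P x) ys) @ zs" for x ys zs
    by (induction ys arbitrary: zs) auto
  moreover have "ptime (\<lambda>x. rev (fold (\<lambda>h a. if P x h then h # a else a) (l x) []))"
  proof (rule ptime_rev, rule ptime_fold_additive[OF l, where r = "[:1, 1:]"])
    have "ptime (\<lambda>q. P (fst q) (fst (snd q)))"
      using ptime_comp[OF g, of "\<lambda>q. (fst q, fst (snd q))"] by (simp add: ptime_intros)
    then show "ptime (\<lambda>q. if P (fst q) (fst (snd q)) then fst (snd q) # snd (snd q) else snd (snd q))"
      by (intro ptime_intros)
  qed (simp | intro ptime_intros)+
  ultimately show ?thesis by simp
qed

lemma ptime_bex [ptime_intros]: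
  assumes "ptime l" "ptime (\<lambda>q. P (fst q) (snd q))"
  shows "ptime (\<lambda>x. \<exists>h\<in>set (l x). P x h)"
proof -
  have "ptime (\<lambda>x. filter (P x) (l x) \<noteq> [])"
    by (intro ptime_intros assms)
  then show ?thesis by (simp add: filter_empty_conv)
qed

lemma ptime_ball [ptime_intros]:
  assumes "ptime l" "ptime (\<lambda>q. P (fst q) (snd q))"
  shows "ptime (\<lambda>x. \<forall>h\<in>set (l x). P x h)"
proof -
  have "ptime (\<lambda>x. \<not> (\<exists>h\<in>set (l x). \<not> P x h))"
    by (intro ptime_intros assms)
  then show ?thesis by simp
qed

lemma ptime_member [ptime_intros]:
  assumes "ptime f" "ptime l"
  shows "ptime (\<lambda>x. f x \<in> set (l x))"
proof -
  have "ptime (\<lambda>x. \<exists>h\<in>set (l x). h = f x)"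
    by (intro ptime_intros assms ptime_comp[OF assms(1)])
  then show ?thesis by simp
qed

lemma ptime_hd [ptime_intros]:
  fixes f :: "'b::encodable \<Rightarrow> 'a::encodable list"
  assumes "ptime f"
  shows "ptime (\<lambda>x. hd (f x))"
proof -
  \<comment> \<open>The value \<open>hd []\<close> is unspecified but fixed, hence computable as a
    constant. Starting from it makes the identity below hold for the empty list too.\<close>
  have *: "ptime (\<lambda>xs::'a list. fold (\<lambda>h _. h) (rev xs) (hd []))"
    by (rule ptime_fold_additive[where r = "[:0, 1:]"]) (intro ptime_intros | simp)+
  have "fold (\<lambda>h _. h) (rev xs) (hd []) = hd xs" for xs :: "'a list"
    by (cases xs) (auto simp: fold_append)
  with * have "ptime (hd :: 'a list \<Rightarrow> 'a)" by simp
  from ptime_comp[OF this assms] show ?thesis .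
qed

subsection \<open>Binary arithmetic\<close>

function bits :: "nat \<Rightarrow> bool list" where
  "bits n = (if n = 0 then [] else odd n # bits (n div 2))"
  by auto
termination by (relation "measure id") auto

declare bits.simps [simp del]

lemma bits_0 [simp]: "bits 0 = []"
  by (simp add: bits.simps)

lemma bits_pos: "n > 0 \<Longrightarrow> bits n = odd n # bits (n div 2)"
  by (subst bits.simps) simp

text \<open>Passing between a number and its bits costs nothing, because the trees coincide.\<close>

lemma encode_bits: "encode (bits n) = encode n"
proof (induction n rule: less_induct)
  case (less n)
  then show ?case
    by (cases "n = 0") (auto simp: bits_pos enc_nat_pos)
qed

lemma ptime_bits [ptime_intros]: "ptime f \<Longrightarrow> ptime (\<lambda>x. bits (f x))"
  by (rule ptime_comp[of bits], rule ptime_assignI[of "Var 0" _ "\<lambda>n. n"])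
     (auto simp: encode_bits intro: poly_bounded_intros)

lemma ptime_of_bits: "ptime (\<lambda>x. bits (f x)) \<Longrightarrow> ptime f"
  unfolding ptime_def computes_def encode_bits .

fun of_bits :: "bool list \<Rightarrow> nat" where
  "of_bits [] = 0"
| "of_bits (b # bs) = of_bool b + 2 * of_bits bs"

lemma of_bits_bits [simp]: "of_bits (bits n) = n"
proof (induction n rule: less_induct)
  case (less n)
  then show ?case
    by (cases "n = 0") (auto simp: bits_pos)
qed

lemma bits_eq_Nil_iff [simp]: "bits n = [] \<longleftrightarrow> n = 0"
  by (subst bits.simps) simp

text \<open>Building from the most significant end discards leading zeros, which restores the unique
  notation.\<close>

lemma bits_of_bits: "bits (of_bits bs) = foldr (\<lambda>d acc. if acc = [] \<and> \<not> d then [] else d # acc) bs []"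
proof (induction bs)
  case (Cons b bs)
  have "bits (of_bool b + 2 * n) = (if n = 0 \<and> \<not> b then [] else b # bits n)" for n
    by (cases "of_bool b + 2 * n = 0") (auto simp: bits_pos)
  then show ?case using Cons.IH[symmetric] by simp
qed simp

lemma ptime_normalize_bits: "ptime f \<Longrightarrow> ptime (\<lambda>x. bits (of_bits (f x)))"
proof -
  assume f: "ptime f"
  have "ptime (\<lambda>x. fold (\<lambda>d acc. if acc = [] \<and> \<not> d then [] else d # acc) (rev (f x)) [])"
    by (rule ptime_fold_additive[where r = "[:1, 1:]"]) (intro ptime_intros f | simp)+
  then show ?thesis by (simp add: bits_of_bits foldr_conv_fold)
qed

text \<open>Reads 0 past the end, so the shorter operand needs no padding.\<close>

definition hd_bit :: "bool list \<Rightarrow> bool" where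
  "hd_bit bs \<longleftrightarrow> bs \<noteq> [] \<and> hd bs"

lemma ptime_hd_bit [ptime_intros]: "ptime f \<Longrightarrow> ptime (\<lambda>x. hd_bit (f x))"
  unfolding hd_bit_def by (intro ptime_intros)

lemma of_bits_hd_tl: "of_bits bs = of_bool (hd_bit bs) + 2 * of_bits (tl bs)"
  by (cases bs) (auto simp: hd_bit_def)

text \<open>Ripple-carry addition: \<open>d = (hd_bit bs = c)\<close> is the exclusive or of three
  bits, and the new carry is their majority.\<close>

fun add_bits :: "bool list \<Rightarrow> bool list \<Rightarrow> bool \<Rightarrow> bool list" where
  "add_bits [] bs c = [c]"
| "add_bits (d # ds) bs c =
     (d = (hd_bit bs = c)) # add_bits ds (tl bs) (d \<and> hd_bit bs \<or> d \<and> c \<or> hd_bit bs \<and> c)"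

lemma of_bits_add_bits:
  "length bs \<le> length ds \<Longrightarrow> of_bits (add_bits ds bs c) = of_bits ds + of_bits bs + of_bool c"
proof (induction ds bs c rule: add_bits.induct)
  case (2 d ds bs c)
  have "length (tl bs) \<le> length ds" using 2(2) by simp
  from 2(1)[OF this] show ?case by (subst (2) of_bits_hd_tl) auto
qed simp

text \<open>The verdict \<open>r\<close> on the lower positions is overruled by every later position
  at which the bits differ.\<close>

fun less_bits :: "bool list \<Rightarrow> bool list \<Rightarrow> bool \<Rightarrow> bool" where
  "less_bits [] bs r = r"
| "less_bits (d # ds) bs r = less_bits ds (tl bs) (if d = hd_bit bs then r else hd_bit bs)"

lemma less_bits_iff:
  "length bs \<le> length ds \<Longrightarrow>
     less_bits ds bs r \<longleftrightarrow> of_bits ds < of_bits bs \<or> of_bits ds = of_bits bs \<and> r"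
proof (induction ds bs r rule: less_bits.induct)
  case (2 d ds bs c)
  have "length (tl bs) \<le> length ds" using 2(2) by simp
  from 2(1)[OF this] show ?case
    by (subst (1 2) of_bits_hd_tl[of bs]) (cases d; cases "hd_bit bs"; auto; presburger)
qed simp

text \<open>The added zeros let a loop over the first operand cover the second one as well.\<close>

definition pad :: "nat \<Rightarrow> nat \<Rightarrow> bool list" where
  "pad m n = bits m @ map (\<lambda>_. False) (bits n)"

lemma ptime_pad [ptime_intros]: "ptime f \<Longrightarrow> ptime g \<Longrightarrow> ptime (\<lambda>x. pad (f x) (g x))"
  unfolding pad_def by (intro ptime_intros)

lemma of_bits_pad [simp]: "of_bits (pad m n) = m"
proof -
  have "of_bits (bs @ map (\<lambda>_. False) cs) = of_bits bs" for bs and cs :: "bool list"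
  proof (induction bs)
    case Nil
    show ?case by (induction cs) auto
  qed auto
  then show ?thesis by (simp add: pad_def)
qed

lemma length_pad: "length (bits n) \<le> length (pad m n)"
  by (simp add: pad_def)

lemma ptime_add [ptime_intros]:
  fixes f g :: "'a::encodable \<Rightarrow> nat"
  assumes "ptime f" "ptime g"
  shows "ptime (\<lambda>x. f x + g x)"
proof (rule ptime_of_bits)
  \<comment> \<open>The state consists of the rest of the second operand, the carry, and the output
    in reverse.\<close>
  define step where "step d s = (tl (fst s), d \<and> hd_bit (fst s) \<or> d \<and> fst (snd s) \<or> hd_bit (fst s) \<and> fst (snd s),
    (d = (hd_bit (fst s) = fst (snd s))) # snd (snd s))" for d and s :: "bool list \<times> bool \<times> bool list"
  have step: "rev (snd (snd (fold step ds (bs, c, out)))) @ [fst (snd (fold step ds (bs, c, out)))]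
      = rev out @ add_bits ds bs c" for ds bs c out
    by (induction ds bs c arbitrary: out rule: add_bits.induct) (auto simp: step_def)
  have *: "ptime (\<lambda>x. fold step (pad (f x) (g x)) (bits (g x), False, []))"
  proof (rule ptime_fold_additive[where r = "[:2:]"])
    show "ptime (\<lambda>q::('a \<times> bool \<times> bool list \<times> bool \<times> bool list). step (fst (snd q)) (snd (snd q)))"
      unfolding step_def by (intro ptime_intros)
    show "size (encode (step h a)) \<le> size (encode a) + poly [:2:] (size (encode x) + size (encode h))"
      for x :: 'a and h a
    proof -
      obtain bs c out where a: "a = (bs, c, out)" by (cases a)
      have "size (encode (tl bs)) \<le> size (encode bs)" by (cases bs) auto
      then show ?thesis by (cases c) (auto simp: a step_def encode_bool_def)
    qed
  qed (intro ptime_intros assms)+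
  have "of_bits (rev (snd (snd (fold step (pad m n) (bits n, False, []))))
     @ [fst (snd (fold step (pad m n) (bits n, False, [])))]) = m + n" for m n
    unfolding step using length_pad[of n m] by (simp add: of_bits_add_bits)
  then have eq: "m + n = of_bits (rev (snd (snd (fold step (pad m n) (bits n, False, []))))
     @ [fst (snd (fold step (pad m n) (bits n, False, [])))])" for m n
    by simp
  show "ptime (\<lambda>x. bits (f x + g x))"
    unfolding eq by (intro ptime_normalize_bits ptime_intros *)
qed

lemma ptime_less [ptime_intros]:
  fixes f g :: "'a::encodable \<Rightarrow> nat"
  assumes "ptime f" "ptime g"
  shows "ptime (\<lambda>x. f x < g x)"
proof -
  define step where "step d s = (tl (fst s), if d = hd_bit (fst s) then snd s else hd_bit (fst s))"
    for d and s :: "bool list \<times> bool"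
  have step: "snd (fold step ds (bs, r)) = less_bits ds bs r" for ds bs r
    by (induction ds bs r rule: less_bits.induct) (auto simp: step_def)
  have "ptime (\<lambda>x. fold step (pad (f x) (g x)) (bits (g x), False))"
  proof (rule ptime_fold_additive[where r = "[:1:]"])
    show "ptime (\<lambda>q::('a \<times> bool \<times> bool list \<times> bool). step (fst (snd q)) (snd (snd q)))"
      unfolding step_def by (intro ptime_intros)
    show "size (encode (step h a)) \<le> size (encode a) + poly [:1:] (size (encode x) + size (encode h))"
      for x :: 'a and h a
    proof -
      obtain bs c where a: "a = (bs, c)" by (cases a)
      have "size (encode (tl bs)) \<le> size (encode bs)" by (cases bs) auto
      then show ?thesis by (auto simp: a step_def encode_bool_def)
    qed
  qed (intro ptime_intros assms)+
  from ptime_snd[OF this] show ?thesis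
    unfolding step using less_bits_iff[OF length_pad] by simp
qed

lemma length_bits_le_iff: "length (bits n) \<le> k \<longleftrightarrow> n < 2 ^ k"
proof (induction k arbitrary: n)
  case (Suc k)
  show ?case using Suc[of "n div 2"] by (cases "n = 0") (auto simp: bits_pos)
qed auto

lemma length_bits_le_size: "length (bits n) \<le> size (encode n)"
  using length_le_size_encode[of "bits n"] by (simp only: encode_bits)

lemma size_le_length_bits: "size (encode n) \<le> 2 * length (bits n)" for n :: nat
proof -
  have "size (encode bs) \<le> 2 * length bs" for bs :: "bool list"
    by (induction bs) (auto simp: encode_bool_def)
  from this[of "bits n"] show ?thesis by (simp only: encode_bits)
qed

lemma length_bits_mono: "m \<le> n \<Longrightarrow> length (bits m) \<le> length (bits n)"
  using length_bits_le_iff[of m "length (bits n)"] length_bits_le_iff[of n "length (bits n)"] by simp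

lemma length_bits_mult: "length (bits (m * n)) \<le> length (bits m) + length (bits n)"
  unfolding length_bits_le_iff power_add
  using length_bits_le_iff[of m "length (bits m)"] length_bits_le_iff[of n "length (bits n)"]
  by (intro mult_strict_mono) auto

lemma length_bits_add: "length (bits (m + n)) \<le> length (bits m) + length (bits n)"
proof (cases "m = 0 \<or> n = 0")
  case False
  have mn: "m < 2 ^ length (bits m)" "n < 2 ^ length (bits n)" using length_bits_le_iff by blast+
  have "(m + 1) * (n + 1) \<le> 2 ^ length (bits m) * 2 ^ length (bits n)"
    using mn by (intro mult_mono) auto
  moreover have "m + n < (m + 1) * (n + 1)" by simp
  ultimately show ?thesis unfolding length_bits_le_iff power_add by linarith
qed auto

text \<open>Multiplication by doubling and adding, from the most significant bit.\<close>

lemma ptime_mult [ptime_intros]: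
  fixes f g :: "'a::encodable \<Rightarrow> nat"
  assumes f: "ptime f" and g: "ptime g"
  shows "ptime (\<lambda>x. f x * g x)"
proof -
  define step where "step m d a = a + a + (if d then m else 0)" for m a :: nat and d
  have step: "fold (step m) (rev bs) 0 = m * of_bits bs" for m bs
    by (induction bs) (auto simp: step_def algebra_simps)
  obtain p q where p: "\<And>x. size (encode (f x)) \<le> poly p (size (encode x))"
    and q: "\<And>x. size (encode (g x)) \<le> poly q (size (encode x))"
    using ptime_size[OF f] ptime_size[OF g] by metis
  have "ptime (\<lambda>x. fold (step (f x)) (rev (bits (g x))) 0)"
  proof (rule ptime_fold)
    show "ptime (\<lambda>q::'a \<times> bool \<times> nat. step (f (fst q)) (fst (snd q)) (snd (snd q)))"
      unfolding step_def by (intro ptime_intros ptime_comp[OF f])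
    show "size (encode (fold (step (f x)) (take n (rev (bits (g x)))) 0)) 
       \<le> 2 * (poly p (size (encode x)) + poly q (size (encode x)))" for x n
    proof -
      have le: "of_bits (drop k bs) \<le> of_bits bs" for k bs
      proof (induction bs arbitrary: k)
        case (Cons b bs)
        then show ?case by (cases k) (auto intro!: order_trans[OF Cons.IH])
      qed simp
      obtain k where "take n (rev (bits (g x))) = rev (drop k (bits (g x)))"
        by (metis rev_take take_rev)
      \<comment> \<open>The accumulator is \<open>f x\<close> times the number formed by some
        leading bits of \<open>g x\<close>, so no intermediate result exceeds the product.\<close>
      then have "fold (step (f x)) (take n (rev (bits (g x)))) 0 \<le> f x * g x"
        using le[of k "bits (g x)"] by (simp add: step)
      from length_bits_mono[OF this]
      have "size (encode (fold (step (f x)) (take n (rev (bits (g x)))) 0)) \<le> 2 * length (bits (f x * g x))"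
        using order_trans[OF size_le_length_bits mult_le_mono2] by blast
      also have "length (bits (f x * g x)) \<le> poly p (size (encode x)) + poly q (size (encode x))"
        using length_bits_mult[of "f x" "g x"] order_trans[OF length_bits_le_size p, of x]
          order_trans[OF length_bits_le_size q, of x] by linarith
      finally show ?thesis by simp
    qed
  qed (intro ptime_intros poly_bounded_intros assms)+
  then show ?thesis by (simp add: step)
qed

lemma ptime_sum_list [ptime_intros]:
  fixes f :: "'a::encodable \<Rightarrow> nat list"
  assumes "ptime f"
  shows "ptime (\<lambda>x. sum_list (f x))"
proof -
  have bits: "length (bits (sum_list (ys::nat list))) \<le> size (encode ys)" for ys
  proof (induction ys)
    case (Cons y ys)
    then show ?case using length_bits_add[of y "sum_list ys"] length_bits_le_size[of y] by simp
  qed simp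
  have fold: "fold (+) ys a = a + sum_list ys" for ys and a :: nat
    by (induction ys arbitrary: a) auto
  obtain p where p: "\<And>x. size (encode (f x)) \<le> poly p (size (encode x))"
    using ptime_size[OF assms] by blast
  have "ptime (\<lambda>x. fold (\<lambda>y a. y + a) (f x) 0)"
  proof (rule ptime_fold)
    show "size (encode (fold (+) (take n (f x)) (0::nat))) \<le> 2 * poly p (size (encode x))" for x n
    proof -
      have "sum_list (take n (f x)) \<le> sum_list (f x)"
        by (metis append_take_drop_id le_add1 sum_list_append)
      from length_bits_mono[OF this] bits[of "f x"] size_le_length_bits[of "sum_list (take n (f x))"] p[of x]
      show ?thesis by (simp add: fold)
    qed
  qed (intro ptime_intros poly_bounded_intros assms)+
  then show ?thesis by (simp add: fold)
qed

lemma ptime_prod_list [ptime_intros]: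
  fixes f :: "'a::encodable \<Rightarrow> nat list"
  assumes "ptime f"
  shows "ptime (\<lambda>x. prod_list (f x))"
proof -
  have bits: "length (bits (prod_list (ys::nat list))) \<le> 1 + size (encode ys)" for ys
  proof (induction ys)
    case (Cons y ys)
    then show ?case using length_bits_mult[of y "prod_list ys"] length_bits_le_size[of y] by simp
  qed (simp add: bits_pos)
  have fold: "fold (*) ys a = a * prod_list ys" for ys and a :: nat
    by (induction ys arbitrary: a) (auto simp: mult_ac)
  obtain p where p: "\<And>x. size (encode (f x)) \<le> poly p (size (encode x))"
    using ptime_size[OF assms] by blast
  have "ptime (\<lambda>x. fold (\<lambda>y a. y * a) (f x) 1)"
  proof (rule ptime_fold)
    show "size (encode (fold (*) (take n (f x)) (1::nat))) \<le> 2 * (1 + poly p (size (encode x)))" for x n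
    proof -
      \<comment> \<open>A later factor 0 could make a prefix product exceed the whole product, so
        the prefix is bounded through the size of the list.\<close>
      have "size (encode (take n ys)) \<le> size (encode ys)" for ys :: "nat list"
        by (induction ys arbitrary: n) (auto simp: take_Cons split: nat.split)
      from order_trans[OF this p[of x]] bits[of "take n (f x)"] size_le_length_bits[of "prod_list (take n (f x))"]
      show ?thesis by (simp add: fold)
    qed
  qed (intro ptime_intros poly_bounded_intros assms)+
  then show ?thesis by (simp add: fold)
qed

section \<open>The algorithm\<close>

type_synonym edge = "nat \<times> nat"

text \<open>An item is an edge together with its scaled weight and its penalty, the total weight of its partners.\<close>

type_synonym item = "edge \<times> nat \<times> nat"

definition absorb :: "edge list \<Rightarrow> nat list \<Rightarrow> nat list" where
  "absorb = fold (\<lambda>e R. if fst e \<in> set R \<or> snd e \<in> set R then fst e # snd e # R else R)"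

text \<open>The list \<open>F @ F\<close> serves only as a counter of rounds.\<close>

definition linked :: "edge list \<Rightarrow> nat \<Rightarrow> nat \<Rightarrow> bool" where
  "linked F u v \<longleftrightarrow> v \<in> set (fold (\<lambda>_. absorb F) (F @ F) [u])"

definition partner :: "edge list \<Rightarrow> edge \<Rightarrow> edge \<Rightarrow> bool" where
  "partner F e f \<longleftrightarrow> f \<noteq> e \<and> \<not> linked (filter (\<lambda>g. g \<noteq> e \<and> g \<noteq> f) F) (fst e) (snd e)"

definition partner_weight :: "(edge \<times> nat) list \<Rightarrow> edge \<Rightarrow> nat" where
  "partner_weight es e = (\<Sum>f\<leftarrow>filter (\<lambda>f. partner (map fst es) e (fst f)) es. snd f)"

definition items :: "(edge \<times> nat) list \<Rightarrow> item list" where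
  "items es = map (\<lambda>x. (fst x, snd x, partner_weight es (fst x))) es"

definition isort :: "('a \<Rightarrow> 'a \<Rightarrow> bool) \<Rightarrow> 'a list \<Rightarrow> 'a list" where
  "isort prec xs = fold (\<lambda>x l. filter (\<lambda>y. prec y x) l @ x # filter (\<lambda>y. \<not> prec y x) l) xs []"

text \<open>This compares the truncated differences of weight and penalty.\<close>

definition lighter :: "item \<Rightarrow> item \<Rightarrow> bool" where
  "lighter x y \<longleftrightarrow> snd (snd y) < fst (snd y) \<and> fst (snd x) + snd (snd y) < fst (snd y) + snd (snd x)"

definition kruskal :: "item list \<Rightarrow> item list" where
  "kruskal xs = fold (\<lambda>x T. if linked (map fst T) (fst (fst x)) (snd (fst x)) then T else x # T) xs []"

definition below :: "edge list \<Rightarrow> nat \<Rightarrow> edge \<Rightarrow> nat \<Rightarrow> bool" where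
  "below T r e v \<longleftrightarrow> \<not> linked (filter (\<lambda>f. f \<noteq> e) T) r v"

definition crosses :: "edge list \<Rightarrow> nat \<Rightarrow> edge \<Rightarrow> edge \<Rightarrow> bool" where
  "crosses T r e l \<longleftrightarrow> below T r e (fst l) \<noteq> below T r e (snd l)"

text \<open>Links are coloured in increasing depth, which supplies the assumption
  \<open>deep\<close> of \<open>laminar_two_chains\<close>.\<close>

definition depth :: "edge list \<Rightarrow> nat \<Rightarrow> edge \<Rightarrow> nat" where
  "depth T r l = length (filter (\<lambda>e. below T r e (fst l) \<and> below T r e (snd l)) T)"

text \<open>The executable counterpart of \<open>bad\<close>.\<close>

definition clash :: "edge list \<Rightarrow> nat \<Rightarrow> (item \<times> nat) list \<Rightarrow> item \<Rightarrow> nat \<Rightarrow> bool" where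
  "clash T r acc l c \<longleftrightarrow> (\<exists>e\<in>set T. crosses T r e (fst l) \<and> (\<exists>a\<in>set acc. crosses T r e (fst (fst a))) \<and>
     (\<forall>a\<in>set acc. \<not> crosses T r e (fst (fst a)) \<or> snd a = c))"

definition colouring :: "edge list \<Rightarrow> nat \<Rightarrow> item list \<Rightarrow> (item \<times> nat) list" where
  "colouring T r ls = fold (\<lambda>l acc. (l, if \<not> clash T r acc l 0 then 0 else if \<not> clash T r acc l 1 then 1 else 2) # acc) ls []"

text \<open>A tie between weight and penalty counts as dropped; either choice would be charged their
  minimum.\<close>

definition dropped :: "nat \<Rightarrow> item \<times> nat \<Rightarrow> bool" where
  "dropped i a \<longleftrightarrow> snd a = i \<and> \<not> fst (snd (fst a)) < snd (snd (fst a))"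

text \<open>The last part lists second copies of tree edges. A tree edge with several dropped
  partners is doubled only once.\<close>

definition candidate :: "edge list \<Rightarrow> item list \<Rightarrow> (item \<times> nat) list \<Rightarrow> nat \<Rightarrow> item list" where
  "candidate F T cs i = T @ map fst (filter (\<lambda>a. \<not> dropped i a) cs) @
     filter (\<lambda>x. \<exists>a\<in>set cs. dropped i a \<and> partner F (fst (fst a)) (fst x)) T"

definition total :: "item list \<Rightarrow> nat" where
  "total xs = (\<Sum>x\<leftarrow>xs. fst (snd x))"

definition lightest :: "item list \<Rightarrow> item list \<Rightarrow> item list" where
  "lightest xs ys = (if total ys < total xs then ys else xs)"

definition best_candidate :: "edge list \<Rightarrow> item list \<Rightarrow> (item \<times> nat) list \<Rightarrow> item list" where
  "best_candidate F T cs = lightest (candidate F T cs 0) (lightest (candidate F T cs 1) (candidate F T cs 2))"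

definition tree_links :: "nat \<Rightarrow> item list \<Rightarrow> item list \<Rightarrow> (item \<times> nat) list" where
  "tree_links r T xs = colouring (map fst T) r
     (isort (\<lambda>l l'. depth (map fst T) r (fst l) < depth (map fst T) r (fst l')) (filter (\<lambda>x. x \<notin> set T) xs))"

definition solve_items :: "nat \<Rightarrow> item list \<Rightarrow> item list \<Rightarrow> edge list" where
  "solve_items r T xs = map fst (best_candidate (map fst xs) T (tree_links r T xs))"

text \<open>Multiplying a numerator by all other denominators clears fractions with one common
  factor, the product of all denominators. The program then needs only arithmetic on natural
  numbers.\<close>

definition scaled :: "(edge \<times> nat \<times> nat) list \<Rightarrow> (edge \<times> nat) list" where
  "scaled es = map (\<lambda>x. (fst x, fst (snd x) * (\<Prod>y\<leftarrow>filter (\<lambda>y. fst y \<noteq> fst x) es. snd (snd y)))) es"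

definition algorithm :: "nat list \<times> (edge \<times> nat \<times> nat) list \<Rightarrow> edge list" where
  "algorithm inp = solve_items (hd (fst inp))
     (kruskal (isort lighter (items (scaled (snd inp))))) (items (scaled (snd inp)))"

subsection \<open>Running time\<close>

text \<open>Reduces a function of several arguments to its uncurried form, so that each part of the
  algorithm is analysed once.\<close>

lemma ptime_comp2:
  assumes "ptime (\<lambda>q. f (fst q) (snd q))" "ptime a" "ptime b"
  shows "ptime (\<lambda>x. f (a x) (b x))"
  using ptime_comp[OF assms(1), of "\<lambda>x. (a x, b x)"] assms(2-) by (simp add: ptime_Pair)

lemma ptime_comp3:
  assumes "ptime (\<lambda>q. f (fst q) (fst (snd q)) (snd (snd q)))" "ptime a" "ptime b" "ptime c"
  shows "ptime (\<lambda>x. f (a x) (b x) (c x))"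
  using ptime_comp[OF assms(1), of "\<lambda>x. (a x, b x, c x)"] assms(2-) by (simp add: ptime_Pair)

lemma ptime_comp4:
  assumes "ptime (\<lambda>q. f (fst q) (fst (snd q)) (fst (snd (snd q))) (snd (snd (snd q))))"
    "ptime a" "ptime b" "ptime c" "ptime d"
  shows "ptime (\<lambda>x. f (a x) (b x) (c x) (d x))"
  using ptime_comp[OF assms(1), of "\<lambda>x. (a x, b x, c x, d x)"] assms(2-) by (simp add: ptime_Pair)

lemma ptime_comp5:
  assumes "ptime (\<lambda>q. f (fst q) (fst (snd q)) (fst (snd (snd q)))
      (fst (snd (snd (snd q)))) (snd (snd (snd (snd q)))))"
    "ptime a" "ptime b" "ptime c" "ptime d" "ptime e"
  shows "ptime (\<lambda>x. f (a x) (b x) (c x) (d x) (e x))"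
  using ptime_comp[OF assms(1), of "\<lambda>x. (a x, b x, c x, d x, e x)"] assms(2-)
  by (simp add: ptime_Pair)

lemma ptime_length [ptime_intros]:
  assumes "ptime f"
  shows "ptime (\<lambda>x. length (f x))"
proof -
  have "ptime (\<lambda>x. \<Sum>y\<leftarrow>f x. 1 :: nat)"
    by (intro ptime_intros assms)
  then show ?thesis by (simp add: sum_list_triv)
qed

lemma size_encode_append: "size (encode (xs @ ys)) = size (encode xs) + size (encode ys)"
  by (induction xs) auto

lemma size_encode_partition:
  "size (encode (filter P xs)) + size (encode (filter (\<lambda>x. \<not> P x) xs)) = size (encode xs)"
  by (induction xs) auto

lemma ptime_isort [ptime_intros]:
  fixes l :: "'a::encodable \<Rightarrow> 'b::encodable list"
  assumes l: "ptime l" and prec: "ptime (\<lambda>q. prec (fst q) (fst (snd q)) (snd (snd q)))"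
  shows "ptime (\<lambda>x. isort (prec x) (l x))"
  unfolding isort_def
proof (rule ptime_fold_additive[OF l, where r = "[:1, 1:]"])
  show "ptime (\<lambda>q::('a \<times> 'b \<times> 'b list). filter (\<lambda>y. prec (fst q) y (fst (snd q))) (snd (snd q)) @
    fst (snd q) # filter (\<lambda>y. \<not> prec (fst q) y (fst (snd q))) (snd (snd q)))"
    by (intro ptime_intros ptime_comp3[OF prec])
  show "size (encode (filter (\<lambda>y. prec x y h) a @ h # filter (\<lambda>y. \<not> prec x y h) a))
      \<le> size (encode a) + poly [:1, 1:] (size (encode x) + size (encode h))" for x h a
    using size_encode_partition[of "\<lambda>y. prec x y h" a] by (simp add: size_encode_append)
qed (intro ptime_intros)

lemma ptime_absorb:
  assumes f: "ptime f" and g: "ptime g"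
  shows "ptime (\<lambda>x. absorb (f x) (g x))"
  unfolding absorb_def
  by (rule ptime_fold_additive[OF f g, where r = "[:1, 1:]"]) (intro ptime_intros | simp add: encode_prod_def)+

text \<open>One pass adds at most the ends of each edge, whatever \<open>R\<close> is. This is what
  the additive criterion needs for repeated passes.\<close>

lemma size_absorb: "size (encode (absorb F R)) \<le> size (encode R) + size (encode F)"
  unfolding absorb_def
proof (induction F arbitrary: R)
  case (Cons e F)
  show ?case
    by (simp, intro conjI impI order_trans[OF Cons.IH]) (auto simp: encode_prod_def)
qed simp

lemma ptime_linked [ptime_intros]:
  assumes "ptime f" "ptime u" "ptime v"
  shows "ptime (\<lambda>x. linked (f x) (u x) (v x))"
proof (rule ptime_comp3[OF _ assms])
  have "ptime (\<lambda>q :: edge list \<times> nat \<times> nat. fold (\<lambda>_. absorb (fst q)) (fst q @ fst q) [fst (snd q)])"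
    by (rule ptime_fold_additive[where r = "[:0, 1:]"])
       (intro ptime_intros ptime_absorb | use size_absorb in \<open>simp add: encode_prod_def order_trans[OF size_absorb]\<close>)+
  then show "ptime (\<lambda>q. linked (fst q) (fst (snd q)) (snd (snd q)))"
    unfolding linked_def by (intro ptime_intros)
qed

lemma ptime_partner [ptime_intros]:
  "ptime a \<Longrightarrow> ptime b \<Longrightarrow> ptime c \<Longrightarrow> ptime (\<lambda>x. partner (a x) (b x) (c x))"
  by (rule ptime_comp3, unfold partner_def, intro ptime_intros)

lemma ptime_items [ptime_intros]: "ptime a \<Longrightarrow> ptime (\<lambda>x. items (a x))"
  by (rule ptime_comp[of items], unfold items_def partner_weight_def, intro ptime_intros)

lemma ptime_scaled [ptime_intros]: "ptime a \<Longrightarrow> ptime (\<lambda>x. scaled (a x))"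
  by (rule ptime_comp[of scaled], unfold scaled_def, intro ptime_intros)

lemma ptime_lighter [ptime_intros]: "ptime a \<Longrightarrow> ptime b \<Longrightarrow> ptime (\<lambda>x. lighter (a x) (b x))"
  by (rule ptime_comp2, unfold lighter_def, intro ptime_intros)

lemma ptime_kruskal [ptime_intros]: "ptime a \<Longrightarrow> ptime (\<lambda>x. kruskal (a x))"
proof (rule ptime_comp[of kruskal])
  show "ptime kruskal"
    unfolding kruskal_def
    by (rule ptime_fold_additive[where r = "[:1, 1:]"]) (intro ptime_intros | simp)+
qed

lemma ptime_below [ptime_intros]:
  "ptime a \<Longrightarrow> ptime b \<Longrightarrow> ptime c \<Longrightarrow> ptime d \<Longrightarrow> ptime (\<lambda>x. below (a x) (b x) (c x) (d x))"
  by (rule ptime_comp4, unfold below_def, intro ptime_intros)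

lemma ptime_crosses [ptime_intros]:
  "ptime a \<Longrightarrow> ptime b \<Longrightarrow> ptime c \<Longrightarrow> ptime d \<Longrightarrow> ptime (\<lambda>x. crosses (a x) (b x) (c x) (d x))"
  by (rule ptime_comp4, unfold crosses_def, intro ptime_intros)

lemma ptime_depth [ptime_intros]:
  "ptime a \<Longrightarrow> ptime b \<Longrightarrow> ptime c \<Longrightarrow> ptime (\<lambda>x. depth (a x) (b x) (c x))"
  by (rule ptime_comp3, unfold depth_def, intro ptime_intros)

lemma ptime_clash [ptime_intros]:
  "ptime a \<Longrightarrow> ptime b \<Longrightarrow> ptime c \<Longrightarrow> ptime d \<Longrightarrow> ptime e \<Longrightarrow>
     ptime (\<lambda>x. clash (a x) (b x) (c x) (d x) (e x))"
  by (rule ptime_comp5, unfold clash_def, intro ptime_intros)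

lemma ptime_colouring [ptime_intros]:
  assumes "ptime a" "ptime b" "ptime c"
  shows "ptime (\<lambda>x. colouring (a x) (b x) (c x))"
proof (rule ptime_comp3[OF _ assms])
  show "ptime (\<lambda>q. colouring (fst q) (fst (snd q)) (snd (snd q)))"
    unfolding colouring_def
  \<comment> \<open>The constant covers the two new nodes and the code of the colour.\<close>
  proof (rule ptime_fold_additive[where r = "[:2 + 2 * size (encode (2 :: nat)), 1:]"])
    have "enc_nat (Suc 0) = Node (Node Leaf Leaf) Leaf" "enc_nat 2 = Node Leaf (Node (Node Leaf Leaf) Leaf)"
      by (simp_all add: enc_nat_pos encode_bool_def)
    then show "size (encode ((h, if \<not> clash (fst q) (fst (snd q)) a h 0 then 0
        else if \<not> clash (fst q) (fst (snd q)) a h 1 then 1 else 2) # a)) \<le> size (encode a) +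
        poly [:2 + 2 * size (encode (2::nat)), 1:] (size (encode q) + size (encode h))"
      for q :: "edge list \<times> nat \<times> item list" and h a
      by auto
  qed (intro ptime_intros)+
qed

lemma ptime_tree_links [ptime_intros]:
  "ptime a \<Longrightarrow> ptime b \<Longrightarrow> ptime c \<Longrightarrow> ptime (\<lambda>x. tree_links (a x) (b x) (c x))"
  by (rule ptime_comp3, unfold tree_links_def, intro ptime_intros)

lemma ptime_dropped [ptime_intros]: "ptime a \<Longrightarrow> ptime b \<Longrightarrow> ptime (\<lambda>x. dropped (a x) (b x))"
  by (rule ptime_comp2, unfold dropped_def, intro ptime_intros)

lemma ptime_candidate [ptime_intros]:
  "ptime a \<Longrightarrow> ptime b \<Longrightarrow> ptime c \<Longrightarrow> ptime d \<Longrightarrow> ptime (\<lambda>x. candidate (a x) (b x) (c x) (d x))"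
  by (rule ptime_comp4, unfold candidate_def, intro ptime_intros)

lemma ptime_lightest [ptime_intros]: "ptime a \<Longrightarrow> ptime b \<Longrightarrow> ptime (\<lambda>x. lightest (a x) (b x))"
  by (rule ptime_comp2, unfold lightest_def total_def, intro ptime_intros)

lemma ptime_algorithm: "ptime algorithm"
proof -
  have *: "ptime (\<lambda>x. solve_items (a x) (b x) (c x))" if "ptime a" "ptime b" "ptime c"
    for a and b c :: "'a::encodable \<Rightarrow> item list"
    by (rule ptime_comp3[OF _ that], unfold solve_items_def best_candidate_def, intro ptime_intros)
  show ?thesis
    unfolding algorithm_def by (intro ptime_intros *)
qed

section \<open>Correctness of the algorithm\<close>

lemma absorb_mono: "set R \<subseteq> set (absorb F R)"
  unfolding absorb_def by (induction F arbitrary: R) (simp, force)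

lemma absorb_step:
  "e \<in> set F \<Longrightarrow> fst e \<in> set R \<or> snd e \<in> set R \<Longrightarrow> fst e \<in> set (absorb F R) \<and> snd e \<in> set (absorb F R)"
proof (induction F arbitrary: R)
  case (Cons f F)
  define R' where "R' = (if fst f \<in> set R \<or> snd f \<in> set R then fst f # snd f # R else R)"
  have R': "absorb (f # F) R = absorb F R'" by (simp add: absorb_def R'_def)
  have sub: "set R \<subseteq> set R'" by (auto simp: R'_def)
  show ?case
  proof (cases "e = f")
    case True
    then have "fst e \<in> set R'" "snd e \<in> set R'" using Cons.prems(2) by (auto simp: R'_def)
    then show ?thesis using absorb_mono[of R' F] unfolding R' by blast
  next
    case False
    then show ?thesis using Cons.IH[of R'] Cons.prems sub unfolding R' by auto
  qed
qed simp

lemma absorb_sound: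
  assumes "edge_of ` set F \<subseteq> G" "\<forall>v\<in>set R. con G u v"
  shows "\<forall>v\<in>set (absorb F R). con G u v"
  using assms
proof (induction F arbitrary: R)
  case (Cons f F)
  define R' where "R' = (if fst f \<in> set R \<or> snd f \<in> set R then fst f # snd f # R else R)"
  have R': "absorb (f # F) R = absorb F R'" by (simp add: absorb_def R'_def)
  have "con G (fst f) (snd f)" using Cons.prems(1) by (intro con_edge) (auto simp: edge_of_def)
  then have "\<forall>v\<in>set R'. con G u v"
    using Cons.prems(2) con_trans[of G u] con_sym[of G "fst f" "snd f"] by (auto simp: R'_def)
  then show ?case unfolding R' using Cons.IH Cons.prems(1) by simp
qed (simp add: absorb_def)

lemma linked_iff: "linked F u v \<longleftrightarrow> con (edge_of ` set F) u v"
proof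
  have "\<forall>v\<in>set (fold (\<lambda>_. absorb F) xs R). con (edge_of ` set F) u v"
    if "\<forall>v\<in>set R. con (edge_of ` set F) u v" for xs :: "edge list" and R
    using that
  proof (induction xs arbitrary: R)
    case (Cons x xs)
    show ?case using Cons.IH[OF absorb_sound[OF order_refl Cons.prems]] by simp
  qed simp
  then show "linked F u v \<Longrightarrow> con (edge_of ` set F) u v"
    unfolding linked_def by (metis con_refl empty_iff list.set(1) set_ConsD)
next
  \<comment> \<open>There are at most two pairs per edge, so a reachable vertex is reached within
    \<open>length (F @ F)\<close> steps, and every pass makes at least one step.\<close>
  define S where "S = {(a, b). {a, b} \<in> edge_of ` set F}"
  have S: "S = set F \<union> (set F)\<inverse>"
    unfolding S_def edge_of_def by (auto simp: doubleton_eq_iff image_iff) force+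
  have "card S \<le> card (set F) + card ((set F)\<inverse>)" unfolding S by (rule card_Un_le)
  also have "\<dots> \<le> length (F @ F)" using card_length[of F] by (simp add: card_inverse)
  finally have card_S: "card S \<le> length (F @ F)" .
  have mono: "set R \<subseteq> set (fold (\<lambda>_. absorb F) xs R)" for xs :: "edge list" and R
    by (induction xs arbitrary: R) (simp_all, use absorb_mono in blast)
  have rounds: "v \<in> set (fold (\<lambda>_. absorb F) xs [u])" if "(u, v) \<in> S ^^ n" "n \<le> length xs"
    for n and xs :: "edge list"
    using that
  proof (induction n arbitrary: v xs)
    case 0
    then show ?case using mono[of "[u]" xs] by simp
  next
    case (Suc n)
    from Suc.prems(1) obtain y where y: "(u, y) \<in> S ^^ n" "(y, v) \<in> S" by auto
    from Suc.prems(2) obtain zs z where xs: "xs = zs @ [z]" by (cases xs rule: rev_cases) auto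
    have "y \<in> set (fold (\<lambda>_. absorb F) zs [u])" using Suc.IH[OF y(1)] Suc.prems(2) xs by simp
    moreover have "(y, v) \<in> set F \<or> (v, y) \<in> set F" using y(2) S by blast
    ultimately show ?case unfolding xs using absorb_step[of _ F "fold (\<lambda>_. absorb F) zs [u]"] by fastforce
  qed
  assume "con (edge_of ` set F) u v"
  then have "(u, v) \<in> S\<^sup>*" by (simp add: con_def S_def)
  then obtain n where "(u, v) \<in> S ^^ n" "n \<le> card S"
    using rtrancl_finite_eq_relpow[of S] S by auto
  then show "linked F u v" unfolding linked_def using rounds card_S by (meson order_trans)
qed

section \<open>Sorting and the greedy tree\<close>

lemma mset_isort: "mset (isort prec xs) = mset xs"
proof -
  have "mset (fold (\<lambda>x l. filter (\<lambda>y. prec y x) l @ x # filter (\<lambda>y. \<not> prec y x) l) xs l) = mset xs + mset l" for l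
    by (induction xs arbitrary: l) (simp_all add: multiset_partition[symmetric])
  then show ?thesis by (simp add: isort_def)
qed

lemma sorted_isort:
  fixes k :: "'a \<Rightarrow> 'b::linorder"
  assumes "\<And>x y. prec x y \<longleftrightarrow> k x < k y"
  shows "sorted (map k (isort prec xs))"
proof -
  have "sorted (map k (fold (\<lambda>x l. filter (\<lambda>y. prec y x) l @ x # filter (\<lambda>y. \<not> prec y x) l) xs l))"
    if "sorted (map k l)" for l
    using that
  proof (induction xs arbitrary: l)
    case (Cons x xs)
    have "sorted (map k (filter (\<lambda>y. prec y x) l @ x # filter (\<lambda>y. \<not> prec y x) l))"
      using Cons.prems assms by (auto simp: sorted_append sorted_filter intro: order_trans less_imp_le)
    then show ?case using Cons.IH by simp
  qed simp
  then show ?thesis by (simp add: isort_def)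
qed

lemma set_isort [simp]: "set (isort prec xs) = set xs"
  using mset_isort[of prec xs] by (rule mset_eq_setD)

lemma distinct_isort [simp]: "distinct (isort prec xs) = distinct xs"
  using mset_isort[of prec xs] by (rule mset_eq_imp_distinct_iff)

text \<open>Truncated subtraction supplies the lower bound 0, so this is the excess.\<close>

definition key :: "item \<Rightarrow> nat" where
  "key x = fst (snd x) - snd (snd x)"

lemma lighter_iff: "lighter x y \<longleftrightarrow> key x < key y"
  by (auto simp: lighter_def key_def)

definition edge :: "item \<Rightarrow> nat set" where
  "edge x = edge_of (fst x)"

lemma edge_eq: "edge x = {fst (fst x), snd (fst x)}"
  by (simp add: edge_def edge_of_def)

lemma kruskal_append: "kruskal (xs @ [x]) =
    (if linked (map fst (kruskal xs)) (fst (fst x)) (snd (fst x)) then kruskal xs else x # kruskal xs)"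
  by (simp add: kruskal_def)

lemma kruskal_subset: "set (kruskal xs) \<subseteq> set xs"
  by (induction xs rule: rev_induct) (auto simp: kruskal_append kruskal_def[of "[]"])

lemma distinct_kruskal: "distinct xs \<Longrightarrow> distinct (kruskal xs)"
proof (induction xs rule: rev_induct)
  case (snoc x xs)
  then show ?case using kruskal_subset[of xs] by (auto simp: kruskal_append)
qed (simp add: kruskal_def)

lemma con_edges_eq: "linked (map fst xs) u v \<longleftrightarrow> con (edge ` set xs) u v"
  by (simp add: linked_iff image_image edge_def)

text \<open>If adding \<open>{c, d}\<close> closed a cycle through an older edge
  \<open>{a, b}\<close>, that cycle without \<open>{c, d}\<close> would already have joined
  \<open>c\<close> and \<open>d\<close>.\<close>

lemma kruskal_forest:
  "inj_on edge (set xs) \<Longrightarrow> distinct xs \<Longrightarrow> {a, b} \<in> edge ` set (kruskal xs) \<Longrightarrow> \<not> con (edge ` set (kruskal xs) - {{a, b}}) a b"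
proof (induction xs arbitrary: a b rule: rev_induct)
  case (snoc x xs)
  let ?T = "edge ` set (kruskal xs)"
  obtain c d where cd: "fst x = (c, d)" by (cases "fst x")
  then have ex: "edge x = {c, d}" by (simp add: edge_eq)
  have IH: "{a, b} \<in> ?T \<Longrightarrow> \<not> con (?T - {{a, b}}) a b" for a b
    using snoc by (auto intro: inj_on_subset)
  show ?case
  proof (cases "con ?T c d")
    case True
    then show ?thesis using snoc.prems(3) IH cd by (simp add: kruskal_append con_edges_eq)
  next
    case False
    then have eq: "edge ` set (kruskal (xs @ [x])) = insert {c, d} ?T"
      using cd ex by (simp add: kruskal_append con_edges_eq)
    have new: "{c, d} \<notin> ?T" using False con_edge by blast
    show ?thesis
    proof (cases "{a, b} = {c, d}")
      case True
      then have "a = c \<and> b = d \<or> a = d \<and> b = c" by (auto simp: doubleton_eq_iff)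
      then have "\<not> con ?T a b" using False con_sym[of ?T d c] by auto
      moreover have "insert {c, d} ?T - {{a, b}} = ?T" using True new by auto
      ultimately show ?thesis unfolding eq by simp
    next
      case ab: False
      then have abT: "{a, b} \<in> ?T" using snoc.prems(3) eq by simp
      have eq': "insert {c, d} ?T - {{a, b}} = insert {c, d} (?T - {{a, b}})" using ab by auto
      have up: "con ?T u v" if "con (?T - {{a, b}}) u v" for u v using con_mono[OF _ that] by blast
      have ab_con: "con ?T a b" using con_edge abT by blast
      show ?thesis
      proof
        assume "con (edge ` set (kruskal (xs @ [x])) - {{a, b}}) a b"
        then have "con (insert {c, d} (?T - {{a, b}})) a b" unfolding eq eq' .
        from con_insert[OF this] IH[OF abT]
        consider "con ?T a c" "con ?T d b" | "con ?T a d" "con ?T c b" using up by blast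
        then show False
        proof cases
          case 1
          then have "con ?T c d" using con_trans[OF con_sym con_trans[OF ab_con con_sym]] by blast
          then show False using False by simp
        next
          case 2
          then have "con ?T d c" using con_trans[OF con_sym con_trans[OF ab_con con_sym]] by blast
          then show False using False con_sym by blast
        qed
      qed
    qed
  qed
qed (simp add: kruskal_def)

text \<open>When an item is examined, all tree edges so far have keys at most its own, and they
  either join its ends already or the item is added. The tree only grows afterwards.\<close>

lemma kruskal_bottleneck:
  "sorted (map key xs) \<Longrightarrow> x \<in> set xs \<Longrightarrow>
     con (edge ` {t \<in> set (kruskal xs). key t \<le> key x}) (fst (fst x)) (snd (fst x))"
proof (induction xs arbitrary: x rule: rev_induct)
  case (snoc y xs)
  have sorted: "sorted (map key xs)" and le: "\<And>z. z \<in> set xs \<Longrightarrow> key z \<le> key y"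
    using snoc.prems(1) by (auto simp: sorted_append)
  have sub: "set (kruskal xs) \<subseteq> set (kruskal (xs @ [y]))" by (auto simp: kruskal_append)
  show ?case
  proof (cases "x \<in> set xs")
    case True
    from snoc.IH[OF sorted True] show ?thesis by (rule con_mono[rotated]) (use sub in blast)
  next
    case False
    then have x: "x = y" using snoc.prems(2) by simp
    show ?thesis
    proof (cases "con (edge ` set (kruskal xs)) (fst (fst y)) (snd (fst y))")
      case True
      then show ?thesis unfolding x
        by (rule con_mono[rotated]) (use sub le kruskal_subset[of xs] in blast)
    next
      case False
      then have "y \<in> set (kruskal (xs @ [y]))" by (simp add: kruskal_append con_edges_eq)
      then show ?thesis unfolding x by (intro con_edge) (auto simp: edge_eq[symmetric])
    qed
  qed
qed simp

section \<open>One instance with integer weights\<close>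

locale edge_list_instance = tec_graph +
  fixes es :: "(edge \<times> nat) list" and r :: nat
  assumes distinct_es: "distinct (map (edge_of \<circ> fst) es)"
    and set_es: "set (map (edge_of \<circ> fst) es) = E"
    and root: "r \<in> V"
begin

definition xs :: "item list" where "xs = items es"

text \<open>For \<open>e \<in> E\<close> the choice is unique, because the edges listed in
  \<open>es\<close> are distinct.\<close>

definition w :: "nat set \<Rightarrow> real" where
  "w e = real (snd (SOME x. x \<in> set es \<and> edge_of (fst x) = e))"

lemma edge_of_inj: "a \<in> fst ` set es \<Longrightarrow> b \<in> fst ` set es \<Longrightarrow> edge_of a = edge_of b \<Longrightarrow> a = b"
  using distinct_es by (auto simp: distinct_map inj_on_def)

lemma edge_of_inj_on: "inj_on edge_of (fst ` set es)"
  using edge_of_inj by (rule inj_onI)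

lemma E_eq: "E = edge_of ` fst ` set es"
  using set_es by (simp add: image_comp)

lemma edge_of_fst_inj: "inj_on (edge_of \<circ> fst) (set es)"
  using distinct_es by (simp add: distinct_map)

lemma w_es: "x \<in> set es \<Longrightarrow> w (edge_of (fst x)) = real (snd x)"
proof -
  assume x: "x \<in> set es"
  have "(SOME y. y \<in> set es \<and> edge_of (fst y) = edge_of (fst x)) = x"
    by (rule some_equality) (use x edge_of_fst_inj in \<open>auto simp: inj_on_def\<close>)
  then show ?thesis by (simp add: w_def)
qed

lemma partner_iff:
  assumes "a \<in> fst ` set es" "b \<in> fst ` set es"
  shows "partner (map fst es) a b \<longleftrightarrow> two_cut (edge_of a) (edge_of b)"
proof -
  have "edge_of ` set (filter (\<lambda>g. g \<noteq> a \<and> g \<noteq> b) (map fst es)) = E - {edge_of a, edge_of b}"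
  proof -
    have "set (filter (\<lambda>g. g \<noteq> a \<and> g \<noteq> b) (map fst es)) = fst ` set es - {a, b}" by auto
    then show ?thesis
      unfolding E_eq using inj_on_image_set_diff[OF edge_of_inj_on, of "fst ` set es" "{a, b}"] assms by simp
  qed
  moreover have "edge_of a \<in> E" "edge_of b \<in> E" using assms E_eq by auto
  moreover have "edge_of a = {fst a, snd a}" by (simp add: edge_of_def)
  moreover have "b \<noteq> a \<longleftrightarrow> edge_of b \<noteq> edge_of a" using assms edge_of_inj by blast
  ultimately show ?thesis
    unfolding partner_def linked_iff using two_cut_iff[of "fst a" "snd a" "edge_of b"] by simp
qed

lemma partner_weight_eq:
  assumes "a \<in> fst ` set es"
  shows "real (partner_weight es a) = penalty w (edge_of a)"
proof -
  let ?P = "\<lambda>f. two_cut (edge_of a) (edge_of (fst f))"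
  have "filter (\<lambda>f. partner (map fst es) a (fst f)) es = filter ?P es"
    by (rule filter_cong) (use assms partner_iff in auto)
  then have "partner_weight es a = (\<Sum>f\<leftarrow>filter ?P es. snd f)" by (simp add: partner_weight_def)
  also have "\<dots> = (\<Sum>f\<in>{f \<in> set es. ?P f}. snd f)"
    using distinct_es by (subst sum_list_distinct_conv_sum_set) (auto simp: distinct_map)
  finally have "real (partner_weight es a) = (\<Sum>f\<in>{f \<in> set es. ?P f}. w ((edge_of \<circ> fst) f))"
    using w_es by simp
  also have "\<dots> = sum w ((edge_of \<circ> fst) ` {f \<in> set es. ?P f})"
    by (rule sum.reindex[symmetric, unfolded o_def]) (use edge_of_fst_inj in \<open>auto simp: inj_on_def\<close>)
  also have "(edge_of \<circ> fst) ` {f \<in> set es. ?P f} = {f. two_cut (edge_of a) f}"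
    using set_es two_cut_edges by (auto simp: image_iff)
  finally show ?thesis by (simp add: penalty_def)
qed

lemma fst_xs: "map fst xs = map fst es"
  by (simp add: xs_def items_def comp_def)

lemma edge_inj: "inj_on edge (set xs)" and distinct_xs: "distinct xs" and edge_xs: "edge ` set xs = E"
proof -
  have "map edge xs = map (edge_of \<circ> fst) es"
    by (simp add: xs_def items_def edge_def)
  then have "distinct (map edge xs)" "set (map edge xs) = E"
    using distinct_es set_es by auto
  then show "inj_on edge (set xs)" "distinct xs" "edge ` set xs = E"
    by (auto simp: distinct_map)
qed

lemma xs_weight: "x \<in> set xs \<Longrightarrow> real (fst (snd x)) = w (edge x)"
  and xs_penalty: "x \<in> set xs \<Longrightarrow> real (snd (snd x)) = penalty w (edge x)"
proof -
  assume "x \<in> set xs"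
  then obtain y where "y \<in> set es" "x = (fst y, snd y, partner_weight es (fst y))"
    by (auto simp: xs_def items_def)
  then show "real (fst (snd x)) = w (edge x)" "real (snd (snd x)) = penalty w (edge x)"
    using w_es[of y] partner_weight_eq[of "fst y"] by (simp_all add: edge_def)
qed

lemma xs_key: "x \<in> set xs \<Longrightarrow> real (key x) = excess w (edge x)"
  using xs_weight[of x] xs_penalty[of x] by (auto simp: key_def excess_def min_def)

lemma w_nonneg: "0 \<le> w e"
  by (simp add: w_def)

lemma sum_items:
  fixes g :: "nat set \<Rightarrow> real"
  assumes "distinct zs" "set zs \<subseteq> set xs"
  shows "(\<Sum>x\<leftarrow>zs. g (edge x)) = sum g (edge ` set zs)"
  using assms edge_inj by (simp add: sum_list_distinct_conv_sum_set sum.reindex inj_on_subset)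

definition Tl :: "item list" where "Tl = kruskal (isort lighter xs)"

definition T :: "nat set set" where "T = edge ` set Tl"

lemma Tl_subset: "set Tl \<subseteq> set xs" and distinct_Tl: "distinct Tl"
  using kruskal_subset[of "isort lighter xs"] distinct_kruskal[of "isort lighter xs"] distinct_xs
  by (auto simp: Tl_def)

sublocale rooted_tree V E T "excess w" r
proof
  show TE: "T \<subseteq> E" using Tl_subset edge_xs by (auto simp: T_def)
  show "\<not> con (T - {{a, b}}) a b" if "{a, b} \<in> T" for a b
    using kruskal_forest[of "isort lighter xs" a b] that edge_inj distinct_xs by (simp add: T_def Tl_def)
  show "con {t \<in> T. excess w t \<le> excess w {a, b}} a b" if ab: "{a, b} \<in> E" for a b
  proof -
    obtain x where x: "x \<in> set xs" "edge x = {a, b}" using ab edge_xs by auto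
    have "sorted (map key (isort lighter xs))" by (rule sorted_isort) (rule lighter_iff)
    from kruskal_bottleneck[OF this, of x] x(1)
    have "con (edge ` {t \<in> set Tl. key t \<le> key x}) (fst (fst x)) (snd (fst x))" by (simp add: Tl_def)
    moreover have "edge ` {t \<in> set Tl. key t \<le> key x} \<subseteq> {t \<in> T. excess w t \<le> excess w {a, b}}"
    proof
      fix e assume "e \<in> edge ` {t \<in> set Tl. key t \<le> key x}"
      then obtain t where t: "t \<in> set Tl" "key t \<le> key x" "e = edge t" by blast
      then have "excess w (edge t) \<le> excess w (edge x)"
        using xs_key[OF x(1)] xs_key[of t] Tl_subset by (metis of_nat_le_iff subsetD)
      then show "e \<in> {t \<in> T. excess w t \<le> excess w {a, b}}" using t x by (simp add: T_def)
    qed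
    ultimately have c: "con {t \<in> T. excess w t \<le> excess w {a, b}} (fst (fst x)) (snd (fst x))"
      using con_mono by blast
    have "a = fst (fst x) \<and> b = snd (fst x) \<or> a = snd (fst x) \<and> b = fst (fst x)"
      using x(2) by (auto simp: edge_eq doubleton_eq_iff)
    then show ?thesis using c con_sym by blast
  qed
qed (rule root)

definition F :: "edge list" where "F = map fst Tl"

lemma F_es: "set F \<subseteq> fst ` set es"
  using Tl_subset fst_xs unfolding F_def by (metis image_mono list.set_map)

lemma distinct_F: "distinct F" and edge_of_F: "edge_of ` set F = T"
proof -
  have "inj_on fst (set Tl)"
    using inj_on_subset[OF edge_inj Tl_subset] by (auto simp: inj_on_def edge_def)
  then show "distinct F" using distinct_Tl by (simp add: F_def distinct_map)
  show "edge_of ` set F = T" by (simp add: F_def T_def edge_def image_image)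
qed

lemma below_iff:
  assumes "e \<in> set F" "v \<in> V"
  shows "below F r e v \<longleftrightarrow> v \<in> under (edge_of e)"
proof -
  have "edge_of ` set (filter (\<lambda>f. f \<noteq> e) F) = T - {edge_of e}"
  proof -
    have "set (filter (\<lambda>f. f \<noteq> e) F) = set F - {e}" by auto
    then show ?thesis
      unfolding edge_of_F[symmetric] using inj_on_image_set_diff[OF edge_of_inj_on, of "set F" "{e}"] assms(1) F_es
      by auto
  qed
  then show ?thesis using assms(2) by (simp add: below_def linked_iff under_def)
qed

lemma ends_V: "x \<in> set xs \<Longrightarrow> fst (fst x) \<in> V \<and> snd (fst x) \<in> V"
  using edge_xs edgeD[of "fst (fst x)" "snd (fst x)"] by (auto simp: edge_eq)

lemma crosses_iff:
  assumes "e \<in> set F" "x \<in> set xs"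
  shows "crosses F r e (fst x) \<longleftrightarrow> spans (edge_of e) (edge x)"
    and "crosses F r e (fst x) \<longleftrightarrow> (fst (fst x) \<in> under (edge_of e)) \<noteq> (snd (fst x) \<in> under (edge_of e))"
proof -
  have "edge x \<in> E" using assms(2) edge_xs by blast
  then show "crosses F r e (fst x) \<longleftrightarrow> spans (edge_of e) (edge x)"
    unfolding edge_eq using below_iff[OF assms(1)] ends_V[OF assms(2)]
    by (simp add: crosses_def spans_iff)
  show "crosses F r e (fst x) \<longleftrightarrow> (fst (fst x) \<in> under (edge_of e)) \<noteq> (snd (fst x) \<in> under (edge_of e))"
    using below_iff[OF assms(1)] ends_V[OF assms(2)] by (simp add: crosses_def)
qed

lemma depth_eq:
  assumes "x \<in> set xs"
  shows "depth F r (fst x) =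
    card {e \<in> set F. fst (fst x) \<in> under (edge_of e) \<and> snd (fst x) \<in> under (edge_of e)}"
proof -
  have "filter (\<lambda>e. below F r e (fst (fst x)) \<and> below F r e (snd (fst x))) F =
    filter (\<lambda>e. fst (fst x) \<in> under (edge_of e) \<and> snd (fst x) \<in> under (edge_of e)) F"
    by (rule filter_cong) (use below_iff ends_V[OF assms] in auto)
  then show ?thesis unfolding depth_def using distinct_F
    by (simp add: distinct_card[symmetric])
qed

definition ls :: "item list" where
  "ls = isort (\<lambda>l l'. depth F r (fst l) < depth F r (fst l')) (filter (\<lambda>x. x \<notin> set Tl) xs)"

lemma set_ls: "set ls = set xs - set Tl" and distinct_ls: "distinct ls"
  using distinct_xs by (auto simp: ls_def)

lemma sorted_ls: "sorted (map (\<lambda>l. depth F r (fst l)) ls)"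
  unfolding ls_def by (rule sorted_isort) simp

text \<open>A set crossed by \<open>l\<close> contains exactly one end of \<open>l\<close>, and
  which one decides its group. Within a group, laminarity and the order by depth make the earlier
  crossings nested.\<close>

sublocale greedy_colouring "set F" "\<lambda>e x. crosses F r e (fst x)" ls
proof
  show "distinct ls" by (rule distinct_ls)
  fix as l bs assume ls: "ls = as @ l # bs"
  have l: "l \<in> set xs" and as: "set as \<subseteq> set xs" using ls set_ls by auto
  have deep: "depth F r (fst a) \<le> depth F r (fst l)" if "a \<in> set as" for a
    using sorted_ls that unfolding ls by (auto simp: sorted_append)
  obtain u v where uv: "fst l = (u, v)" by (cases "fst l")
  have lam: "under (edge_of e) \<subseteq> under (edge_of f) \<or> under (edge_of f) \<subseteq> under (edge_of e)"
    if "e \<in> set F" "f \<in> set F" "z \<in> under (edge_of e)" "z \<in> under (edge_of f)" for e f z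
    using under_laminar[of "edge_of e" "edge_of f" z] that edge_of_F by blast
  have deep': "card {g \<in> set F. a \<in> under (edge_of g) \<and> b \<in> under (edge_of g)}
      \<le> card {g \<in> set F. u \<in> under (edge_of g) \<and> v \<in> under (edge_of g)}" if "(a, b) \<in> fst ` set as" for a b
  proof -
    obtain x where x: "x \<in> set as" "fst x = (a, b)" using \<open>(a, b) \<in> fst ` set as\<close> by auto
    show ?thesis using deep[OF x(1)] depth_eq[of x] depth_eq[OF l] x as uv by auto
  qed
  have chain: "(\<forall>l'\<in>set as. crosses F r e (fst l') \<longrightarrow> crosses F r f (fst l')) \<or>
      (\<forall>l'\<in>set as. crosses F r f (fst l') \<longrightarrow> crosses F r e (fst l'))"
    if e: "e \<in> set F" "p \<in> under (edge_of e)" "q \<notin> under (edge_of e)"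
      and f: "f \<in> set F" "p \<in> under (edge_of f)" "q \<notin> under (edge_of f)"
      and pq: "(p, q) = (u, v) \<or> (p, q) = (v, u)" for e f p q
  proof -
    have "card {g \<in> set F. p \<in> under (edge_of g) \<and> q \<in> under (edge_of g)} =
        card {g \<in> set F. u \<in> under (edge_of g) \<and> v \<in> under (edge_of g)}"
      using pq by (auto simp: conj_commute)
    with laminar_two_chains[of "set F" "\<lambda>e. under (edge_of e)" e p q f "fst ` set as"] lam e f deep'
    have "(\<forall>(a, b)\<in>fst ` set as. (a \<in> under (edge_of e)) \<noteq> (b \<in> under (edge_of e)) \<longrightarrow>
          (a \<in> under (edge_of f)) \<noteq> (b \<in> under (edge_of f))) \<or>
       (\<forall>(a, b)\<in>fst ` set as. (a \<in> under (edge_of f)) \<noteq> (b \<in> under (edge_of f)) \<longrightarrow>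
          (a \<in> under (edge_of e)) \<noteq> (b \<in> under (edge_of e)))"
      by simp
    moreover have "crosses F r g (fst x) \<longleftrightarrow>
        (fst (fst x) \<in> under (edge_of g)) \<noteq> (snd (fst x) \<in> under (edge_of g))"
      if "g \<in> set F" "x \<in> set as" for g x
      using crosses_iff(2)[of g x] that as by blast
    ultimately show ?thesis using e(1) f(1) by (simp add: case_prod_beta)
  qed
  show "\<exists>side. \<forall>e\<in>set F. \<forall>f\<in>set F. crosses F r e (fst l) \<longrightarrow> crosses F r f (fst l) \<longrightarrow>
      side e = (side f :: bool) \<longrightarrow>
      (\<forall>l'\<in>set as. crosses F r e (fst l') \<longrightarrow> crosses F r f (fst l')) \<or>
      (\<forall>l'\<in>set as. crosses F r f (fst l') \<longrightarrow> crosses F r e (fst l'))"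
  proof (intro exI[of _ "\<lambda>e. u \<in> under (edge_of e)"] ballI impI)
    fix e f assume e: "e \<in> set F" and f: "f \<in> set F"
      and cr: "crosses F r e (fst l)" "crosses F r f (fst l)"
      and side: "(u \<in> under (edge_of e)) = (u \<in> under (edge_of f))"
    have cre: "(u \<in> under (edge_of e)) \<noteq> (v \<in> under (edge_of e))"
      and crf: "(u \<in> under (edge_of f)) \<noteq> (v \<in> under (edge_of f))"
      using cr crosses_iff(2)[OF e l] crosses_iff(2)[OF f l] uv by auto
    show "(\<forall>l'\<in>set as. crosses F r e (fst l') \<longrightarrow> crosses F r f (fst l')) \<or>
      (\<forall>l'\<in>set as. crosses F r f (fst l') \<longrightarrow> crosses F r e (fst l'))"
    proof (cases "u \<in> under (edge_of e)")
      case True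
      then show ?thesis using chain[OF e, of u v f] f cre crf side by simp
    next
      case False
      then show ?thesis using chain[OF e, of v u f] f cre crf side by simp
    qed
  qed
qed

definition cs :: "(item \<times> nat) list" where "cs = tree_links r Tl xs"

lemma cs_eq: "cs = fold extend ls []"
proof -
  have ext: "extend = (\<lambda>l acc. (l, if \<not> clash F r acc l 0 then 0 else if \<not> clash F r acc l 1 then 1 else 2) # acc)"
    by (intro ext) (simp add: extend_def bad_def clash_def)
  show ?thesis unfolding ext by (simp only: cs_def tree_links_def colouring_def ls_def F_def)
qed

lemma cs_fst: "map fst cs = rev ls" and cs_snd: "a \<in> set cs \<Longrightarrow> snd a < 3"
  and cs_cover: "e \<in> set F \<Longrightarrow> l \<in> set ls \<Longrightarrow> l' \<in> set ls \<Longrightarrow> crosses F r e (fst l) \<Longrightarrow>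
    crosses F r e (fst l') \<Longrightarrow> l \<noteq> l' \<Longrightarrow> \<exists>a\<in>set cs. crosses F r e (fst (fst a)) \<and> snd a \<noteq> c"
  unfolding cs_eq by (fact colouring)+

end

section \<open>Feasibility and weight of the three candidates\<close>

lemma sum_list_filter_bex_le:
  fixes f :: "'a \<Rightarrow> nat"
  shows "(\<Sum>x\<leftarrow>filter (\<lambda>x. \<exists>a\<in>set as. P a x) zs. f x) \<le> (\<Sum>a\<leftarrow>as. \<Sum>x\<leftarrow>filter (P a) zs. f x)"
proof (induction as)
  case (Cons a as)
  have "(\<Sum>x\<leftarrow>filter (\<lambda>x. Q x \<or> R x) zs. f x) \<le> (\<Sum>x\<leftarrow>filter Q zs. f x) + (\<Sum>x\<leftarrow>filter R zs. f x)" for Q R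
    by (induction zs) auto
  from order_trans[OF this[of "P a" "\<lambda>x. \<exists>a\<in>set as. P a x"] add_left_mono[OF Cons.IH]]
  show ?case by simp
qed simp

text \<open>A dropped link is missing from one of the three candidates and is then paid for by its penalty.\<close>

lemma sum_dropped:
  assumes "\<forall>a\<in>set cs. snd a < 3"
  shows "(\<Sum>i\<leftarrow>[0, 1, 2]. (\<Sum>a\<leftarrow>filter (\<lambda>a. \<not> dropped i a) cs. fst (snd (fst a))) +
      (\<Sum>a\<leftarrow>filter (dropped i) cs. snd (snd (fst a)))) =
    (\<Sum>a\<leftarrow>cs. 2 * fst (snd (fst a)) + min (fst (snd (fst a))) (snd (snd (fst a))))"
  using assms
proof (induction cs)
  case (Cons a cs)
  have "snd a = 0 \<or> snd a = 1 \<or> snd a = 2" using Cons.prems by auto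
  then show ?case using Cons by (auto simp: dropped_def)
qed simp

context edge_list_instance
begin

definition cand :: "nat \<Rightarrow> item list" where
  "cand i = candidate (map fst xs) Tl cs i"

lemma fst_cs: "a \<in> set cs \<Longrightarrow> fst a \<in> set xs - set Tl"
  using arg_cong[OF cs_fst, of set] set_ls by auto

lemma ls_cs: "y \<in> set ls \<Longrightarrow> \<exists>a\<in>set cs. fst a = y"
  using arg_cong[OF cs_fst, of set] by (metis imageE list.set_map set_rev)

lemma cand_subset: "set (cand i) \<subseteq> set xs"
  using fst_cs Tl_subset by (auto simp: cand_def candidate_def)

lemma edge_T_iff: "x \<in> set xs \<Longrightarrow> edge x \<in> T \<longleftrightarrow> x \<in> set Tl"
  using edge_inj Tl_subset by (auto simp: T_def inj_on_def)

lemma partner_items: "x \<in> set xs \<Longrightarrow> y \<in> set xs \<Longrightarrow> partner (map fst xs) (fst x) (fst y) \<longleftrightarrow> two_cut (edge x) (edge y)"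
  unfolding fst_xs edge_def by (rule partner_iff) (metis fst_xs image_eqI list.set_map)+

text \<open>A tree edge spanned by two links keeps one whose colour is not \<open>i\<close>. If only
  one link spans it, the two are partners, so the link is kept or the tree edge is doubled.\<close>

lemma cand_feasible: "mset (map edge (cand i)) \<in> feasible_2EC V E"
proof -
  let ?M = "mset (map edge (cand i))"
  have M: "set_mset ?M \<subseteq> E" using cand_subset edge_xs by auto
  have "two_edge_connected V ?M"
  proof (rule two_edge_connectedI[OF M])
    show "T \<subseteq> set_mset ?M" by (auto simp: cand_def candidate_def T_def)
    fix e assume e: "e \<in> T"
    then obtain x where x: "x \<in> set Tl" "edge x = e" by (auto simp: T_def)
    have xF: "fst x \<in> set F" "edge_of (fst x) = e" using x by (auto simp: F_def edge_def)
    obtain l where l: "l \<in> E - T" "spans e l" using spanning_link[OF e] .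
    have item: "\<exists>y\<in>set ls. edge y = l'" if l': "l' \<in> E - T" for l'
    proof -
      obtain y where "y \<in> set xs" "edge y = l'" using l' edge_xs by auto
      then show ?thesis using l' set_ls edge_T_iff by blast
    qed
    obtain y where y: "y \<in> set ls" "edge y = l" using item[OF l(1)] by blast
    have cr: "crosses F r (fst x) (fst z) \<longleftrightarrow> spans e (edge z)" if "z \<in> set ls" for z
      using crosses_iff(1)[OF xF(1), of z] that set_ls xF(2) by auto
    show "2 \<le> count ?M e \<or> (\<exists>l\<in>#?M. l \<notin> T \<and> spans e l)"
    proof (cases "\<exists>l'\<in>E - T. spans e l' \<and> l' \<noteq> l")
      case True
      then obtain y' where y': "y' \<in> set ls" "spans e (edge y')" "y' \<noteq> y" using item y(2) by blast
      obtain a where a: "a \<in> set cs" "crosses F r (fst x) (fst (fst a))" "snd a \<noteq> i"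
        using cs_cover[OF xF(1) y(1) y'(1)] cr[OF y(1)] cr[OF y'(1)] l y y' by metis
      have "fst a \<in> set (cand i)" using a by (auto simp: cand_def candidate_def dropped_def)
      moreover have "edge (fst a) \<notin> T" using fst_cs[OF a(1)] edge_T_iff by simp
      moreover have "spans e (edge (fst a))" using a(2) cr[of "fst a"] fst_cs[OF a(1)] set_ls by simp
      ultimately show ?thesis by auto
    next
      case False
      then have le: "two_cut l e" using unique_spanning_link[OF e l] by blast
      obtain a where a: "a \<in> set cs" "fst a = y" using ls_cs[OF y(1)] by blast
      show ?thesis
      proof (cases "dropped i a")
        case True
        let ?R = "filter (\<lambda>x. \<exists>a\<in>set cs. dropped i a \<and> partner (map fst xs) (fst (fst a)) (fst x)) Tl"
        have "partner (map fst xs) (fst y) (fst x)"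
          using partner_items[of y x] le x y Tl_subset set_ls by blast
        then have xR: "x \<in> set ?R" using True a x by auto
        have "0 < count (mset (map edge zs)) e" if "x \<in> set zs" for zs
          using that x(2) by (auto simp: count_greater_zero_iff)
        from this[OF x(1)] this[OF xR]
        have "2 \<le> count (mset (map edge Tl)) e + count (mset (map edge ?R)) e" by linarith
        also have "\<dots> \<le> count ?M e" by (simp add: cand_def candidate_def)
        finally show ?thesis by blast
      next
        case False
        then have "y \<in> set (cand i)" using a by (auto simp: cand_def candidate_def)
        then show ?thesis using l y by auto
      qed
    qed
  qed
  then show ?thesis using M by (simp add: feasible_2EC_def)
qed

lemma total_eq: "set zs \<subseteq> set xs \<Longrightarrow> real (total zs) = weight w (mset (map edge zs))"
  by (induction zs) (auto simp: total_def weight_def xs_weight)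

lemma total_sum: "set zs \<subseteq> set xs \<Longrightarrow> real (total zs) = (\<Sum>x\<leftarrow>zs. w (edge x))"
  by (induction zs) (auto simp: total_def xs_weight)

lemma partners_le_penalty:
  assumes "x \<in> set xs"
  shows "total (filter (\<lambda>y. partner (map fst xs) (fst x) (fst y)) Tl) \<le> snd (snd x)"
proof -
  let ?zs = "filter (\<lambda>y. partner (map fst xs) (fst x) (fst y)) Tl"
  have "real (total ?zs) = (\<Sum>y\<leftarrow>?zs. w (edge y))"
    using Tl_subset by (intro total_sum) auto
  also have "\<dots> = sum w (edge ` set ?zs)"
    using distinct_Tl Tl_subset by (intro sum_items) auto
  also have "\<dots> \<le> sum w {f. two_cut (edge x) f}"
    by (rule sum_mono2[OF finite_two_cut]) (use partner_items[OF assms] Tl_subset w_nonneg in auto)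
  also have "\<dots> = real (snd (snd x))" using xs_penalty[OF assms] by (simp add: penalty_def)
  finally show ?thesis by simp
qed

lemma total_cand:
  "total (cand i) \<le> total Tl + ((\<Sum>a\<leftarrow>filter (\<lambda>a. \<not> dropped i a) cs. fst (snd (fst a))) +
     (\<Sum>a\<leftarrow>filter (dropped i) cs. snd (snd (fst a))))"
proof -
  let ?P = "\<lambda>a x. partner (map fst xs) (fst (fst a)) (fst x)"
  have "total (filter (\<lambda>x. \<exists>a\<in>set (filter (dropped i) cs). ?P a x) Tl)
      \<le> (\<Sum>a\<leftarrow>filter (dropped i) cs. total (filter (?P a) Tl))"
    unfolding total_def by (rule sum_list_filter_bex_le)
  also have "\<dots> \<le> (\<Sum>a\<leftarrow>filter (dropped i) cs. snd (snd (fst a)))"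
    by (rule sum_list_mono) (use partners_le_penalty fst_cs in auto)
  also have "(\<lambda>x. \<exists>a\<in>set (filter (dropped i) cs). ?P a x) = (\<lambda>x. \<exists>a\<in>set cs. dropped i a \<and> ?P a x)"
    unfolding set_filter by blast
  finally show ?thesis
    by (simp add: cand_def candidate_def total_def comp_def)
qed

text \<open>The lightest of three candidates weighs at most their average, and each link appears in
  the three sums with \<open>2 * w\<close> plus the minimum of weight and penalty.\<close>

lemma best_total:
  "3 * real (total (best_candidate (map fst xs) Tl cs)) \<le>
     2 * sum w E + (\<Sum>e\<in>E. min (w e) (penalty w e)) + (\<Sum>e\<in>T. excess w e)"
proof -
  let ?W = "\<lambda>x :: item. fst (snd x)" and ?p = "\<lambda>x :: item. snd (snd x)"
  have "3 * total (best_candidate (map fst xs) Tl cs) \<le> total (cand 0) + total (cand 1) + total (cand 2)"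
    by (simp add: best_candidate_def lightest_def cand_def)
  also have "\<dots> \<le> 3 * total Tl + (\<Sum>a\<leftarrow>cs. 2 * ?W (fst a) + min (?W (fst a)) (?p (fst a)))"
    using total_cand[of 0] total_cand[of 1] total_cand[of 2] sum_dropped[of cs] cs_snd by simp
  also have "(\<Sum>a\<leftarrow>cs. 2 * ?W (fst a) + min (?W (fst a)) (?p (fst a))) = (\<Sum>x\<leftarrow>rev ls. 2 * ?W x + min (?W x) (?p x))"
    unfolding cs_fst[symmetric] by (simp add: comp_def)
  also have "\<dots> = (\<Sum>x\<leftarrow>ls. 2 * ?W x + min (?W x) (?p x))"
    by (simp flip: rev_map)
  finally have "3 * real (total (best_candidate (map fst xs) Tl cs)) \<le>
      3 * real (total Tl) + real (\<Sum>x\<leftarrow>ls. 2 * ?W x + min (?W x) (?p x))"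
    by linarith
  also have "real (\<Sum>x\<leftarrow>ls. 2 * ?W x + min (?W x) (?p x)) =
      (\<Sum>x\<leftarrow>ls. 2 * w (edge x) + min (w (edge x)) (penalty w (edge x)))"
  proof -
    have "real (\<Sum>x\<leftarrow>zs. 2 * ?W x + min (?W x) (?p x)) =
      (\<Sum>x\<leftarrow>zs. 2 * w (edge x) + min (w (edge x)) (penalty w (edge x)))" if "set zs \<subseteq> set xs" for zs
      using that
    proof (induction zs)
      case (Cons z zs)
      then show ?case using xs_weight[of z] xs_penalty[of z] by (simp add: of_nat_min)
    qed simp
    then show ?thesis using set_ls by simp
  qed
  also have "\<dots> = (\<Sum>e\<in>E - T. 2 * w e + min (w e) (penalty w e))"
  proof -
    have "edge ` set ls = E - T"
      unfolding set_ls T_def edge_xs[symmetric] by (rule inj_on_image_set_diff[OF edge_inj]) (use Tl_subset in auto)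
    then show ?thesis
      using sum_items[OF distinct_ls, of "\<lambda>e. 2 * w e + min (w e) (penalty w e)"] set_ls by simp
  qed
  also have "real (total Tl) = sum w T"
  proof -
    show ?thesis using total_sum[OF Tl_subset] sum_items[OF distinct_Tl Tl_subset, of w] by (simp add: T_def)
  qed
  \<comment> \<open>On the tree, three times the weight splits into twice the weight, the minimum of
    weight and penalty, and the excess.\<close>
  also have "3 * sum w T + (\<Sum>e\<in>E - T. 2 * w e + min (w e) (penalty w e)) =
      2 * sum w E + (\<Sum>e\<in>E. min (w e) (penalty w e)) + (\<Sum>e\<in>T. excess w e)"
  proof -
    have split: "sum g E = sum g (E - T) + sum g T" for g :: "nat set \<Rightarrow> real"
      by (rule sum.subset_diff[OF T_sub finite_E])
    show ?thesis
      unfolding split[of w] split[of "\<lambda>e. min (w e) (penalty w e)"] excess_def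
      by (simp add: sum.distrib sum_subtractf flip: sum_distrib_left)
  qed
  finally show ?thesis .
qed

lemma solve_items_correct:
  defines "M \<equiv> mset (map edge_of (solve_items r Tl xs))"
  shows "M \<in> feasible_2EC V E"
    and "\<lbrakk>\<And>e. e \<in> E \<Longrightarrow> 0 \<le> x e; \<And>S. cut E S \<noteq> {} \<Longrightarrow> 2 \<le> (\<Sum>e\<in>cut E S. x e)\<rbrakk> \<Longrightarrow>
      3 * weight w M \<le> 2 * sum w E + (\<Sum>e\<in>E. w e * x e)"
proof -
  let ?b = "best_candidate (map fst xs) Tl cs"
  obtain i where i: "?b = cand i"
    by (simp add: best_candidate_def lightest_def cand_def) metis
  have M: "M = mset (map edge ?b)"
    by (simp add: M_def solve_items_def cs_def edge_def[abs_def] comp_def)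
  show "M \<in> feasible_2EC V E" unfolding M i by (rule cand_feasible)
  assume x: "\<And>e. e \<in> E \<Longrightarrow> 0 \<le> x e" "\<And>S. cut E S \<noteq> {} \<Longrightarrow> 2 \<le> (\<Sum>e\<in>cut E S. x e)"
  interpret minimum_tree V E w x T
    by unfold_locales (use x w_nonneg in auto)
  have "real (total ?b) = weight w M" unfolding M by (rule total_eq) (use i cand_subset in simp)
  then show "3 * weight w M \<le> 2 * sum w E + (\<Sum>e\<in>E. w e * x e)"
    using best_total tree_bound by simp
qed

end

section \<open>The relaxation as a lower bound on the optimum\<close>

context tec_graph
begin

lemma con_crosses:
  assumes "con F u v" "u \<in> S" "v \<notin> S"
  obtains a b where "{a, b} \<in> F" "a \<in> S" "b \<notin> S"
  using con_closed[OF assms(1,2)] assms(3) by blast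

text \<open>Connectedness yields a copy crossing the cut and, after its removal, another one. This
  may be a copy of the same edge, hence the split on \<open>f = e\<close>.\<close>

lemma feasible_cut:
  assumes M: "M \<in> feasible_2EC V E" and S: "cut E S \<noteq> {}"
  shows "2 \<le> (\<Sum>e\<in>cut E S. count M e)"
proof -
  obtain u v where uv: "u \<in> V" "v \<in> V" "u \<in> S" "v \<notin> S"
  proof -
    obtain e where e: "e \<in> cut E S" using S by blast
    then have "e \<in> E" by (simp add: cut_def)
    then obtain a b where ab: "e = {a, b}" "a \<in> V" "b \<in> V" by (rule edgeE)
    then show ?thesis using that[of a b] that[of b a] cut_edge[of a b S] e by blast
  qed
  have ME: "set_mset M \<subseteq> E" using M by (simp add: feasible_2EC_def)
  have crossing: "\<exists>e\<in>#N. e \<in> cut E S" if "connected_graph V (set_mset N)" "N \<subseteq># M" for N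
  proof -
    have "con (set_mset N) u v" using that(1) uv by (simp add: connected_graph_def con_def)
    then obtain a b where ab: "{a, b} \<in># N" "a \<in> S" "b \<notin> S" using uv(3,4) by (rule con_crosses)
    have "{a, b} \<in> E" using subsetD[OF ME mset_subset_eqD[OF that(2) ab(1)]] .
    then have "{a, b} \<in> cut E S" using ab edgeD[of a b] by (subst in_cut_iff) auto
    then show ?thesis using ab by blast
  qed
  have conn: "connected_graph V (set_mset M)" "\<And>e. e \<in># M \<Longrightarrow> connected_graph V (set_mset (M - {#e#}))"
    using M by (auto simp: feasible_2EC_def two_edge_connected_def)
  obtain e where e: "e \<in># M" "e \<in> cut E S" using crossing[OF conn(1)] by blast
  obtain f where f: "f \<in># M - {#e#}" "f \<in> cut E S" using crossing[OF conn(2)[OF e(1)]] by auto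
  have fin: "finite (cut E S)" using finite_E by (simp add: cut_def)
  show ?thesis
  proof (cases "f = e")
    case True
    then have "2 \<le> count M e" using f(1) by (auto simp: in_diff_count)
    also have "\<dots> \<le> (\<Sum>e\<in>cut E S. count M e)" using fin e by (intro member_le_sum) auto
    finally show ?thesis .
  next
    case False
    have "f \<in># M" using f(1) by (rule in_diffD)
    then have "2 \<le> (\<Sum>e\<in>{e, f}. count M e)" using e(1) False by (simp flip: count_greater_zero_iff)
    also have "\<dots> \<le> (\<Sum>e\<in>cut E S. count M e)" using fin e f by (intro sum_mono2) auto
    finally show ?thesis .
  qed
qed

lemma weight_eq_sum: "set_mset M \<subseteq> E \<Longrightarrow> weight w M = (\<Sum>e\<in>E. w e * real (count M e))"
proof (induction M)
  case (add a M)
  have "(\<Sum>e\<in>E. w e * real (count (add_mset a M) e)) =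
      (\<Sum>e\<in>E. w e * real (count M e)) + (\<Sum>e\<in>E. if e = a then w e else 0)"
    unfolding sum.distrib[symmetric] by (rule sum.cong) (auto simp: algebra_simps)
  then show ?case using add finite_E by (simp add: weight_def)
qed (simp add: weight_def)

text \<open>The polytope constrains only proper nonempty subsets of \<open>V\<close>. Intersecting
  with \<open>V\<close> changes no cut, which frees the other arguments from keeping
  \<open>S\<close> inside \<open>V\<close>.\<close>

lemma Subtour_cut: "x \<in> Subtour V E \<Longrightarrow> cut E S \<noteq> {} \<Longrightarrow> 2 \<le> (\<Sum>e\<in>cut E S. x e)"
proof -
  assume x: "x \<in> Subtour V E" and S: "cut E S \<noteq> {}"
  have eq: "cut E (S \<inter> V) = cut E S"
  proof -
    have "e \<inter> (S \<inter> V) = e \<inter> S" if "e \<in> E" for e using edge_card[OF that] by blast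
    then show ?thesis by (auto simp: cut_def)
  qed
  obtain e where e: "e \<in> cut E S" using S by blast
  then have "e \<in> E" by (simp add: cut_def)
  then obtain a b where ab: "e = {a, b}" "a \<in> V" "b \<in> V" by (rule edgeE)
  then have "S \<inter> V \<noteq> {}" "S \<inter> V \<subset> V" using cut_edge[of a b S] e by blast+
  then have "2 \<le> (\<Sum>e\<in>cut E (S \<inter> V). x e)" using x by (simp add: Subtour_def)
  then show ?thesis by (simp only: eq)
qed

lemma Subtour_nonneg: "x \<in> Subtour V E \<Longrightarrow> e \<in> E \<Longrightarrow> 0 \<le> x e"
  by (auto simp: Subtour_def)

lemma SubtourI:
  assumes "\<And>e. e \<in> E \<Longrightarrow> 0 \<le> x e" "\<And>S. cut E S \<noteq> {} \<Longrightarrow> 2 \<le> (\<Sum>e\<in>cut E S. x e)"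
  shows "restrict x E \<in> Subtour V E"
proof -
  have "2 \<le> (\<Sum>e\<in>cut E S. restrict x E e)" if S: "S \<noteq> {}" "S \<subset> V" for S
  proof -
    have "cut E S \<noteq> {}" using S cut_nonempty[of _ _ S] by blast
    moreover have "(\<Sum>e\<in>cut E S. restrict x E e) = (\<Sum>e\<in>cut E S. x e)"
      by (rule sum.cong) (auto simp: cut_def)
    ultimately show ?thesis using assms(2) by simp
  qed
  then show ?thesis using assms(1) by (auto simp: Subtour_def)
qed

lemma Subtour_nonempty: "Subtour V E \<noteq> {}"
proof -
  \<comment> \<open>With the value 2 a single edge already satisfies the constraint of its
    cut.\<close>
  have "restrict (\<lambda>_. 2) E \<in> Subtour V E"
  proof (rule SubtourI)
    fix S assume "cut E S \<noteq> {}"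
    then have "1 \<le> card (cut E S)" using finite_E by (simp add: cut_def Suc_le_eq card_gt_0_iff)
    then show "2 \<le> (\<Sum>e\<in>cut E S. 2 :: real)" by simp
  qed simp
  then show ?thesis by blast
qed

lemma edges_feasible: "mset_set E \<in> feasible_2EC V E"
  using tec finite_E by (simp add: feasible_2EC_def two_edge_connected_graph_def)

context
  fixes w :: "nat set \<Rightarrow> real"
  assumes w: "\<And>e. e \<in> E \<Longrightarrow> 0 \<le> w e"
begin

lemma Subtour_weight_nonneg: "x \<in> Subtour V E \<Longrightarrow> 0 \<le> (\<Sum>e\<in>E. w e * x e)"
  using w Subtour_nonneg by (simp add: sum_nonneg)

lemma subtour_value_le: "x \<in> Subtour V E \<Longrightarrow> subtour_value V E w \<le> (\<Sum>e\<in>E. w e * x e)"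
  unfolding subtour_value_def
proof (rule cINF_lower)
  show "bdd_below ((\<lambda>x. \<Sum>e\<in>E. w e * x e) ` Subtour V E)"
    by (rule bdd_belowI2) (rule Subtour_weight_nonneg)
qed

lemma subtour_value_ge: "(\<And>x. x \<in> Subtour V E \<Longrightarrow> c \<le> (\<Sum>e\<in>E. w e * x e)) \<Longrightarrow> c \<le> subtour_value V E w"
  unfolding subtour_value_def using Subtour_nonempty by (intro cINF_greatest)

lemma subtour_value_nonneg: "0 \<le> subtour_value V E w"
  by (rule subtour_value_ge) (rule Subtour_weight_nonneg)

text \<open>The edge multiplicities of a feasible multigraph form a point of the polytope.\<close>

lemma subtour_value_le_opt: "subtour_value V E w \<le> opt_2EC V E w"
  unfolding opt_2EC_def
proof (rule cINF_greatest)
  show "feasible_2EC V E \<noteq> {}" using edges_feasible by blast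
  fix M assume M: "M \<in> feasible_2EC V E"
  have "restrict (\<lambda>e. real (count M e)) E \<in> Subtour V E"
  proof (rule SubtourI)
    fix S assume "cut E S \<noteq> {}"
    from feasible_cut[OF M this] show "2 \<le> (\<Sum>e\<in>cut E S. real (count M e))"
      by (simp flip: of_nat_sum)
  qed simp
  from subtour_value_le[OF this] show "subtour_value V E w \<le> weight w M"
    using M by (simp add: weight_eq_sum feasible_2EC_def cong: sum.cong)
qed

lemma opt_le_sum: "opt_2EC V E w \<le> sum w E"
proof -
  have "bdd_below (weight w ` feasible_2EC V E)"
    by (rule bdd_belowI2[of _ 0]) (auto simp: weight_eq_sum feasible_2EC_def w intro!: sum_nonneg)
  from cINF_lower[OF this edges_feasible] show ?thesis
    using finite_E by (simp add: opt_2EC_def weight_eq_sum)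
qed

lemma approximation_ratio:
  assumes M: "\<And>x. x \<in> Subtour V E \<Longrightarrow> 3 * c \<le> 2 * sum w E + (\<Sum>e\<in>E. w e * x e)"
    and \<beta>: "sum w E \<le> \<beta> * subtour_value V E w"
  shows "c \<le> (1 + 2 * \<beta>) / 3 * opt_2EC V E w"
proof -
  let ?z = "subtour_value V E w"
  have "3 * c - 2 * sum w E \<le> ?z"
    by (rule subtour_value_ge) (use M in fastforce)
  then have c: "3 * c \<le> (1 + 2 * \<beta>) * ?z" using \<beta> by (simp add: algebra_simps)
  have "(1 + 2 * \<beta>) * ?z \<le> (1 + 2 * \<beta>) * opt_2EC V E w"
  proof (cases "0 \<le> 1 + 2 * \<beta>")
    case True
    then show ?thesis using subtour_value_le_opt by (intro mult_left_mono) auto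
  next
    \<comment> \<open>Here \<beta> is negative. Nonnegativity of the total weight then forces
      \<open>?z = 0\<close>, so the total weight and with it the optimum vanish.\<close>
    case False
    have "0 \<le> sum w E" using w by (rule sum_nonneg)
    then have "0 \<le> \<beta> * ?z" using \<beta> by simp
    then have "?z = 0" using False subtour_value_nonneg by (simp add: zero_le_mult_iff)
    then have "opt_2EC V E w = 0" using \<beta> opt_le_sum subtour_value_le_opt by simp
    then show ?thesis using \<open>?z = 0\<close> by simp
  qed
  then show ?thesis using c by simp
qed

end

end

section \<open>Rational weights and the input encoding\<close>

lemma prod_list_filter_neq:
  "distinct (map f ps) \<Longrightarrow> p \<in> set ps \<Longrightarrow>
     prod_list (map g ps) = g p * prod_list (map g (filter (\<lambda>q. f q \<noteq> f p) ps))" for g :: "'a \<Rightarrow> nat"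
proof (induction ps)
  case (Cons q ps)
  show ?case
  proof (cases "p = q")
    case True
    have "filter (\<lambda>r. f r \<noteq> f q) ps = ps"
      using Cons.prems(1) by (simp add: filter_id_conv) (metis imageI)
    then show ?thesis using True by simp
  next
    case False
    then have "p \<in> set ps" "f q \<noteq> f p" using Cons.prems by (simp, simp) (metis imageI)
    then show ?thesis using Cons by simp
  qed
qed simp

definition fraction :: "rat \<Rightarrow> nat \<times> nat" where
  "fraction q = (nat (fst (quotient_of q)), nat (snd (quotient_of q)))"

lemma fraction_pos: "0 < snd (fraction q)"
  using quotient_of_denom_pos'[of q] by (simp add: fraction_def)

lemma fraction_eq:
  assumes "0 \<le> q"
  shows "real_of_rat q = real (fst (fraction q)) / real (snd (fraction q))"
proof -
  obtain a b where ab: "quotient_of q = (a, b)" by (cases "quotient_of q")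
  have b: "0 < b" using quotient_of_denom_pos[OF ab] .
  have q: "q = of_int a / of_int b" using quotient_of_div[OF ab] .
  then have "0 \<le> a" using assms b by (simp add: zero_le_divide_iff)
  moreover have "real_of_rat q = of_int a / of_int b" unfolding q by (simp add: of_rat_divide)
  ultimately show ?thesis using b by (simp add: fraction_def ab)
qed

text \<open>The prescribed input trees are encodings of ordinary values, so the running-time
  analysis applies to them directly.\<close>

lemma enc_instance_eq:
  "enc_instance vs ps w = encode (vs, map (\<lambda>p. (p, fraction (w (edge_of p)))) ps)"
proof -
  have "enc_list enc_nat vs = encode vs" by (simp add: encode_list_def)
  moreover have "Node (enc_pair p) (enc_rat q) = encode (p, fraction q)" for p q
    by (simp add: enc_pair_def enc_rat_def fraction_def encode_prod_def Let_def split: prod.split)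
  ultimately show ?thesis by (simp add: enc_instance_def encode_map)
qed

lemma encodes_multigraph_encode: "encodes_multigraph (encode ps) (mset (map edge_of ps))"
proof -
  have "enc_pair = encode" by (intro ext) (simp add: enc_pair_def encode_prod_def)
  then have "encode ps = enc_list enc_pair ps" by (simp add: encode_list_def)
  then show ?thesis unfolding encodes_multigraph_def by blast
qed

text \<open>The bound is homogeneous in the weights. Clearing denominators multiplies both sides by
  the positive factor \<open>D\<close>, which cancels.\<close>

lemma algorithm_correct:
  fixes w :: "nat set \<Rightarrow> rat"
  defines "w' \<equiv> real_of_rat \<circ> w"
  assumes G: "two_edge_connected_graph V E" and w: "\<forall>e\<in>E. 0 \<le> w e"
    and \<beta>: "sum w' E \<le> \<beta> * subtour_value V E w'"
    and vs: "set vs = V" and ps: "distinct (map edge_of ps)" "set (map edge_of ps) = E"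
  defines "M \<equiv> mset (map edge_of (algorithm (vs, map (\<lambda>p. (p, fraction (w (edge_of p)))) ps)))"
  shows "M \<in> feasible_2EC V E" "weight w' M \<le> (1 + 2 * \<beta>) / 3 * opt_2EC V E w'"
proof -
  interpret tec_graph V E by unfold_locales (rule G)
  let ?fs = "map (\<lambda>p. (p, fraction (w (edge_of p)))) ps"
  define es where "es = scaled ?fs"
  have fst_es: "map fst es = ps" by (simp add: es_def scaled_def comp_def)
  have es_edges: "map (edge_of \<circ> fst) es = map edge_of ps" by (simp flip: fst_es)
  interpret I: edge_list_instance V E es "hd vs"
  proof
    have "vs \<noteq> []" using V_ne vs by auto
    then show "hd vs \<in> V" using vs by auto
  qed (use ps es_edges in simp_all)
  have M: "M = mset (map edge_of (solve_items (hd vs) I.Tl I.xs))"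
    by (simp only: M_def algorithm_def I.Tl_def I.xs_def fst_conv snd_conv flip: es_def)
  show feasible: "M \<in> feasible_2EC V E" unfolding M by (rule I.solve_items_correct(1))
  define D where "D = (\<Prod>p\<leftarrow>ps. snd (fraction (w (edge_of p))))"
  have D: "0 < D"
    unfolding D_def using fraction_pos by (induction ps) auto
  have dist: "distinct (map fst ?fs)" using ps(1) by (simp add: comp_def distinct_map)
  have scale: "I.w e = real D * w' e" if e: "e \<in> E" for e
  proof -
    obtain p where p: "p \<in> set ps" "e = edge_of p" using e ps(2) by auto
    let ?a = "fst (fraction (w e))" and ?b = "snd (fraction (w e))"
    let ?R = "\<Prod>y\<leftarrow>filter (\<lambda>y. fst y \<noteq> p) ?fs. snd (snd y)"
    have "(p, ?a * ?R) \<in> set es"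
      unfolding es_def scaled_def using p by (auto simp: image_iff)
    then have "I.w e = real (?a * ?R)" using I.w_es p(2) by fastforce
    moreover have "D = ?b * ?R"
      using prod_list_filter_neq[OF dist, of "(p, fraction (w e))" "\<lambda>y. snd (snd y)"] p
      by (simp add: D_def comp_def)
    moreover have "w' e = real ?a / real ?b" using fraction_eq[of "w e"] w e by (simp add: w'_def)
    ultimately show ?thesis using fraction_pos[of "w e"] by simp
  qed
  have w'_nonneg: "0 \<le> w' e" if "e \<in> E" for e
    using w that by (simp add: w'_def)
  show "weight w' M \<le> (1 + 2 * \<beta>) / 3 * opt_2EC V E w'"
  proof (rule approximation_ratio[OF w'_nonneg _ \<beta>])
    fix x assume x: "x \<in> Subtour V E"
    have ME: "set_mset M \<subseteq> E" using feasible by (simp add: feasible_2EC_def)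
    have "3 * weight I.w M \<le> 2 * sum I.w E + (\<Sum>e\<in>E. I.w e * x e)"
      unfolding M by (rule I.solve_items_correct(2)) (use x Subtour_nonneg Subtour_cut in auto)
    moreover have "weight I.w M = real D * weight w' M"
      unfolding weight_eq_sum[OF ME] using scale by (simp add: sum_distrib_left mult.assoc)
    moreover have "sum I.w E = real D * sum w' E"
      using scale by (simp add: sum_distrib_left)
    moreover have "(\<Sum>e\<in>E. I.w e * x e) = real D * (\<Sum>e\<in>E. w' e * x e)"
      using scale by (simp add: sum_distrib_left mult.assoc)
    ultimately have "real D * (3 * weight w' M) \<le> real D * (2 * sum w' E + (\<Sum>e\<in>E. w' e * x e))"
      by (simp add: algebra_simps)
    then show "3 * weight w' M \<le> 2 * sum w' E + (\<Sum>e\<in>E. w' e * x e)"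
      using D by simp
  qed
qed

text \<open>A single program serves every \<beta>, which enters only the analysis of the
  ratio.\<close>

theorem theorem15:
  fixes \<beta> :: real
  shows "\<exists>c. poly_time_approx_2EC ((1 + 2 * \<beta>) / 3)
    {(V, E, w).
       two_edge_connected_graph V E \<and> (\<forall>e\<in>E. w e \<ge> 0) \<and>
       (\<Sum>e\<in>E. real_of_rat (w e)) \<le> \<beta> * subtour_value V E (real_of_rat \<circ> w)} c"
proof -
  let ?I = "{(V, E, w).
       two_edge_connected_graph V E \<and> (\<forall>e\<in>E. w e \<ge> 0) \<and>
       (\<Sum>e\<in>E. real_of_rat (w e)) \<le> \<beta> * subtour_value V E (real_of_rat \<circ> w)}"
  obtain c N p where c: "computes c N p algorithm"
    using ptime_algorithm unfolding ptime_def by blast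
  have "poly_time_approx_2EC ((1 + 2 * \<beta>) / 3) ?I c"
    unfolding poly_time_approx_2EC_def solves_in_poly_time_def
  proof (intro exI[of _ p] ballI)
    fix d assume "d \<in> {d. \<exists>(V, E, w)\<in>?I. encodes_instance d V E w}"
    then obtain inp :: "nat list \<times> (edge \<times> nat \<times> nat) list" where d: "d = encode inp"
      by (auto simp: encodes_instance_def enc_instance_eq simp del: encode_Pair)
    from computesD[OF c, of "(\<lambda>_. Leaf)(0 := d)" inp] obtain t s' where run:
      "exec c ((\<lambda>_. Leaf)(0 := d)) t s'" "t \<le> poly p (size d)" "s' 0 = encode (algorithm inp)"
      by (auto simp: d reaches_def)
    have "\<exists>M. encodes_multigraph (encode (algorithm inp)) M \<and> M \<in> feasible_2EC V E \<and>
        weight (real_of_rat \<circ> w) M \<le> (1 + 2 * \<beta>) / 3 * opt_2EC V E (real_of_rat \<circ> w)"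
      if I: "(V, E, w) \<in> ?I" and enc: "encodes_instance d V E w" for V E w
    proof -
      obtain vs ps where vs: "set vs = V" and ps: "distinct (map edge_of ps)" "set (map edge_of ps) = E"
        and "d = enc_instance vs ps w"
        using enc unfolding encodes_instance_def by blast
      \<comment> \<open>Several instances may share the tree \<open>d\<close>, for example with
        different weights outside \<open>E\<close>. By injectivity of the encoding they all give the
        same input \<open>inp\<close>.\<close>
      then have inp: "inp = (vs, map (\<lambda>p. (p, fraction (w (edge_of p)))) ps)"
        unfolding d enc_instance_eq encode_inject by simp
      have "sum (real_of_rat \<circ> w) E \<le> \<beta> * subtour_value V E (real_of_rat \<circ> w)"
        using I by simp
      from algorithm_correct[OF _ _ this vs ps] I encodes_multigraph_encode[of "algorithm inp"]
      show ?thesis unfolding inp by auto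
    qed
    then show "\<exists>t output. runs c d t output \<and> t \<le> poly p (size d) \<and>
        output \<in> {d'. \<forall>(V, E, w)\<in>?I. encodes_instance d V E w \<longrightarrow>
          (\<exists>M. encodes_multigraph d' M \<and> M \<in> feasible_2EC V E \<and>
             weight (real_of_rat \<circ> w) M \<le> (1 + 2 * \<beta>) / 3 * opt_2EC V E (real_of_rat \<circ> w))}"
      using run unfolding runs_def by blast
  qed
  then show ?thesis by blast
qed

end
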